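(* Let $R$ be a Noetherian local ring, let $C$ be a semidualizing $R$-module, and let $n$ be a non-negative integer. Let $M$ and $N$ be finitely generated $R$-modules such that $N\in\mathcal{A}_C(R)$ and $\operatorname{Ext}_R^i(M,N)\in\mathcal{A}_C(R)$ for all $0\leq i\leq n$. Then, for all $0\leq i\leq n$, there is a natural isomorphism $$\operatorname{Ext}_R^i(M,N)\otimes_R C\cong\operatorname{Ext}_R^i(M,N\otimes_R C).$$
   Context: All rings are commutative with unit. A finitely generated $R$-module $C$ is semidualizing if the homothety map $R\to\operatorname{Hom}_R(C,C)$ is an isomorphism and $\operatorname{Ext}_R^i(C,C)=0$ for all $i\geq1$. The Auslander class $\mathcal{A}_C(R)$ consists of all $R$-modules $X$ such that $\operatorname{Tor}_i^R(C,X)=0$ for all $i\geq1$, $\operatorname{Ext}_R^i(C,C\otimes_R X)=0$ for all $i\geq1$, and the natural map $X\to\operatorname{Hom}_R(C,C\otimes_R X)$, $x\mapsto(c\mapsto c\otimes x)$, is an isomorphism. *)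

theory Defs
  imports "HOL-Algebra.Module" "HOL-Algebra.Ring_Divisibility"
begin

text \<open>
  Modules over a commutative ring are the records of \<^theory>\<open>HOL-Algebra.Module\<close>. Such a record
  carries ring fields \<open>mult\<close> and \<open>one\<close> that play no role in the locale \<^locale>\<open>module\<close>; they are left
  \<^term>\<open>undefined\<close> in the modules constructed below.
\<close>

section \<open>Rings\<close>

definition noetherian_local_ring :: "('a, 'r) ring_scheme \<Rightarrow> bool" where
  "noetherian_local_ring R \<longleftrightarrow> cring R \<and> noetherian_ring R \<and> (\<exists>!\<mm>. maximalideal \<mm> R)"

section \<open>Modules\<close>

definition linear_map ::
    "('a, 'r) ring_scheme \<Rightarrow> ('a, 'm) module \<Rightarrow> ('a, 'n) module \<Rightarrow> ('m \<Rightarrow> 'n) \<Rightarrow> bool" where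
  "linear_map R M N f \<longleftrightarrow>
     f \<in> carrier M \<rightarrow> carrier N \<and>
     (\<forall>x\<in>carrier M. \<forall>y\<in>carrier M. f (x \<oplus>\<^bsub>M\<^esub> y) = f x \<oplus>\<^bsub>N\<^esub> f y) \<and>
     (\<forall>r\<in>carrier R. \<forall>x\<in>carrier M. f (r \<odot>\<^bsub>M\<^esub> x) = r \<odot>\<^bsub>N\<^esub> f x)"

definition module_iso ::
    "('a, 'r) ring_scheme \<Rightarrow> ('a, 'm) module \<Rightarrow> ('a, 'n) module \<Rightarrow> ('m \<Rightarrow> 'n) \<Rightarrow> bool" where
  "module_iso R M N f \<longleftrightarrow> linear_map R M N f \<and> bij_betw f (carrier M) (carrier N)"

definition zero_module :: "('a, 'm) module \<Rightarrow> bool" where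
  "zero_module M \<longleftrightarrow> carrier M = {\<zero>\<^bsub>M\<^esub>}"

definition module_span :: "('a, 'r) ring_scheme \<Rightarrow> ('a, 'm) module \<Rightarrow> 'm set \<Rightarrow> 'm set" where
  "module_span R M S = \<Inter> {U. submodule U R M \<and> S \<subseteq> U}"

definition fg_module :: "('a, 'r) ring_scheme \<Rightarrow> ('a, 'm) module \<Rightarrow> bool" where
  "fg_module R M \<longleftrightarrow> module R M \<and>
     (\<exists>S. finite S \<and> S \<subseteq> carrier M \<and> module_span R M S = carrier M)"

definition regular_module :: "('a, 'r) ring_scheme \<Rightarrow> ('a, 'a) module" where
  "regular_module R =
     \<lparr>carrier = carrier R, mult = mult R, one = one R, zero = zero R, add = add R, smult = mult R\<rparr>"

definition quotient_module :: "('a, 'm) module \<Rightarrow> 'm set \<Rightarrow> ('a, 'm set) module" where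
  "quotient_module M U =
     \<lparr>carrier = a_rcosets\<^bsub>M\<^esub> U, mult = undefined, one = undefined, zero = U,
      add = (\<lambda>X Y. X <+>\<^bsub>M\<^esub> Y), smult = (\<lambda>r X. \<Union>x\<in>X. U +>\<^bsub>M\<^esub> (r \<odot>\<^bsub>M\<^esub> x))\<rparr>"

text \<open>Homomorphisms are made extensional, so that equality of elements of \<open>Hom(M,N)\<close> is equality of
  functions on the carrier of \<open>M\<close>.\<close>

definition hom_module ::
    "('a, 'r) ring_scheme \<Rightarrow> ('a, 'm) module \<Rightarrow> ('a, 'n) module \<Rightarrow> ('a, 'm \<Rightarrow> 'n) module" where
  "hom_module R M N =
     \<lparr>carrier = {f \<in> extensional (carrier M). linear_map R M N f}, mult = undefined, one = undefined,
      zero = (\<lambda>x\<in>carrier M. \<zero>\<^bsub>N\<^esub>), add = (\<lambda>f g. \<lambda>x\<in>carrier M. f x \<oplus>\<^bsub>N\<^esub> g x),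
      smult = (\<lambda>r f. \<lambda>x\<in>carrier M. r \<odot>\<^bsub>N\<^esub> f x)\<rparr>"

text \<open>The free module with basis \<open>I\<close>: finitely supported families of scalars indexed by \<open>I\<close>.\<close>

definition free_module :: "('a, 'r) ring_scheme \<Rightarrow> 'i set \<Rightarrow> ('a, 'i \<Rightarrow> 'a) module" where
  "free_module R I =
     \<lparr>carrier = {v. (\<forall>i. v i \<in> carrier R) \<and> finite {i. v i \<noteq> \<zero>\<^bsub>R\<^esub>} \<and> {i. v i \<noteq> \<zero>\<^bsub>R\<^esub>} \<subseteq> I},
      mult = undefined, one = undefined,
      zero = (\<lambda>i. \<zero>\<^bsub>R\<^esub>), add = (\<lambda>v w i. v i \<oplus>\<^bsub>R\<^esub> w i), smult = (\<lambda>r v i. r \<otimes>\<^bsub>R\<^esub> v i)\<rparr>"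

definition free_gen :: "('a, 'r) ring_scheme \<Rightarrow> 'i \<Rightarrow> 'i \<Rightarrow> 'a" where
  "free_gen R i = (\<lambda>j. if j = i then \<one>\<^bsub>R\<^esub> else \<zero>\<^bsub>R\<^esub>)"

section \<open>Tensor products\<close>

definition tensor_rels ::
    "('a, 'r) ring_scheme \<Rightarrow> ('a, 'm) module \<Rightarrow> ('a, 'n) module \<Rightarrow> ('m \<times> 'n \<Rightarrow> 'a) set" where
  "tensor_rels R M N = (let F = free_module R (carrier M \<times> carrier N) in
     {free_gen R (x \<oplus>\<^bsub>M\<^esub> x', y) \<ominus>\<^bsub>F\<^esub> (free_gen R (x, y) \<oplus>\<^bsub>F\<^esub> free_gen R (x', y)) | x x' y.
        x \<in> carrier M \<and> x' \<in> carrier M \<and> y \<in> carrier N} \<union>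
     {free_gen R (x, y \<oplus>\<^bsub>N\<^esub> y') \<ominus>\<^bsub>F\<^esub> (free_gen R (x, y) \<oplus>\<^bsub>F\<^esub> free_gen R (x, y')) | x y y'.
        x \<in> carrier M \<and> y \<in> carrier N \<and> y' \<in> carrier N} \<union>
     {free_gen R (r \<odot>\<^bsub>M\<^esub> x, y) \<ominus>\<^bsub>F\<^esub> r \<odot>\<^bsub>F\<^esub> free_gen R (x, y) | r x y.
        r \<in> carrier R \<and> x \<in> carrier M \<and> y \<in> carrier N} \<union>
     {free_gen R (x, r \<odot>\<^bsub>N\<^esub> y) \<ominus>\<^bsub>F\<^esub> r \<odot>\<^bsub>F\<^esub> free_gen R (x, y) | r x y.
        r \<in> carrier R \<and> x \<in> carrier M \<and> y \<in> carrier N})"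

definition tensor_submodule ::
    "('a, 'r) ring_scheme \<Rightarrow> ('a, 'm) module \<Rightarrow> ('a, 'n) module \<Rightarrow> ('m \<times> 'n \<Rightarrow> 'a) set" where
  "tensor_submodule R M N =
     module_span R (free_module R (carrier M \<times> carrier N)) (tensor_rels R M N)"

definition tensor_module ::
    "('a, 'r) ring_scheme \<Rightarrow> ('a, 'm) module \<Rightarrow> ('a, 'n) module \<Rightarrow> ('a, ('m \<times> 'n \<Rightarrow> 'a) set) module"
  where
  "tensor_module R M N =
     quotient_module (free_module R (carrier M \<times> carrier N)) (tensor_submodule R M N)"

definition pure_tensor ::
    "('a, 'r) ring_scheme \<Rightarrow> ('a, 'm) module \<Rightarrow> ('a, 'n) module \<Rightarrow> 'm \<Rightarrow> 'n \<Rightarrow> ('m \<times> 'n \<Rightarrow> 'a) set"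
  where
  "pure_tensor R M N x y =
     tensor_submodule R M N +>\<^bsub>free_module R (carrier M \<times> carrier N)\<^esub> free_gen R (x, y)"

text \<open>The linear map \<open>M \<otimes> N \<rightarrow> P\<close> given by the universal property, for a bilinear \<open>\<beta>\<close>.\<close>

definition tensor_lift ::
    "('a, 'r) ring_scheme \<Rightarrow> ('a, 'm) module \<Rightarrow> ('a, 'n) module \<Rightarrow> ('a, 'p) module \<Rightarrow>
     ('m \<Rightarrow> 'n \<Rightarrow> 'p) \<Rightarrow> ('m \<times> 'n \<Rightarrow> 'a) set \<Rightarrow> 'p" where
  "tensor_lift R M N P \<beta> =
     (THE \<theta>. \<theta> \<in> carrier (hom_module R (tensor_module R M N) P) \<and>
        (\<forall>x\<in>carrier M. \<forall>y\<in>carrier N. \<theta> (pure_tensor R M N x y) = \<beta> x y))"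

definition tensor_map ::
    "('a, 'r) ring_scheme \<Rightarrow> ('a, 'm) module \<Rightarrow> ('a, 'n) module \<Rightarrow>
     ('a, 'p) module \<Rightarrow> ('a, 'q) module \<Rightarrow> ('m \<Rightarrow> 'p) \<Rightarrow> ('n \<Rightarrow> 'q) \<Rightarrow>
     ('m \<times> 'n \<Rightarrow> 'a) set \<Rightarrow> ('p \<times> 'q \<Rightarrow> 'a) set" where
  "tensor_map R M N P Q f g =
     tensor_lift R M N (tensor_module R P Q) (\<lambda>x y. pure_tensor R P Q (f x) (g y))"

section \<open>Complexes\<close>

text \<open>A chain complex has differentials \<open>D n : A (n + 1) \<rightarrow> A n\<close>, a cochain complex has differentials
  \<open>\<delta> n : A n \<rightarrow> A (n + 1)\<close>; both vanish in negative degrees.\<close>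

definition homology :: "(nat \<Rightarrow> ('a, 'm) module) \<Rightarrow> (nat \<Rightarrow> 'm \<Rightarrow> 'm) \<Rightarrow> nat \<Rightarrow> ('a, 'm set) module" where
  "homology A D n =
     quotient_module
       ((A n)\<lparr>carrier := (case n of 0 \<Rightarrow> carrier (A 0)
                           | Suc k \<Rightarrow> {x \<in> carrier (A (Suc k)). D k x = \<zero>\<^bsub>A k\<^esub>})\<rparr>)
       (D n ` carrier (A (Suc n)))"

definition cocycles :: "(nat \<Rightarrow> ('a, 'm) module) \<Rightarrow> (nat \<Rightarrow> 'm \<Rightarrow> 'm) \<Rightarrow> nat \<Rightarrow> 'm set" where
  "cocycles A \<delta> n = {x \<in> carrier (A n). \<delta> n x = \<zero>\<^bsub>A (Suc n)\<^esub>}"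

definition coboundaries :: "(nat \<Rightarrow> ('a, 'm) module) \<Rightarrow> (nat \<Rightarrow> 'm \<Rightarrow> 'm) \<Rightarrow> nat \<Rightarrow> 'm set" where
  "coboundaries A \<delta> n = (case n of 0 \<Rightarrow> {\<zero>\<^bsub>A 0\<^esub>} | Suc k \<Rightarrow> \<delta> k ` carrier (A k))"

definition cohomology ::
    "(nat \<Rightarrow> ('a, 'm) module) \<Rightarrow> (nat \<Rightarrow> 'm \<Rightarrow> 'm) \<Rightarrow> nat \<Rightarrow> ('a, 'm set) module" where
  "cohomology A \<delta> n = quotient_module ((A n)\<lparr>carrier := cocycles A \<delta> n\<rparr>) (coboundaries A \<delta> n)"

text \<open>The map on cohomology induced by a map \<open>\<phi>\<close> of cocycles that preserves coboundaries; the sets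
  in the union then all coincide.\<close>

definition cohomology_map ::
    "(nat \<Rightarrow> ('a, 'm) module) \<Rightarrow> (nat \<Rightarrow> 'm \<Rightarrow> 'm) \<Rightarrow> (nat \<Rightarrow> ('a, 'n) module) \<Rightarrow> (nat \<Rightarrow> 'n \<Rightarrow> 'n) \<Rightarrow>
     nat \<Rightarrow> ('m \<Rightarrow> 'n) \<Rightarrow> 'm set \<Rightarrow> 'n set" where
  "cohomology_map A \<delta> A' \<delta>' n \<phi> =
     (\<lambda>X\<in>carrier (cohomology A \<delta> n). \<Union>z\<in>X. coboundaries A' \<delta>' n +>\<^bsub>A' n\<^esub> \<phi> z)"

section \<open>Free resolutions, Tor and Ext\<close>

text \<open>An exact sequence \<open>\<dots> \<rightarrow> F 2 \<rightarrow> F 1 \<rightarrow> F 0 \<rightarrow> M \<rightarrow> 0\<close>, where \<open>F n\<close> is free with basis \<open>I n\<close>,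
  with differentials \<open>d n : F (n + 1) \<rightarrow> F n\<close> and augmentation \<open>e\<close>.\<close>

definition free_resolution ::
    "('a, 'r) ring_scheme \<Rightarrow> ('a, 'm) module \<Rightarrow>
     (nat \<Rightarrow> 'i set) \<Rightarrow> (nat \<Rightarrow> ('i \<Rightarrow> 'a) \<Rightarrow> ('i \<Rightarrow> 'a)) \<Rightarrow> (('i \<Rightarrow> 'a) \<Rightarrow> 'm) \<Rightarrow> bool" where
  "free_resolution R M I d e \<longleftrightarrow>
     (let F = (\<lambda>n. free_module R (I n)) in
      linear_map R (F 0) M e \<and> e ` carrier (F 0) = carrier M \<and>
      (\<forall>n. linear_map R (F (Suc n)) (F n) (d n)) \<and>
      d 0 ` carrier (F 1) = {x \<in> carrier (F 0). e x = \<zero>\<^bsub>M\<^esub>} \<and>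
      (\<forall>n. d (Suc n) ` carrier (F (Suc (Suc n))) =
             {x \<in> carrier (F (Suc n)). d n x = \<zero>\<^bsub>F n\<^esub>}))"

text \<open>
  A fixed choice of a free resolution of every module. The type \<open>('a \<times> 'm) list\<close> is large enough to
  index one for any module: it is infinite, contains a copy of \<open>M\<close>, and is at least as large as the set of
  finitely supported functions from it to \<open>R\<close>, so that the bases can be chosen successively as
  copies of \<open>M\<close> and of the syzygies.
\<close>

definition chosen_resolution ::
    "('a, 'r) ring_scheme \<Rightarrow> ('a, 'm) module \<Rightarrow>
     (nat \<Rightarrow> ('a \<times> 'm) list set) \<times>
     (nat \<Rightarrow> (('a \<times> 'm) list \<Rightarrow> 'a) \<Rightarrow> (('a \<times> 'm) list \<Rightarrow> 'a)) \<times>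
     ((('a \<times> 'm) list \<Rightarrow> 'a) \<Rightarrow> 'm)" where
  "chosen_resolution R M = (SOME (I, d, e). free_resolution R M I d e)"

definition res_module ::
    "('a, 'r) ring_scheme \<Rightarrow> ('a, 'm) module \<Rightarrow> nat \<Rightarrow> ('a, ('a \<times> 'm) list \<Rightarrow> 'a) module" where
  "res_module R M n = free_module R (fst (chosen_resolution R M) n)"

definition res_diff ::
    "('a, 'r) ring_scheme \<Rightarrow> ('a, 'm) module \<Rightarrow>
     nat \<Rightarrow> (('a \<times> 'm) list \<Rightarrow> 'a) \<Rightarrow> (('a \<times> 'm) list \<Rightarrow> 'a)" where
  "res_diff R M = fst (snd (chosen_resolution R M))"

definition res_aug ::
    "('a, 'r) ring_scheme \<Rightarrow> ('a, 'm) module \<Rightarrow> (('a \<times> 'm) list \<Rightarrow> 'a) \<Rightarrow> 'm" where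
  "res_aug R M = snd (snd (chosen_resolution R M))"

definition Tor ::
    "('a, 'r) ring_scheme \<Rightarrow> nat \<Rightarrow> ('a, 'm) module \<Rightarrow> ('a, 'n) module \<Rightarrow>
     ('a, ((('a \<times> 'm) list \<Rightarrow> 'a) \<times> 'n \<Rightarrow> 'a) set set) module" where
  "Tor R i M N =
     homology (\<lambda>n. tensor_module R (res_module R M n) N)
       (\<lambda>n. tensor_map R (res_module R M (Suc n)) N (res_module R M n) N (res_diff R M n) id) i"

definition ext_complex ::
    "('a, 'r) ring_scheme \<Rightarrow> ('a, 'm) module \<Rightarrow> ('a, 'n) module \<Rightarrow>
     nat \<Rightarrow> ('a, (('a \<times> 'm) list \<Rightarrow> 'a) \<Rightarrow> 'n) module" where
  "ext_complex R M N n = hom_module R (res_module R M n) N"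

definition ext_diff ::
    "('a, 'r) ring_scheme \<Rightarrow> ('a, 'm) module \<Rightarrow> nat \<Rightarrow>
     ((('a \<times> 'm) list \<Rightarrow> 'a) \<Rightarrow> 'n) \<Rightarrow> ((('a \<times> 'm) list \<Rightarrow> 'a) \<Rightarrow> 'n)" where
  "ext_diff R M n \<alpha> = compose (carrier (res_module R M (Suc n))) \<alpha> (res_diff R M n)"

definition Ext ::
    "('a, 'r) ring_scheme \<Rightarrow> nat \<Rightarrow> ('a, 'm) module \<Rightarrow> ('a, 'n) module \<Rightarrow>
     ('a, ((('a \<times> 'm) list \<Rightarrow> 'a) \<Rightarrow> 'n) set) module" where
  "Ext R i M N = cohomology (ext_complex R M N) (ext_diff R M) i"

text \<open>\<open>Ext i (M, g) : Ext i (M, N) \<rightarrow> Ext i (M, N')\<close> for \<open>g : N \<rightarrow> N'\<close>\<close>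

definition Ext_map_right ::
    "('a, 'r) ring_scheme \<Rightarrow> nat \<Rightarrow> ('a, 'm) module \<Rightarrow> ('a, 'n) module \<Rightarrow> ('a, 'p) module \<Rightarrow>
     ('n \<Rightarrow> 'p) \<Rightarrow> ((('a \<times> 'm) list \<Rightarrow> 'a) \<Rightarrow> 'n) set \<Rightarrow> ((('a \<times> 'm) list \<Rightarrow> 'a) \<Rightarrow> 'p) set" where
  "Ext_map_right R i M N N' g =
     cohomology_map (ext_complex R M N) (ext_diff R M) (ext_complex R M N') (ext_diff R M) i
       (\<lambda>\<alpha>. compose (carrier (res_module R M i)) g \<alpha>)"

text \<open>Chain maps between the chosen resolutions that lift \<open>f : M' \<rightarrow> M\<close>. Any two are homotopic,
  so it does not matter for Ext which one is picked.\<close>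

definition chain_lift ::
    "('a, 'r) ring_scheme \<Rightarrow> ('a, 'k) module \<Rightarrow> ('a, 'm) module \<Rightarrow> ('k \<Rightarrow> 'm) \<Rightarrow>
     (nat \<Rightarrow> (('a \<times> 'k) list \<Rightarrow> 'a) \<Rightarrow> (('a \<times> 'm) list \<Rightarrow> 'a)) \<Rightarrow> bool" where
  "chain_lift R M' M f \<phi> \<longleftrightarrow>
     (\<forall>n. linear_map R (res_module R M' n) (res_module R M n) (\<phi> n)) \<and>
     (\<forall>x\<in>carrier (res_module R M' 0). res_aug R M (\<phi> 0 x) = f (res_aug R M' x)) \<and>
     (\<forall>n. \<forall>x\<in>carrier (res_module R M' (Suc n)).
        res_diff R M n (\<phi> (Suc n) x) = \<phi> n (res_diff R M' n x))"

text \<open>\<open>Ext i (f, N) : Ext i (M, N) \<rightarrow> Ext i (M', N)\<close> for \<open>f : M' \<rightarrow> M\<close>\<close>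

definition Ext_map_left ::
    "('a, 'r) ring_scheme \<Rightarrow> nat \<Rightarrow> ('a, 'k) module \<Rightarrow> ('a, 'm) module \<Rightarrow> ('a, 'n) module \<Rightarrow>
     ('k \<Rightarrow> 'm) \<Rightarrow> ((('a \<times> 'm) list \<Rightarrow> 'a) \<Rightarrow> 'n) set \<Rightarrow> ((('a \<times> 'k) list \<Rightarrow> 'a) \<Rightarrow> 'n) set" where
  "Ext_map_left R i M' M N f =
     cohomology_map (ext_complex R M N) (ext_diff R M) (ext_complex R M' N) (ext_diff R M') i
       (\<lambda>\<alpha>. compose (carrier (res_module R M' i)) \<alpha> ((SOME \<phi>. chain_lift R M' M f \<phi>) i))"

section \<open>Semidualizing modules and the Auslander class\<close>

definition semidualizing :: "('a, 'r) ring_scheme \<Rightarrow> ('a, 'c) module \<Rightarrow> bool" where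
  "semidualizing R C \<longleftrightarrow>
     fg_module R C \<and>
     module_iso R (regular_module R) (hom_module R C C) (\<lambda>r. \<lambda>c\<in>carrier C. r \<odot>\<^bsub>C\<^esub> c) \<and>
     (\<forall>i\<ge>1. zero_module (Ext R i C C))"

definition auslander_class ::
    "('a, 'r) ring_scheme \<Rightarrow> ('a, 'c) module \<Rightarrow> ('a, 'x) module \<Rightarrow> bool" where
  "auslander_class R C X \<longleftrightarrow>
     module R X \<and>
     (\<forall>i\<ge>1. zero_module (Tor R i C X)) \<and>
     (\<forall>i\<ge>1. zero_module (Ext R i C (tensor_module R C X))) \<and>
     module_iso R X (hom_module R C (tensor_module R C X))
       (\<lambda>x. \<lambda>c\<in>carrier C. pure_tensor R C X c x)"

section \<open>The comparison map\<close>

text \<open>The canonical map \<open>Ext i (M, N) \<otimes> C \<rightarrow> Ext i (M, N \<otimes> C)\<close>. It sends \<open>\<xi> \<otimes> c\<close> to the image of \<open>\<xi>\<close> under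
  \<open>Ext i (M, (\<lambda>y. y \<otimes> c))\<close>; on cocycles this is the tensor evaluation \<open>\<alpha> \<otimes> c \<mapsto> (x \<mapsto> \<alpha>(x) \<otimes> c)\<close>.\<close>

definition Ext_tensor_map ::
    "('a, 'r) ring_scheme \<Rightarrow> nat \<Rightarrow> ('a, 'm) module \<Rightarrow> ('a, 'n) module \<Rightarrow> ('a, 'c) module \<Rightarrow>
     (((('a \<times> 'm) list \<Rightarrow> 'a) \<Rightarrow> 'n) set \<times> 'c \<Rightarrow> 'a) set \<Rightarrow>
     ((('a \<times> 'm) list \<Rightarrow> 'a) \<Rightarrow> ('n \<times> 'c \<Rightarrow> 'a) set) set" where
  "Ext_tensor_map R i M N C =
     tensor_lift R (Ext R i M N) C (Ext R i M (tensor_module R N C))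
       (\<lambda>\<xi> c. Ext_map_right R i M N (tensor_module R N C) (\<lambda>y. pure_tensor R N C y c) \<xi>)"

end

theory Submission
  imports Defs
begin

text \<open>
  Let \<open>F\<close> be a free resolution of \<open>M\<close> and let \<open>X = Hom(F, N)\<close>, with cocycles \<open>Z\<close>, coboundaries \<open>B\<close>
  and cohomology \<open>H\<close>. Each \<open>X i\<close> is a possibly infinite product of copies of \<open>N\<close>; as \<open>C\<close> is finitely
  presented, \<open>X i \<otimes> C = Hom(F i, N \<otimes> C)\<close> and \<open>X i\<close> inherits from \<open>N\<close> the part of the Auslander class
  condition that matters: \<open>Y = Hom(C, Y \<otimes> C)\<close> and vanishing of the higher \<open>Ext(C, Y \<otimes> C)\<close>.

  If \<open>Y \<rightarrow> Y'\<close> is an injection of such modules, no nonzero map from \<open>C\<close> lands in the kernel of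
  \<open>Y \<otimes> C \<rightarrow> Y' \<otimes> C\<close>; since \<open>C\<close> is finitely generated and faithful over a Noetherian ring, this kernel
  vanishes. So tensoring preserves the exactness of \<open>0 \<rightarrow> B i \<rightarrow> Z i \<rightarrow> H i \<rightarrow> 0\<close> and of
  \<open>0 \<rightarrow> Z i \<rightarrow> X i \<rightarrow> B (i + 1) \<rightarrow> 0\<close>, and the condition passes from \<open>B i\<close> and \<open>H i\<close> to \<open>Z i\<close>, and from
  \<open>Z i\<close> and \<open>X i\<close> to \<open>B (i + 1)\<close>. By induction all the sequences up to \<open>n\<close> stay exact, hence
  \<open>H i \<otimes> C\<close> is the cohomology of \<open>X \<otimes> C = Hom(F, N \<otimes> C)\<close>.
\<close>

section \<open>Linear maps and submodules\<close>

text \<open>The chosen resolution has copies of \<open>M\<close> and of the syzygies as bases, so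
  the products in \<open>X i\<close> cannot be assumed finite even for finitely generated
  \<open>M\<close>. The identification of \<open>X i \<otimes> C\<close> with
  \<open>Hom(F i, N \<otimes> C)\<close> therefore rests on generators and relations of
  \<open>C\<close>, not on finite rank of \<open>F i\<close>.

  Nonzero maps out of \<open>C\<close> come from an element \<open>k\<close> with prime annihilator:
  since \<open>C\<close> is faithful, nothing outside that prime kills \<open>C\<close>. Usually one
  would localize there and pass to the residue field; here an induction on the generators of
  \<open>C\<close> does this by hand. Faithfulness is the injectivity of the homothety map.

  There is a circularity to avoid. The condition passes to \<open>Z i\<close> only once
  \<open>B i \<otimes> C \<rightarrow> Z i \<otimes> C\<close> is known to be injective, while the
  injectivity criterion wants the condition at both ends. The way out is to test injectivity after
  mapping on to \<open>X i\<close>, which satisfies the condition from the beginning. The induction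
  starts at \<open>B 0 = 0\<close> and must reach \<open>B (n + 1)\<close>, because surjectivity of
  the comparison in degree \<open>n\<close> uses that
  \<open>B (n + 1) \<otimes> C \<rightarrow> X (n + 1) \<otimes> C\<close> is injective.\<close>

lemma (in abelian_group) minus_eq_zero_iff:
  "x \<in> carrier G \<Longrightarrow> y \<in> carrier G \<Longrightarrow> x \<ominus> y = \<zero> \<longleftrightarrow> x = y"
  by (metis add.inv_closed add.inv_inv minus_equality minus_eq r_neg)

lemma (in abelian_group) minus_zero_right: "x \<in> carrier G \<Longrightarrow> x \<ominus> \<zero> = x"
  using minus_equality[of \<zero> \<zero>] by (simp add: a_minus_def)

lemma linear_mapI:
  assumes "\<And>x. x \<in> carrier M \<Longrightarrow> f x \<in> carrier N"
    and "\<And>x y. x \<in> carrier M \<Longrightarrow> y \<in> carrier M \<Longrightarrow> f (x \<oplus>\<^bsub>M\<^esub> y) = f x \<oplus>\<^bsub>N\<^esub> f y"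
    and "\<And>r x. r \<in> carrier R \<Longrightarrow> x \<in> carrier M \<Longrightarrow> f (r \<odot>\<^bsub>M\<^esub> x) = r \<odot>\<^bsub>N\<^esub> f x"
  shows "linear_map R M N f"
  using assms unfolding linear_map_def by auto

lemma linear_map_closed: "linear_map R M N f \<Longrightarrow> x \<in> carrier M \<Longrightarrow> f x \<in> carrier N"
  and linear_map_add: "linear_map R M N f \<Longrightarrow> x \<in> carrier M \<Longrightarrow> y \<in> carrier M \<Longrightarrow>
    f (x \<oplus>\<^bsub>M\<^esub> y) = f x \<oplus>\<^bsub>N\<^esub> f y"
  and linear_map_smult: "linear_map R M N f \<Longrightarrow> r \<in> carrier R \<Longrightarrow> x \<in> carrier M \<Longrightarrow>
    f (r \<odot>\<^bsub>M\<^esub> x) = r \<odot>\<^bsub>N\<^esub> f x"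
  unfolding linear_map_def by auto

lemma linear_map_zero:
  assumes "module R M" "module R N" "linear_map R M N f"
  shows "f \<zero>\<^bsub>M\<^esub> = \<zero>\<^bsub>N\<^esub>"
proof -
  interpret M: module R M by fact
  interpret N: module R N by fact
  have "f \<zero>\<^bsub>M\<^esub> = f (\<zero>\<^bsub>R\<^esub> \<odot>\<^bsub>M\<^esub> \<zero>\<^bsub>M\<^esub>)" by simp
  also have "\<dots> = \<zero>\<^bsub>R\<^esub> \<odot>\<^bsub>N\<^esub> f \<zero>\<^bsub>M\<^esub>" by (rule linear_map_smult[OF assms(3)]) auto
  also have "\<dots> = \<zero>\<^bsub>N\<^esub>" using linear_map_closed[OF assms(3)] by simp
  finally show ?thesis .
qed

lemma linear_map_uminus:
  assumes "module R M" "module R N" "linear_map R M N f" "x \<in> carrier M"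
  shows "f (\<ominus>\<^bsub>M\<^esub> x) = \<ominus>\<^bsub>N\<^esub> f x"
proof -
  interpret M: module R M by fact
  interpret N: module R N by fact
  have "f (\<ominus>\<^bsub>M\<^esub> x) \<oplus>\<^bsub>N\<^esub> f x = f (\<ominus>\<^bsub>M\<^esub> x \<oplus>\<^bsub>M\<^esub> x)"
    using linear_map_add[OF assms(3)] assms(4) by simp
  also have "\<dots> = \<zero>\<^bsub>N\<^esub>" using assms(4) linear_map_zero[OF assms(1-3)] by (simp add: M.M.l_neg)
  finally show ?thesis
    using linear_map_closed[OF assms(3)] assms(4) by (simp add: N.M.minus_equality)
qed

lemma linear_map_minus:
  assumes "module R M" "module R N" "linear_map R M N f" "x \<in> carrier M" "y \<in> carrier M"
  shows "f (x \<ominus>\<^bsub>M\<^esub> y) = f x \<ominus>\<^bsub>N\<^esub> f y"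
proof -
  interpret M: module R M by fact
  show ?thesis
    using linear_map_add[OF assms(3)] linear_map_uminus[OF assms(1-3)] assms(4,5)
    by (simp add: a_minus_def)
qed

lemma linear_map_finsum:
  assumes "module R M" "module R N" "linear_map R M N f" "finite A" "g \<in> A \<rightarrow> carrier M"
  shows "f (\<Oplus>\<^bsub>M\<^esub>i\<in>A. g i) = (\<Oplus>\<^bsub>N\<^esub>i\<in>A. f (g i))"
proof -
  interpret M: module R M by fact
  interpret N: module R N by fact
  show ?thesis using assms(4,5)
  proof (induction A rule: finite_induct)
    case empty
    then show ?case using linear_map_zero[OF assms(1-3)] by simp
  next
    case (insert x F)
    then have "(\<lambda>i. f (g i)) \<in> F \<rightarrow> carrier N" "f (g x) \<in> carrier N" "g x \<in> carrier M" "g \<in> F \<rightarrow> carrier M"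
      using linear_map_closed[OF assms(3)] by auto
    then show ?case using insert linear_map_add[OF assms(3)] by simp
  qed
qed

lemma linear_map_compose:
  assumes "linear_map R M N f" "linear_map R N P g"
  shows "linear_map R M P (\<lambda>x. g (f x))"
  using assms unfolding linear_map_def by (auto simp: Pi_iff)

lemma linear_map_cong:
  assumes "module R M" "\<And>x. x \<in> carrier M \<Longrightarrow> f x = g x"
  shows "linear_map R M N f = linear_map R M N g"
proof -
  interpret M: module R M by fact
  show ?thesis using assms(2) unfolding linear_map_def by (auto simp: Pi_iff)
qed

lemma linear_map_restrict [simp]:
  "module R M \<Longrightarrow> linear_map R M N (restrict f (carrier M)) = linear_map R M N f"
  by (rule linear_map_cong) auto

lemma linear_map_id: "linear_map R M M (\<lambda>x. x)"
  by (rule linear_mapI) auto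

lemma linear_map_inclusion:
  "U \<subseteq> carrier M \<Longrightarrow> linear_map R (M\<lparr>carrier := U\<rparr>) M (\<lambda>x. x)"
  by (rule linear_mapI) auto

lemma linear_map_on_submodule:
  assumes "linear_map R M N f" "U \<subseteq> carrier M"
  shows "linear_map R (M\<lparr>carrier := U\<rparr>) N f"
  using assms unfolding linear_map_def by (auto simp: subset_iff)

lemma linear_map_into_submodule:
  assumes "linear_map R M N f" "\<And>x. x \<in> carrier M \<Longrightarrow> f x \<in> U"
  shows "linear_map R M (N\<lparr>carrier := U\<rparr>) f"
  using assms unfolding linear_map_def by auto

lemma linear_map_plus:
  assumes "module R M" "module R N" "linear_map R M N f" "linear_map R M N g"
  shows "linear_map R M N (\<lambda>x. f x \<oplus>\<^bsub>N\<^esub> g x)"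
proof -
  interpret M: module R M by fact
  interpret N: module R N by fact
  show ?thesis
    using linear_map_closed[OF assms(3)] linear_map_closed[OF assms(4)]
    by (intro linear_mapI)
      (simp_all add: linear_map_add[OF assms(3)] linear_map_add[OF assms(4)]
        linear_map_smult[OF assms(3)] linear_map_smult[OF assms(4)] N.smult_r_distr N.M.a_ac)
qed

lemma linear_map_scale:
  assumes "module R M" "module R N" "linear_map R M N f" "a \<in> carrier R"
  shows "linear_map R M N (\<lambda>x. a \<odot>\<^bsub>N\<^esub> f x)"
proof -
  interpret M: module R M by fact
  interpret N: module R N by fact
  show ?thesis
    using linear_map_closed[OF assms(3)] assms(4)
    by (intro linear_mapI)
      (simp_all add: linear_map_add[OF assms(3)] linear_map_smult[OF assms(3)]
        N.smult_r_distr N.smult_assoc1[symmetric] M.R.m_comm)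
qed

lemma linear_map_diff:
  assumes "module R M" "module R N" "linear_map R M N f" "linear_map R M N g"
  shows "linear_map R M N (\<lambda>x. f x \<ominus>\<^bsub>N\<^esub> g x)"
proof -
  interpret M: module R M by fact
  interpret N: module R N by fact
  have *: "\<ominus>\<^bsub>N\<^esub> g x = (\<ominus>\<^bsub>R\<^esub> \<one>\<^bsub>R\<^esub>) \<odot>\<^bsub>N\<^esub> g x" if "x \<in> carrier M" for x
    using linear_map_closed[OF assms(4) that] by (simp add: N.smult_l_minus)
  have "linear_map R M N (\<lambda>x. f x \<oplus>\<^bsub>N\<^esub> ((\<ominus>\<^bsub>R\<^esub> \<one>\<^bsub>R\<^esub>) \<odot>\<^bsub>N\<^esub> g x))"
    by (intro linear_map_plus linear_map_scale assms) simp
  then show ?thesis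
    by (subst linear_map_cong[OF assms(1)]) (auto simp: * a_minus_def)
qed

lemma linear_map_const_zero:
  assumes "module R N"
  shows "linear_map R M N (\<lambda>x. \<zero>\<^bsub>N\<^esub>)"
proof -
  interpret N: module R N by fact
  show ?thesis by (rule linear_mapI) auto
qed

lemma linear_map_inj_onI:
  assumes "module R M" "module R N" "linear_map R M N f"
    and "\<And>x. x \<in> carrier M \<Longrightarrow> f x = \<zero>\<^bsub>N\<^esub> \<Longrightarrow> x = \<zero>\<^bsub>M\<^esub>"
  shows "inj_on f (carrier M)"
proof (rule inj_onI)
  interpret M: module R M by fact
  interpret N: module R N by fact
  fix x y assume xy: "x \<in> carrier M" "y \<in> carrier M" "f x = f y"
  then have "f (x \<ominus>\<^bsub>M\<^esub> y) = \<zero>\<^bsub>N\<^esub>"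
    using linear_map_minus[OF assms(1-3)] linear_map_closed[OF assms(3)]
    by (simp add: N.M.r_neg a_minus_def)
  then have "x \<ominus>\<^bsub>M\<^esub> y = \<zero>\<^bsub>M\<^esub>" using assms(4) xy by simp
  then show "x = y" using xy by (simp add: M.M.minus_eq_zero_iff)
qed

lemma inj_on_linear_map_zero:
  assumes "module R M" "module R N" "linear_map R M N f" "inj_on f (carrier M)"
    and "x \<in> carrier M" "f x = \<zero>\<^bsub>N\<^esub>"
  shows "x = \<zero>\<^bsub>M\<^esub>"
proof -
  interpret M: module R M by fact
  show ?thesis using assms linear_map_zero[OF assms(1-3)]
    by (metis M.M.zero_closed inj_onD)
qed

lemma submodule_subset: "submodule U R M \<Longrightarrow> U \<subseteq> carrier M"
  unfolding submodule_def subgroup_def by auto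

lemma submodule_zero: "submodule U R M \<Longrightarrow> \<zero>\<^bsub>M\<^esub> \<in> U"
  unfolding submodule_def subgroup_def by auto

lemma submodule_add: "submodule U R M \<Longrightarrow> x \<in> U \<Longrightarrow> y \<in> U \<Longrightarrow> x \<oplus>\<^bsub>M\<^esub> y \<in> U"
  unfolding submodule_def subgroup_def by auto

lemma submodule_uminus: "submodule U R M \<Longrightarrow> x \<in> U \<Longrightarrow> \<ominus>\<^bsub>M\<^esub> x \<in> U"
  unfolding submodule_def subgroup_def a_inv_def by auto

lemma submodule_minus: "submodule U R M \<Longrightarrow> x \<in> U \<Longrightarrow> y \<in> U \<Longrightarrow> x \<ominus>\<^bsub>M\<^esub> y \<in> U"
  by (simp add: a_minus_def submodule_add submodule_uminus)

lemma submodule_smult: "submodule U R M \<Longrightarrow> r \<in> carrier R \<Longrightarrow> x \<in> U \<Longrightarrow> r \<odot>\<^bsub>M\<^esub> x \<in> U"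
  by (rule submodule.smult_closed)

lemma submodule_criterion:
  assumes "module R M" "U \<subseteq> carrier M" "\<zero>\<^bsub>M\<^esub> \<in> U"
    and "\<And>x y. x \<in> U \<Longrightarrow> y \<in> U \<Longrightarrow> x \<oplus>\<^bsub>M\<^esub> y \<in> U"
    and "\<And>r x. r \<in> carrier R \<Longrightarrow> x \<in> U \<Longrightarrow> r \<odot>\<^bsub>M\<^esub> x \<in> U"
  shows "submodule U R M"
proof -
  interpret M: module R M by fact
  show ?thesis
  proof (rule M.submoduleI)
    fix a assume a: "a \<in> U"
    then have "\<ominus>\<^bsub>M\<^esub> a = (\<ominus>\<^bsub>R\<^esub> \<one>\<^bsub>R\<^esub>) \<odot>\<^bsub>M\<^esub> a" using assms(2) by (simp add: M.smult_l_minus subsetD)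
    then show "\<ominus>\<^bsub>M\<^esub> a \<in> U" using assms(5) a by simp
  qed (use assms in auto)
qed

lemma submodule_module: "module R M \<Longrightarrow> submodule U R M \<Longrightarrow> module R (M\<lparr>carrier := U\<rparr>)"
  by (rule submodule.submodule_is_module)

lemma submodule_vimage:
  assumes "module R M" "module R N" "linear_map R M N f" "submodule U R N"
  shows "submodule {x \<in> carrier M. f x \<in> U} R M"
proof -
  interpret M: module R M by fact
  show ?thesis
    by (rule submodule_criterion)
      (auto simp: linear_map_zero[OF assms(1-3)] linear_map_add[OF assms(3)]
        linear_map_smult[OF assms(3)] submodule_zero[OF assms(4)] submodule_add[OF assms(4)]
        submodule_smult[OF assms(4)] assms(1))
qed

lemma submodule_zero_set: "module R M \<Longrightarrow> submodule {\<zero>\<^bsub>M\<^esub>} R M"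
proof -
  assume "module R M"
  then interpret M: module R M .
  show ?thesis by (rule submodule_criterion) (auto intro: M.module_axioms)
qed

lemma submodule_carrier: "module R M \<Longrightarrow> submodule (carrier M) R M"
  by (rule module.carrier_is_submodule)

lemma submodule_kernel:
  assumes "module R M" "module R N" "linear_map R M N f"
  shows "submodule {x \<in> carrier M. f x = \<zero>\<^bsub>N\<^esub>} R M"
  using submodule_vimage[OF assms submodule_zero_set[OF assms(2)]] by simp

lemma submodule_equalizer:
  assumes "module R M" "module R N" "linear_map R M N f" "linear_map R M N g"
  shows "submodule {x \<in> carrier M. f x = g x} R M"
proof -
  interpret M: module R M by fact
  show ?thesis
    by (rule submodule_criterion)
      (auto simp: linear_map_zero[OF assms(1-3)] linear_map_zero[OF assms(1,2,4)]
        linear_map_add[OF assms(3)] linear_map_add[OF assms(4)]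
        linear_map_smult[OF assms(3)] linear_map_smult[OF assms(4)] assms(1))
qed

lemma submodule_image_submodule:
  assumes "module R M" "module R N" "linear_map R M N f" "submodule U R M"
  shows "submodule (f ` U) R N"
proof -
  interpret M: module R M by fact
  note sub = submodule_subset[OF assms(4), THEN subsetD]
  show ?thesis
  proof (rule submodule_criterion[OF assms(2)])
    show "f ` U \<subseteq> carrier N" using linear_map_closed[OF assms(3)] sub by auto
    show "\<zero>\<^bsub>N\<^esub> \<in> f ` U"
      using linear_map_zero[OF assms(1-3)] submodule_zero[OF assms(4)] by (metis image_eqI)
  next
    fix x y assume "x \<in> f ` U" "y \<in> f ` U"
    then obtain u v where "u \<in> U" "v \<in> U" "x = f u" "y = f v" by auto
    then show "x \<oplus>\<^bsub>N\<^esub> y \<in> f ` U"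
      using linear_map_add[OF assms(3), of u v] submodule_add[OF assms(4)] sub by (metis image_eqI)
  next
    fix r x assume "r \<in> carrier R" "x \<in> f ` U"
    then show "r \<odot>\<^bsub>N\<^esub> x \<in> f ` U"
      using linear_map_smult[OF assms(3)] submodule_smult[OF assms(4)] sub
      by (metis (no_types, lifting) image_iff)
  qed
qed

lemma submodule_image:
  assumes "module R M" "module R N" "linear_map R M N f"
  shows "submodule (f ` carrier M) R N"
  by (rule submodule_image_submodule[OF assms submodule_carrier[OF assms(1)]])

lemma submodule_span:
  assumes "module R M" "S \<subseteq> carrier M"
  shows "submodule (module_span R M S) R M"
proof -
  interpret M: module R M by fact
  have "carrier M \<in> {U. submodule U R M \<and> S \<subseteq> U}" using submodule_carrier assms by auto
  then have "\<Inter> {U. submodule U R M \<and> S \<subseteq> U} \<subseteq> carrier M" by blast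
  then show ?thesis
    unfolding module_span_def
    by (intro submodule_criterion[OF assms(1)])
      (auto simp: submodule_zero submodule_add submodule_smult)
qed

lemma span_superset: "S \<subseteq> module_span R M S"
  unfolding module_span_def by auto

lemma span_minimal: "submodule U R M \<Longrightarrow> S \<subseteq> U \<Longrightarrow> module_span R M S \<subseteq> U"
  unfolding module_span_def by auto

lemma linear_map_inv_into:
  assumes "module R M" "module R N" "module_iso R M N f"
  shows "linear_map R N M (inv_into (carrier M) f)"
proof -
  interpret M: module R M by fact
  have f: "linear_map R M N f" and inj: "inj_on f (carrier M)" and surj: "f ` carrier M = carrier N"
    using assms(3) unfolding module_iso_def bij_betw_def by auto
  show ?thesis
  proof (rule linear_mapI)
    fix x assume "x \<in> carrier N"
    then show "inv_into (carrier M) f x \<in> carrier M" using surj by (simp add: inv_into_into)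
  next
    fix x y assume "x \<in> carrier N" "y \<in> carrier N"
    then obtain u v where "u \<in> carrier M" "v \<in> carrier M" "x = f u" "y = f v" using surj by blast
    then show "inv_into (carrier M) f (x \<oplus>\<^bsub>N\<^esub> y) = inv_into (carrier M) f x \<oplus>\<^bsub>M\<^esub> inv_into (carrier M) f y"
      using inj linear_map_add[OF f, of u v, symmetric] by (simp add: inv_into_f_f)
  next
    fix r x assume r: "r \<in> carrier R" and "x \<in> carrier N"
    then obtain u where "u \<in> carrier M" "x = f u" using surj by blast
    then show "inv_into (carrier M) f (r \<odot>\<^bsub>N\<^esub> x) = r \<odot>\<^bsub>M\<^esub> inv_into (carrier M) f x"
      using inj r linear_map_smult[OF f, of r u, symmetric] by (simp add: inv_into_f_f)
  qed
qed

section \<open>Quotient modules\<close>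

lemma carrier_quotient: "carrier (quotient_module M U) = (\<lambda>x. U +>\<^bsub>M\<^esub> x) ` carrier M"
  unfolding quotient_module_def A_RCOSETS_def' by auto

lemma submodule_abelian_subgroup:
  assumes "module R M" "submodule U R M"
  shows "abelian_subgroup U M"
proof -
  interpret M: module R M by fact
  show ?thesis
    using assms(2) M.abelian_group_axioms
    by (intro abelian_subgroupI3 additive_subgroup.intro) (auto simp: submodule_def)
qed

lemma coset_eq_iff:
  assumes "module R M" "submodule U R M" "x \<in> carrier M" "y \<in> carrier M"
  shows "U +>\<^bsub>M\<^esub> x = U +>\<^bsub>M\<^esub> y \<longleftrightarrow> x \<ominus>\<^bsub>M\<^esub> y \<in> U"
proof -
  interpret M: module R M by fact
  interpret U: abelian_subgroup U M by (rule submodule_abelian_subgroup) fact+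
  have "U +>\<^bsub>M\<^esub> x = U +>\<^bsub>M\<^esub> y \<longleftrightarrow> x \<in> U +>\<^bsub>M\<^esub> y"
    using U.a_repr_independence' U.a_rcos_self assms by (metis U.a_repr_independenceD)
  then show ?thesis using U.a_rcos_module assms
    by (simp add: a_minus_def)
qed

lemma add_cosets:
  assumes "module R M" "submodule U R M" "x \<in> carrier M" "y \<in> carrier M"
  shows "(U +>\<^bsub>M\<^esub> x) <+>\<^bsub>M\<^esub> (U +>\<^bsub>M\<^esub> y) = U +>\<^bsub>M\<^esub> (x \<oplus>\<^bsub>M\<^esub> y)"
  by (rule abelian_subgroup.a_rcos_sum[OF submodule_abelian_subgroup]) fact+

lemma in_coset_iff:
  assumes "module R M" "submodule U R M" "x \<in> carrier M"
  shows "y \<in> U +>\<^bsub>M\<^esub> x \<longleftrightarrow> y \<in> carrier M \<and> U +>\<^bsub>M\<^esub> y = U +>\<^bsub>M\<^esub> x"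
proof -
  interpret M: module R M by fact
  interpret U: abelian_subgroup U M by (rule submodule_abelian_subgroup) fact+
  show ?thesis
    using U.a_repr_independence' U.a_rcos_self assms M.a_r_coset_subset_G U.a_subset
    by (metis U.a_repr_independenceD subsetD)
qed

text \<open>The union in \<open>quotient_module\<close> runs over equal cosets:
  \<open>r y - r x = r (y - x)\<close> lies in \<open>U\<close> as soon as \<open>y - x\<close>
  does.\<close>

lemma smult_coset:
  assumes "module R M" "submodule U R M" "r \<in> carrier R" "x \<in> carrier M"
  shows "(\<Union>y\<in>U +>\<^bsub>M\<^esub> x. U +>\<^bsub>M\<^esub> (r \<odot>\<^bsub>M\<^esub> y)) = U +>\<^bsub>M\<^esub> (r \<odot>\<^bsub>M\<^esub> x)"
proof -
  interpret M: module R M by fact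
  have "U +>\<^bsub>M\<^esub> (r \<odot>\<^bsub>M\<^esub> y) = U +>\<^bsub>M\<^esub> (r \<odot>\<^bsub>M\<^esub> x)" if "y \<in> U +>\<^bsub>M\<^esub> x" for y
  proof -
    have y: "y \<in> carrier M" "y \<ominus>\<^bsub>M\<^esub> x \<in> U"
      using that coset_eq_iff[OF assms(1,2), of y x] in_coset_iff[OF assms(1,2,4)] assms(4) by auto
    then have "r \<odot>\<^bsub>M\<^esub> y \<ominus>\<^bsub>M\<^esub> r \<odot>\<^bsub>M\<^esub> x = r \<odot>\<^bsub>M\<^esub> (y \<ominus>\<^bsub>M\<^esub> x)"
      using assms(3,4) by (simp add: a_minus_def M.smult_r_distr M.smult_r_minus)
    then show ?thesis
      using coset_eq_iff[OF assms(1,2)] submodule_smult[OF assms(2,3) y(2)] y assms(3,4) by simp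
  qed
  moreover have "x \<in> U +>\<^bsub>M\<^esub> x" using in_coset_iff[OF assms(1,2,4)] assms(4) by simp
  ultimately show ?thesis by blast
qed

lemma coset_zero:
  assumes "module R M" "submodule U R M"
  shows "U +>\<^bsub>M\<^esub> \<zero>\<^bsub>M\<^esub> = U"
  by (rule abelian_group.a_coset_add_zero)
    (use assms in \<open>auto simp: module_def submodule_subset\<close>)

lemma linear_map_coset:
  assumes "module R M" "submodule U R M"
  shows "linear_map R M (quotient_module M U) (\<lambda>x. U +>\<^bsub>M\<^esub> x)"
  by (rule linear_mapI, simp add: carrier_quotient)
    (simp_all add: quotient_module_def add_cosets[OF assms] smult_coset[OF assms])

text \<open>\<open>N\<close> is only a record at this point, so the image of zero has to be assumed;
  additivity would force it only in a group. Every axiom is then checked on preimages, which spares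
  a verification on cosets.\<close>

lemma module_via_surjection:
  assumes "module R M" "f ` carrier M = carrier N" "f \<zero>\<^bsub>M\<^esub> = \<zero>\<^bsub>N\<^esub>" "linear_map R M N f"
  shows "module R N"
proof -
  interpret M: module R M by fact
  note simps = linear_map_add[OF assms(4), symmetric] linear_map_smult[OF assms(4), symmetric]
    assms(3)[symmetric] assms(2)[symmetric]
  show ?thesis
  proof (rule moduleI)
    show "abelian_group N"
    proof (rule abelian_groupI)
      fix x assume "x \<in> carrier N"
      then obtain u where u: "u \<in> carrier M" "x = f u" using assms(2) by blast
      then have "f (\<ominus>\<^bsub>M\<^esub> u) \<oplus>\<^bsub>N\<^esub> x = \<zero>\<^bsub>N\<^esub>" using simps by (simp add: M.M.l_neg)
      then show "\<exists>y\<in>carrier N. y \<oplus>\<^bsub>N\<^esub> x = \<zero>\<^bsub>N\<^esub>"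
        using linear_map_closed[OF assms(4)] u by blast
    qed (auto simp: simps M.M.a_ac)
  qed (auto simp: simps M.M.a_ac M.smult_l_distr M.smult_r_distr M.smult_assoc1 M.R.cring_axioms)
qed

lemma module_quotient:
  assumes "module R M" "submodule U R M"
  shows "module R (quotient_module M U)"
proof (rule module_via_surjection[OF assms(1) _ _ linear_map_coset[OF assms]])
  show "U +>\<^bsub>M\<^esub> \<zero>\<^bsub>M\<^esub> = \<zero>\<^bsub>quotient_module M U\<^esub>"
    using coset_zero[OF assms] by (simp add: quotient_module_def)
qed (simp add: carrier_quotient)

lemma zero_quotient [simp]: "\<zero>\<^bsub>quotient_module M U\<^esub> = U"
  by (simp add: quotient_module_def)

lemma coset_eq_zero_iff:
  assumes "module R M" "submodule U R M" "x \<in> carrier M"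
  shows "U +>\<^bsub>M\<^esub> x = U \<longleftrightarrow> x \<in> U"
proof -
  interpret M: module R M by fact
  show ?thesis
    using coset_eq_iff[OF assms M.M.zero_closed] coset_zero[OF assms(1,2)] assms(3)
    by (simp add: M.M.minus_zero_right)
qed

text \<open>The value at \<open>y\<close> is \<open>f\<close> of an arbitrary preimage: two
  preimages differ by an element of the kernel of \<open>q\<close>, which \<open>f\<close> kills.
  Descending along any surjection, and not only along a quotient map, lets the same lemma serve
  cosets, presentations of \<open>C\<close> and augmentations of resolutions.\<close>

lemma factor_through_surjection:
  assumes "module R M" "module R N" "module R P" "linear_map R M N q" "q ` carrier M = carrier N"
    and "linear_map R M P f"
    and "\<And>x. x \<in> carrier M \<Longrightarrow> q x = \<zero>\<^bsub>N\<^esub> \<Longrightarrow> f x = \<zero>\<^bsub>P\<^esub>"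
  obtains g where "linear_map R N P g" "\<And>x. x \<in> carrier M \<Longrightarrow> g (q x) = f x"
proof -
  interpret M: module R M by fact
  interpret N: module R N by fact
  interpret P: module R P by fact
  define g where "g = (\<lambda>y. f (inv_into (carrier M) q y))"
  have g: "g (q x) = f x" if x: "x \<in> carrier M" for x
  proof -
    let ?x = "inv_into (carrier M) q (q x)"
    have *: "?x \<in> carrier M" "q ?x = q x" using x by (auto intro: inv_into_into f_inv_into_f)
    then have "q (?x \<ominus>\<^bsub>M\<^esub> x) = \<zero>\<^bsub>N\<^esub>"
      using linear_map_minus[OF assms(1,2,4), of ?x x] linear_map_closed[OF assms(4) x] x
      by (simp add: N.M.minus_eq_zero_iff)
    then have "f ?x \<ominus>\<^bsub>P\<^esub> f x = \<zero>\<^bsub>P\<^esub>"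
      using assms(7)[of "?x \<ominus>\<^bsub>M\<^esub> x"] linear_map_minus[OF assms(1,3,6) *(1) x] * x by simp
    then show ?thesis
      using linear_map_closed[OF assms(6)] * x by (simp add: g_def P.M.minus_eq_zero_iff)
  qed
  have "linear_map R N P g"
  proof (rule linear_mapI)
    fix x assume "x \<in> carrier N"
    then obtain u where "u \<in> carrier M" "x = q u" using assms(5) by blast
    then show "g x \<in> carrier P" using g linear_map_closed[OF assms(6)] by simp
  next
    fix x y assume "x \<in> carrier N" "y \<in> carrier N"
    then obtain u v where uv: "u \<in> carrier M" "v \<in> carrier M" "x = q u" "y = q v" using assms(5) by blast
    then have "g (x \<oplus>\<^bsub>N\<^esub> y) = g (q (u \<oplus>\<^bsub>M\<^esub> v))" using linear_map_add[OF assms(4)] by simp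
    then show "g (x \<oplus>\<^bsub>N\<^esub> y) = g x \<oplus>\<^bsub>P\<^esub> g y" using g linear_map_add[OF assms(6)] uv by simp
  next
    fix r x assume r: "r \<in> carrier R" "x \<in> carrier N"
    then obtain u where u: "u \<in> carrier M" "x = q u" using assms(5) by blast
    then have "g (r \<odot>\<^bsub>N\<^esub> x) = g (q (r \<odot>\<^bsub>M\<^esub> u))" using linear_map_smult[OF assms(4)] r by simp
    then show "g (r \<odot>\<^bsub>N\<^esub> x) = r \<odot>\<^bsub>P\<^esub> g x" using g linear_map_smult[OF assms(6)] u r by simp
  qed
  then show ?thesis using that g by blast
qed

section \<open>Modules of homomorphisms\<close>

lemma carrier_hom:
  "f \<in> carrier (hom_module R M N) \<longleftrightarrow> f \<in> extensional (carrier M) \<and> linear_map R M N f"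
  unfolding hom_module_def by simp

lemma hom_linear: "f \<in> carrier (hom_module R M N) \<Longrightarrow> linear_map R M N f"
  by (simp add: carrier_hom)

lemma hom_eqI:
  assumes "f \<in> carrier (hom_module R M N)" "g \<in> carrier (hom_module R M N)"
    and "\<And>x. x \<in> carrier M \<Longrightarrow> f x = g x"
  shows "f = g"
  using assms by (auto simp: carrier_hom intro: extensionalityI)

lemma restrict_in_hom:
  "module R M \<Longrightarrow> linear_map R M N f \<Longrightarrow> restrict f (carrier M) \<in> carrier (hom_module R M N)"
  by (simp add: carrier_hom)

lemma hom_zero: "x \<in> carrier M \<Longrightarrow> \<zero>\<^bsub>hom_module R M N\<^esub> x = \<zero>\<^bsub>N\<^esub>"
  and hom_add: "x \<in> carrier M \<Longrightarrow> (f \<oplus>\<^bsub>hom_module R M N\<^esub> g) x = f x \<oplus>\<^bsub>N\<^esub> g x"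
  and hom_smult: "x \<in> carrier M \<Longrightarrow> (r \<odot>\<^bsub>hom_module R M N\<^esub> f) x = r \<odot>\<^bsub>N\<^esub> f x"
  by (simp_all add: hom_module_def)

lemma module_hom:
  assumes "module R M" "module R N"
  shows "module R (hom_module R M N)"
proof -
  interpret M: module R M by fact
  interpret N: module R N by fact
  let ?H = "hom_module R M N"
  have add: "f \<oplus>\<^bsub>?H\<^esub> g \<in> carrier ?H" if "f \<in> carrier ?H" "g \<in> carrier ?H" for f g
    using that assms linear_map_plus[OF assms] by (simp add: hom_module_def)
  have zero: "\<zero>\<^bsub>?H\<^esub> \<in> carrier ?H"
    using assms linear_map_const_zero[OF assms(2)] by (simp add: hom_module_def)
  have smult: "r \<odot>\<^bsub>?H\<^esub> f \<in> carrier ?H" if "f \<in> carrier ?H" "r \<in> carrier R" for r f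
    using that assms linear_map_scale[OF assms] by (simp add: hom_module_def)
  have cl: "f x \<in> carrier N" if "f \<in> carrier ?H" "x \<in> carrier M" for f x
    using that by (meson hom_linear linear_map_closed)
  note simps = hom_zero hom_add hom_smult
  show ?thesis
  proof (rule moduleI)
    show "abelian_group ?H"
    proof (rule abelian_groupI)
      fix f assume f: "f \<in> carrier ?H"
      then have "(\<ominus>\<^bsub>R\<^esub> \<one>\<^bsub>R\<^esub>) \<odot>\<^bsub>?H\<^esub> f \<oplus>\<^bsub>?H\<^esub> f = \<zero>\<^bsub>?H\<^esub>"
        by (intro hom_eqI[of _ R M N] add zero smult)
          (auto simp: simps cl N.smult_l_minus N.M.l_neg)
      then show "\<exists>g\<in>carrier ?H. g \<oplus>\<^bsub>?H\<^esub> f = \<zero>\<^bsub>?H\<^esub>" using smult[OF f] by blast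
    qed (auto intro!: hom_eqI[of _ R M N] add zero smult simp: simps cl N.M.a_ac)
  qed (auto intro!: hom_eqI[of _ R M N] add zero smult
      simp: simps cl N.smult_l_distr N.smult_r_distr N.smult_assoc1 M.R.cring_axioms)
qed

lemma linear_map_eval:
  "x \<in> carrier M \<Longrightarrow> linear_map R (hom_module R M N) N (\<lambda>f. f x)"
  by (rule linear_mapI) (auto simp: hom_add hom_smult dest!: hom_linear intro: linear_map_closed)

lemma hom_finsum:
  assumes "module R M" "module R N" "finite A" "f \<in> A \<rightarrow> carrier (hom_module R M N)" "x \<in> carrier M"
  shows "(\<Oplus>\<^bsub>hom_module R M N\<^esub>i\<in>A. f i) x = (\<Oplus>\<^bsub>N\<^esub>i\<in>A. f i x)"
  by (rule linear_map_finsum[OF module_hom[OF assms(1,2)] assms(2) linear_map_eval[OF assms(5)] assms(3,4)])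

lemma linear_map_into_homI:
  assumes "module R M" "\<And>x. x \<in> carrier P \<Longrightarrow> linear_map R M N (\<lambda>y. f x y)"
    and "\<And>x x' y. x \<in> carrier P \<Longrightarrow> x' \<in> carrier P \<Longrightarrow> y \<in> carrier M \<Longrightarrow>
      f (x \<oplus>\<^bsub>P\<^esub> x') y = f x y \<oplus>\<^bsub>N\<^esub> f x' y"
    and "\<And>r x y. r \<in> carrier R \<Longrightarrow> x \<in> carrier P \<Longrightarrow> y \<in> carrier M \<Longrightarrow>
      f (r \<odot>\<^bsub>P\<^esub> x) y = r \<odot>\<^bsub>N\<^esub> f x y"
  shows "linear_map R P (hom_module R M N) (\<lambda>x. \<lambda>y\<in>carrier M. f x y)"
proof (rule linear_mapI)
  fix x assume "x \<in> carrier P"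
  then show "(\<lambda>y\<in>carrier M. f x y) \<in> carrier (hom_module R M N)"
    by (intro restrict_in_hom assms(1,2))
qed (auto simp: hom_module_def restrict_def fun_eq_iff assms(3,4))

lemma compose_in_hom:
  assumes "module R M" "linear_map R M N f" "linear_map R N P g"
  shows "compose (carrier M) g f \<in> carrier (hom_module R M P)"
  unfolding compose_def by (intro restrict_in_hom linear_map_compose[OF assms(2,3)] assms(1))

lemma linear_map_precompose:
  assumes "module R M" "linear_map R M N f"
  shows "linear_map R (hom_module R N P) (hom_module R M P) (\<lambda>g. compose (carrier M) g f)"
  unfolding compose_def using linear_map_closed[OF assms(2)]
  by (intro linear_map_into_homI[OF assms(1)] linear_map_compose[OF assms(2)])
    (auto simp: hom_linear hom_add hom_smult)

lemma linear_map_postcompose: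
  assumes "module R M" "linear_map R N P g"
  shows "linear_map R (hom_module R M N) (hom_module R M P) (\<lambda>f. compose (carrier M) g f)"
  unfolding compose_def
  by (intro linear_map_into_homI[OF assms(1)] linear_map_compose[OF _ assms(2)])
    (auto simp: hom_linear hom_add hom_smult
      linear_map_add[OF assms(2)] linear_map_smult[OF assms(2)] dest!: hom_linear
      intro!: linear_map_add[OF assms(2)] linear_map_smult[OF assms(2)] intro: linear_map_closed)

section \<open>Free modules\<close>

lemma carrier_free:
  "v \<in> carrier (free_module R I) \<longleftrightarrow>
    (\<forall>i. v i \<in> carrier R) \<and> finite {i. v i \<noteq> \<zero>\<^bsub>R\<^esub>} \<and> {i. v i \<noteq> \<zero>\<^bsub>R\<^esub>} \<subseteq> I"
  by (simp add: free_module_def)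

lemma free_add [simp]: "(v \<oplus>\<^bsub>free_module R I\<^esub> w) i = v i \<oplus>\<^bsub>R\<^esub> w i"
  and free_zero [simp]: "\<zero>\<^bsub>free_module R I\<^esub> i = \<zero>\<^bsub>R\<^esub>"
  and free_smult [simp]: "(r \<odot>\<^bsub>free_module R I\<^esub> v) i = r \<otimes>\<^bsub>R\<^esub> v i"
  by (simp_all add: free_module_def)

lemma module_free:
  assumes "cring R"
  shows "module R (free_module R I)"
proof -
  interpret R: cring R by fact
  let ?F = "free_module R I"
  have add: "v \<oplus>\<^bsub>?F\<^esub> w \<in> carrier ?F" if "v \<in> carrier ?F" "w \<in> carrier ?F" for v w
  proof -
    have "{i. v i \<oplus>\<^bsub>R\<^esub> w i \<noteq> \<zero>\<^bsub>R\<^esub>} \<subseteq> {i. v i \<noteq> \<zero>\<^bsub>R\<^esub>} \<union> {i. w i \<noteq> \<zero>\<^bsub>R\<^esub>}" by auto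
    from finite_subset[OF this] this show ?thesis using that by (auto simp: carrier_free)
  qed
  have smult: "r \<odot>\<^bsub>?F\<^esub> v \<in> carrier ?F" if "v \<in> carrier ?F" "r \<in> carrier R" for v r
  proof -
    have "{i. r \<otimes>\<^bsub>R\<^esub> v i \<noteq> \<zero>\<^bsub>R\<^esub>} \<subseteq> {i. v i \<noteq> \<zero>\<^bsub>R\<^esub>}" using that by auto
    from finite_subset[OF this] this show ?thesis using that by (auto simp: carrier_free)
  qed
  have zero: "\<zero>\<^bsub>?F\<^esub> \<in> carrier ?F" by (simp add: carrier_free)
  have cl: "v i \<in> carrier R" if "v \<in> carrier ?F" for v i using that by (simp add: carrier_free)
  show ?thesis
  proof (rule moduleI)
    show "abelian_group ?F"
    proof (rule abelian_groupI)
      fix v assume v: "v \<in> carrier ?F"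
      then have "(\<ominus>\<^bsub>R\<^esub> \<one>\<^bsub>R\<^esub>) \<odot>\<^bsub>?F\<^esub> v \<oplus>\<^bsub>?F\<^esub> v = \<zero>\<^bsub>?F\<^esub>"
        by (intro ext) (auto simp: cl R.l_minus R.l_neg)
      then show "\<exists>w\<in>carrier ?F. w \<oplus>\<^bsub>?F\<^esub> v = \<zero>\<^bsub>?F\<^esub>" using smult[OF v] by blast
    qed (auto intro!: add zero smult ext simp: cl R.a_ac)
  qed (auto intro!: add zero smult ext simp: cl R.l_distr R.r_distr R.m_ac assms)
qed

lemma free_gen_closed:
  assumes "cring R" "i \<in> I"
  shows "free_gen R i \<in> carrier (free_module R I)"
proof -
  interpret R: cring R by fact
  have "{j. free_gen R i j \<noteq> \<zero>\<^bsub>R\<^esub>} \<subseteq> {i}" by (auto simp: free_gen_def)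
  from finite_subset[OF this] show ?thesis
    using assms(2) by (auto simp: carrier_free free_gen_def)
qed

text \<open>Induction on a finite set containing the support: setting the coordinate at
  \<open>j\<close> to zero shrinks this set, and \<open>v j\<close> times the generator at
  \<open>j\<close> restores \<open>v\<close>.\<close>

lemma free_induct:
  assumes "cring R" "submodule U R (free_module R I)" "\<And>i. i \<in> I \<Longrightarrow> free_gen R i \<in> U"
    and "v \<in> carrier (free_module R I)"
  shows "v \<in> U"
proof -
  interpret R: cring R by fact
  interpret F: module R "free_module R I" by (rule module_free) fact
  have "v \<in> carrier (free_module R I) \<Longrightarrow> {i. v i \<noteq> \<zero>\<^bsub>R\<^esub>} \<subseteq> S \<Longrightarrow> S \<subseteq> I \<Longrightarrow> v \<in> U" if "finite S" for S v
    using that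
  proof (induction S arbitrary: v rule: finite_induct)
    case empty
    then have "v = \<zero>\<^bsub>free_module R I\<^esub>" by (intro ext) auto
    then show ?case using submodule_zero[OF assms(2)] by (simp only:)
  next
    case (insert j S)
    let ?w = "v(j := \<zero>\<^bsub>R\<^esub>)"
    have sub: "{i. ?w i \<noteq> \<zero>\<^bsub>R\<^esub>} \<subseteq> S" using insert.prems by auto
    have "?w \<in> carrier (free_module R I)"
      using insert.prems insert.hyps finite_subset[OF sub] sub by (auto simp: carrier_free)
    then have w: "?w \<in> U" using insert.IH sub insert.prems by blast
    have vj: "v j \<in> carrier R" using insert.prems by (simp add: carrier_free)
    have "?w \<oplus>\<^bsub>free_module R I\<^esub> (v j \<odot>\<^bsub>free_module R I\<^esub> free_gen R j) \<in> U"
      using insert.prems vj w by (intro submodule_add[OF assms(2)] submodule_smult[OF assms(2)] assms(3)) auto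
    moreover have "?w \<oplus>\<^bsub>free_module R I\<^esub> (v j \<odot>\<^bsub>free_module R I\<^esub> free_gen R j) = v"
      using insert.prems by (intro ext) (auto simp: free_gen_def carrier_free)
    ultimately show ?case by simp
  qed
  then show ?thesis using assms(4) by (auto simp: carrier_free)
qed

lemma free_maps_eq:
  assumes "cring R" "module R P" "linear_map R (free_module R I) P f" "linear_map R (free_module R I) P g"
    and "\<And>i. i \<in> I \<Longrightarrow> f (free_gen R i) = g (free_gen R i)" "v \<in> carrier (free_module R I)"
  shows "f v = g v"
  using free_induct[OF assms(1) submodule_equalizer[OF module_free[OF assms(1)] assms(2-4)] _ assms(6)]
    assms(5) free_gen_closed[OF assms(1), of _ I] by blast

text \<open>Summing over the support keeps the basis out of the definition, so the same function
  serves every index set on which \<open>\<phi>\<close> takes values in \<open>P\<close>.\<close>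

definition free_lift ::
    "('a, 'r) ring_scheme \<Rightarrow> ('a, 'p) module \<Rightarrow> ('i \<Rightarrow> 'p) \<Rightarrow> ('i \<Rightarrow> 'a) \<Rightarrow> 'p" where
  "free_lift R P \<phi> v = (\<Oplus>\<^bsub>P\<^esub>i\<in>{i. v i \<noteq> \<zero>\<^bsub>R\<^esub>}. v i \<odot>\<^bsub>P\<^esub> \<phi> i)"

text \<open>Supports change under addition and scaling. Linearity is therefore proved over a common
  finite index set, where the additional terms have coefficient zero.\<close>

lemma free_lift_superset:
  assumes "module R P" "v \<in> carrier (free_module R I)" "\<phi> \<in> I \<rightarrow> carrier P"
    and "finite T" "{i. v i \<noteq> \<zero>\<^bsub>R\<^esub>} \<subseteq> T" "T \<subseteq> I"
  shows "free_lift R P \<phi> v = (\<Oplus>\<^bsub>P\<^esub>i\<in>T. v i \<odot>\<^bsub>P\<^esub> \<phi> i)"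
proof -
  interpret P: module R P by fact
  show ?thesis
    unfolding free_lift_def
    using assms by (intro P.M.add.finprod_mono_neutral_cong_left) (auto simp: carrier_free Pi_iff subset_iff)
qed

lemma linear_map_free_lift:
  assumes "module R P" "\<phi> \<in> I \<rightarrow> carrier P"
  shows "linear_map R (free_module R I) P (free_lift R P \<phi>)"
proof -
  interpret P: module R P by fact
  interpret F: module R "free_module R I" by (rule module_free) (rule P.R.cring_axioms)
  have cl: "v i \<odot>\<^bsub>P\<^esub> \<phi> i \<in> carrier P" if "v \<in> carrier (free_module R I)" "i \<in> I" for v i
    using that assms(2) by (auto simp: carrier_free)
  show ?thesis
  proof (rule linear_mapI)
    fix v assume v: "v \<in> carrier (free_module R I)"
    then show "free_lift R P \<phi> v \<in> carrier P"
      unfolding free_lift_def using cl by (intro P.M.finsum_closed) (auto simp: carrier_free)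
    fix r assume r: "r \<in> carrier R"
    let ?T = "{i. v i \<noteq> \<zero>\<^bsub>R\<^esub>}"
    have T: "finite ?T" "?T \<subseteq> I" using v by (auto simp: carrier_free)
    have "free_lift R P \<phi> (r \<odot>\<^bsub>free_module R I\<^esub> v) = (\<Oplus>\<^bsub>P\<^esub>i\<in>?T. (r \<odot>\<^bsub>free_module R I\<^esub> v) i \<odot>\<^bsub>P\<^esub> \<phi> i)"
      using v r by (intro free_lift_superset[OF assms(1) F.smult_closed[OF r v] assms(2) T(1) _ T(2)]) auto
    also have "\<dots> = (\<Oplus>\<^bsub>P\<^esub>i\<in>?T. r \<odot>\<^bsub>P\<^esub> (v i \<odot>\<^bsub>P\<^esub> \<phi> i))"
      using v r cl T assms(2) by (intro P.M.finsum_cong') (auto simp: carrier_free P.smult_assoc1 Pi_iff)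
    also have "\<dots> = r \<odot>\<^bsub>P\<^esub> free_lift R P \<phi> v"
      unfolding free_lift_def using cl[OF v] T r by (intro P.finsum_smult_ldistr[symmetric]) auto
    finally show "free_lift R P \<phi> (r \<odot>\<^bsub>free_module R I\<^esub> v) = r \<odot>\<^bsub>P\<^esub> free_lift R P \<phi> v" .
  next
    fix v w assume vw: "v \<in> carrier (free_module R I)" "w \<in> carrier (free_module R I)"
    let ?T = "{i. v i \<noteq> \<zero>\<^bsub>R\<^esub>} \<union> {i. w i \<noteq> \<zero>\<^bsub>R\<^esub>}"
    have T: "finite ?T" "?T \<subseteq> I" using vw by (auto simp: carrier_free)
    have "free_lift R P \<phi> (v \<oplus>\<^bsub>free_module R I\<^esub> w) = (\<Oplus>\<^bsub>P\<^esub>i\<in>?T. (v \<oplus>\<^bsub>free_module R I\<^esub> w) i \<odot>\<^bsub>P\<^esub> \<phi> i)"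
      using vw by (intro free_lift_superset[OF assms(1) F.M.a_closed[OF vw] assms(2) T(1) _ T(2)]) auto
    also have "\<dots> = (\<Oplus>\<^bsub>P\<^esub>i\<in>?T. v i \<odot>\<^bsub>P\<^esub> \<phi> i \<oplus>\<^bsub>P\<^esub> w i \<odot>\<^bsub>P\<^esub> \<phi> i)"
      using vw cl T assms(2) by (intro P.M.finsum_cong') (auto simp: carrier_free P.smult_l_distr Pi_iff subset_iff)
    also have "\<dots> = (\<Oplus>\<^bsub>P\<^esub>i\<in>?T. v i \<odot>\<^bsub>P\<^esub> \<phi> i) \<oplus>\<^bsub>P\<^esub> (\<Oplus>\<^bsub>P\<^esub>i\<in>?T. w i \<odot>\<^bsub>P\<^esub> \<phi> i)"
      using cl vw T by (intro P.M.finsum_addf) auto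
    also have "\<dots> = free_lift R P \<phi> v \<oplus>\<^bsub>P\<^esub> free_lift R P \<phi> w"
      using free_lift_superset[OF assms(1) vw(1) assms(2) T(1) _ T(2)]
        free_lift_superset[OF assms(1) vw(2) assms(2) T(1) _ T(2)] by simp
    finally show "free_lift R P \<phi> (v \<oplus>\<^bsub>free_module R I\<^esub> w) = free_lift R P \<phi> v \<oplus>\<^bsub>P\<^esub> free_lift R P \<phi> w" .
  qed
qed

lemma free_lift_gen:
  assumes "module R P" "\<phi> \<in> I \<rightarrow> carrier P" "i \<in> I"
  shows "free_lift R P \<phi> (free_gen R i) = \<phi> i"
proof -
  interpret P: module R P by fact
  have "free_lift R P \<phi> (free_gen R i) = (\<Oplus>\<^bsub>P\<^esub>j\<in>{i}. free_gen R i j \<odot>\<^bsub>P\<^esub> \<phi> j)"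
    using assms by (intro free_lift_superset[OF assms(1) free_gen_closed[OF P.R.cring_axioms assms(3)] assms(2)])
      (auto simp: free_gen_def)
  then show ?thesis using assms by (auto simp: free_gen_def Pi_iff)
qed

text \<open>A preimage under \<open>q\<close> is picked for the image of each basis element.
  Liftings of maps out of the resolutions are obtained from this.\<close>

lemma free_projective:
  assumes "module R M" "module R N" "linear_map R M N q" "q ` carrier M = carrier N"
    and "linear_map R (free_module R I) N f"
  obtains g where "linear_map R (free_module R I) M g"
    "\<And>v. v \<in> carrier (free_module R I) \<Longrightarrow> q (g v) = f v"
proof -
  interpret M: module R M by fact
  define \<phi> where "\<phi> i = inv_into (carrier M) q (f (free_gen R i))" for i
  have fN: "f (free_gen R i) \<in> carrier N" if "i \<in> I" for i
    using linear_map_closed[OF assms(5)] free_gen_closed[OF M.R.cring_axioms that] .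
  have \<phi>: "\<phi> \<in> I \<rightarrow> carrier M" using fN assms(4) by (auto simp: \<phi>_def inv_into_into)
  have q\<phi>: "q (\<phi> i) = f (free_gen R i)" if "i \<in> I" for i
    using fN[OF that] assms(4) by (simp add: \<phi>_def f_inv_into_f)
  have lin: "linear_map R (free_module R I) M (free_lift R M \<phi>)"
    by (rule linear_map_free_lift[OF assms(1) \<phi>])
  show ?thesis
  proof (rule that[OF lin])
    fix v assume v: "v \<in> carrier (free_module R I)"
    show "q (free_lift R M \<phi> v) = f v"
      by (rule free_maps_eq[OF M.R.cring_axioms assms(2) linear_map_compose[OF lin assms(3)] assms(5) _ v])
        (simp add: free_lift_gen[OF assms(1) \<phi>] q\<phi>)
  qed
qed

section \<open>Tensor products\<close>

definition bilinear_map ::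
    "('a, 'r) ring_scheme \<Rightarrow> ('a, 'm) module \<Rightarrow> ('a, 'n) module \<Rightarrow> ('a, 'p) module \<Rightarrow>
     ('m \<Rightarrow> 'n \<Rightarrow> 'p) \<Rightarrow> bool" where
  "bilinear_map R M N P \<beta> \<longleftrightarrow>
     (\<forall>x\<in>carrier M. linear_map R N P (\<beta> x)) \<and>
     (\<forall>y\<in>carrier N. linear_map R M P (\<lambda>x. \<beta> x y))"

lemma bilinear_mapI:
  assumes "\<And>x. x \<in> carrier M \<Longrightarrow> linear_map R N P (\<beta> x)"
    and "\<And>y. y \<in> carrier N \<Longrightarrow> linear_map R M P (\<lambda>x. \<beta> x y)"
  shows "bilinear_map R M N P \<beta>"
  using assms by (simp add: bilinear_map_def)

lemma linear_map_coset_kernel_factor: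
  assumes "module R M" "module R P" "submodule U R M" "linear_map R M P f" "\<And>x. x \<in> U \<Longrightarrow> f x = \<zero>\<^bsub>P\<^esub>"
  obtains g where "linear_map R (quotient_module M U) P g" "\<And>x. x \<in> carrier M \<Longrightarrow> g (U +>\<^bsub>M\<^esub> x) = f x"
proof (rule factor_through_surjection[OF assms(1) module_quotient[OF assms(1,3)] assms(2)
      linear_map_coset[OF assms(1,3)] carrier_quotient[symmetric] assms(4)])
  fix x assume "x \<in> carrier M" "U +>\<^bsub>M\<^esub> x = \<zero>\<^bsub>quotient_module M U\<^esub>"
  then show "f x = \<zero>\<^bsub>P\<^esub>" using assms(5) coset_eq_zero_iff[OF assms(1,3)] by simp
qed (use that in auto)

locale module_pair =
  fixes R :: "('a, 'r) ring_scheme" and M :: "('a, 'm) module" and N :: "('a, 'n) module"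
  assumes module_left: "module R M" and module_right: "module R N"
begin

sublocale M: module R M by (rule module_left)
sublocale N: module R N by (rule module_right)

abbreviation "F \<equiv> free_module R (carrier M \<times> carrier N)"

lemma module_F: "module R F"
  by (rule module_free) (rule M.R.cring_axioms)

sublocale F: module R F by (rule module_F)

lemma gen_closed: "x \<in> carrier M \<Longrightarrow> y \<in> carrier N \<Longrightarrow> free_gen R (x, y) \<in> carrier F"
  by (rule free_gen_closed[OF M.R.cring_axioms]) simp

lemma tensor_rels_subset: "tensor_rels R M N \<subseteq> carrier F"
  unfolding tensor_rels_def Let_def
  by (auto intro!: F.M.minus_closed F.M.a_closed F.smult_closed gen_closed)

lemma submodule_tensor: "submodule (tensor_submodule R M N) R F"
  unfolding tensor_submodule_def by (rule submodule_span[OF module_F tensor_rels_subset])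

lemma module_tensor: "module R (tensor_module R M N)"
  unfolding tensor_module_def by (rule module_quotient[OF module_F submodule_tensor])

lemma linear_tensor_coset:
  "linear_map R F (tensor_module R M N) (\<lambda>v. tensor_submodule R M N +>\<^bsub>F\<^esub> v)"
  unfolding tensor_module_def by (rule linear_map_coset[OF module_F submodule_tensor])

lemma pure_tensor_closed:
  "x \<in> carrier M \<Longrightarrow> y \<in> carrier N \<Longrightarrow> pure_tensor R M N x y \<in> carrier (tensor_module R M N)"
  unfolding pure_tensor_def by (rule linear_map_closed[OF linear_tensor_coset gen_closed])

lemma tensor_coset_eq:
  assumes "v \<in> carrier F" "w \<in> carrier F" "v \<ominus>\<^bsub>F\<^esub> w \<in> tensor_rels R M N"
  shows "tensor_submodule R M N +>\<^bsub>F\<^esub> v = tensor_submodule R M N +>\<^bsub>F\<^esub> w"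
  using assms span_superset[of "tensor_rels R M N" R F]
  by (subst coset_eq_iff[OF module_F submodule_tensor]) (auto simp: tensor_submodule_def)

lemma pure_tensor_add_left:
  assumes "x \<in> carrier M" "x' \<in> carrier M" "y \<in> carrier N"
  shows "pure_tensor R M N (x \<oplus>\<^bsub>M\<^esub> x') y =
    pure_tensor R M N x y \<oplus>\<^bsub>tensor_module R M N\<^esub> pure_tensor R M N x' y"
  unfolding pure_tensor_def using assms
  by (subst linear_map_add[OF linear_tensor_coset, symmetric];
      (intro tensor_coset_eq F.M.a_closed F.smult_closed gen_closed)?)
    (auto simp: tensor_rels_def Let_def)

lemma pure_tensor_add_right:
  assumes "x \<in> carrier M" "y \<in> carrier N" "y' \<in> carrier N"
  shows "pure_tensor R M N x (y \<oplus>\<^bsub>N\<^esub> y') =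
    pure_tensor R M N x y \<oplus>\<^bsub>tensor_module R M N\<^esub> pure_tensor R M N x y'"
  unfolding pure_tensor_def using assms
  by (subst linear_map_add[OF linear_tensor_coset, symmetric];
      (intro tensor_coset_eq F.M.a_closed F.smult_closed gen_closed)?)
    (auto simp: tensor_rels_def Let_def)

lemma pure_tensor_smult_left:
  assumes "r \<in> carrier R" "x \<in> carrier M" "y \<in> carrier N"
  shows "pure_tensor R M N (r \<odot>\<^bsub>M\<^esub> x) y = r \<odot>\<^bsub>tensor_module R M N\<^esub> pure_tensor R M N x y"
  unfolding pure_tensor_def using assms
  by (subst linear_map_smult[OF linear_tensor_coset, symmetric];
      (intro tensor_coset_eq F.M.a_closed F.smult_closed gen_closed)?)
    (auto simp: tensor_rels_def Let_def)

lemma pure_tensor_smult_right: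
  assumes "r \<in> carrier R" "x \<in> carrier M" "y \<in> carrier N"
  shows "pure_tensor R M N x (r \<odot>\<^bsub>N\<^esub> y) = r \<odot>\<^bsub>tensor_module R M N\<^esub> pure_tensor R M N x y"
  unfolding pure_tensor_def using assms
  by (subst linear_map_smult[OF linear_tensor_coset, symmetric];
      (intro tensor_coset_eq F.M.a_closed F.smult_closed gen_closed)?)
    (auto simp: tensor_rels_def Let_def)

lemma linear_pure_right: "x \<in> carrier M \<Longrightarrow> linear_map R N (tensor_module R M N) (pure_tensor R M N x)"
  by (rule linear_mapI) (simp_all add: pure_tensor_closed pure_tensor_add_right pure_tensor_smult_right)

lemma linear_pure_left:
  "y \<in> carrier N \<Longrightarrow> linear_map R M (tensor_module R M N) (\<lambda>x. pure_tensor R M N x y)"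
  by (rule linear_mapI) (simp_all add: pure_tensor_closed pure_tensor_add_left pure_tensor_smult_left)

lemma pure_tensor_zero_left: "y \<in> carrier N \<Longrightarrow> pure_tensor R M N \<zero>\<^bsub>M\<^esub> y = \<zero>\<^bsub>tensor_module R M N\<^esub>"
  using linear_map_zero[OF module_left module_tensor linear_pure_left] .

lemma pure_tensor_zero_right: "x \<in> carrier M \<Longrightarrow> pure_tensor R M N x \<zero>\<^bsub>N\<^esub> = \<zero>\<^bsub>tensor_module R M N\<^esub>"
  using linear_map_zero[OF module_right module_tensor linear_pure_right] .

lemma tensor_induct:
  assumes "submodule U R (tensor_module R M N)"
    and "\<And>x y. x \<in> carrier M \<Longrightarrow> y \<in> carrier N \<Longrightarrow> pure_tensor R M N x y \<in> U"
    and "t \<in> carrier (tensor_module R M N)"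
  shows "t \<in> U"
proof -
  obtain v where v: "v \<in> carrier F" "t = tensor_submodule R M N +>\<^bsub>F\<^esub> v"
    using assms(3) by (auto simp: tensor_module_def carrier_quotient)
  have "v \<in> {v \<in> carrier F. tensor_submodule R M N +>\<^bsub>F\<^esub> v \<in> U}"
    using assms(2) gen_closed
    by (intro free_induct[OF M.R.cring_axioms submodule_vimage[OF module_F module_tensor linear_tensor_coset assms(1)] _ v(1)])
      (auto simp: pure_tensor_def)
  then show ?thesis using v by simp
qed

lemma tensor_maps_eq:
  assumes "module R P" "linear_map R (tensor_module R M N) P f" "linear_map R (tensor_module R M N) P g"
    and "\<And>x y. x \<in> carrier M \<Longrightarrow> y \<in> carrier N \<Longrightarrow> f (pure_tensor R M N x y) = g (pure_tensor R M N x y)"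
    and "t \<in> carrier (tensor_module R M N)"
  shows "f t = g t"
  using tensor_induct[OF submodule_equalizer[OF module_tensor assms(1-3)] _ assms(5)]
    assms(4) pure_tensor_closed by blast

text \<open>The free lift of \<open>\<beta>\<close> kills each of the four families in
  \<open>tensor_rels\<close> by bilinearity, hence their span, and so descends to the
  quotient.\<close>

lemma tensor_universal:
  assumes "module R P" "bilinear_map R M N P \<beta>"
  obtains \<theta> where "linear_map R (tensor_module R M N) P \<theta>"
    "\<And>x y. x \<in> carrier M \<Longrightarrow> y \<in> carrier N \<Longrightarrow> \<theta> (pure_tensor R M N x y) = \<beta> x y"
proof -
  interpret P: module R P by fact
  have left: "linear_map R M P (\<lambda>x. \<beta> x y)" if "y \<in> carrier N" for y
    using assms(2) that by (simp add: bilinear_map_def)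
  have right: "linear_map R N P (\<beta> x)" if "x \<in> carrier M" for x
    using assms(2) that by (simp add: bilinear_map_def)
  have cl: "\<beta> x y \<in> carrier P" if "x \<in> carrier M" "y \<in> carrier N" for x y
    using linear_map_closed[OF right] that by blast
  let ?\<phi> = "\<lambda>(x, y). \<beta> x y"
  have \<phi>: "?\<phi> \<in> carrier M \<times> carrier N \<rightarrow> carrier P" using cl by auto
  let ?f = "free_lift R P ?\<phi>"
  have f: "linear_map R F P ?f" by (rule linear_map_free_lift[OF assms(1) \<phi>])
  have f_gen: "?f (free_gen R (x, y)) = \<beta> x y" if "x \<in> carrier M" "y \<in> carrier N" for x y
    using free_lift_gen[OF assms(1) \<phi>, of "(x, y)"] that by simp
  note f_simps = linear_map_minus[OF module_F assms(1) f] linear_map_add[OF f] linear_map_smult[OF f]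
    f_gen gen_closed P.M.minus_eq_zero_iff
  have "tensor_rels R M N \<subseteq> {v \<in> carrier F. ?f v = \<zero>\<^bsub>P\<^esub>}"
    unfolding tensor_rels_def Let_def
    by (auto simp: f_simps cl linear_map_add[OF left] linear_map_add[OF right]
      linear_map_smult[OF left] linear_map_smult[OF right])
  then have "tensor_submodule R M N \<subseteq> {v \<in> carrier F. ?f v = \<zero>\<^bsub>P\<^esub>}"
    unfolding tensor_submodule_def
    by (intro span_minimal submodule_kernel[OF module_F assms(1) f])
  then obtain g where g: "linear_map R (tensor_module R M N) P g"
      "\<And>v. v \<in> carrier F \<Longrightarrow> g (tensor_submodule R M N +>\<^bsub>F\<^esub> v) = ?f v"
    using linear_map_coset_kernel_factor[OF module_F assms(1) submodule_tensor f]
    unfolding tensor_module_def by blast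
  then show ?thesis using that[OF g(1)] f_gen gen_closed by (simp add: pure_tensor_def)
qed

text \<open>This justifies the \<open>THE\<close>. Pure tensors determine \<open>\<theta>\<close> on
  the carrier; membership in \<open>hom_module\<close> makes it extensional and so determines it
  elsewhere.\<close>

lemma tensor_lift:
  assumes "module R P" "bilinear_map R M N P \<beta>"
  shows "tensor_lift R M N P \<beta> \<in> carrier (hom_module R (tensor_module R M N) P) \<and>
    (\<forall>x\<in>carrier M. \<forall>y\<in>carrier N. tensor_lift R M N P \<beta> (pure_tensor R M N x y) = \<beta> x y)"
proof -
  obtain \<theta> where \<theta>: "linear_map R (tensor_module R M N) P \<theta>"
    "\<And>x y. x \<in> carrier M \<Longrightarrow> y \<in> carrier N \<Longrightarrow> \<theta> (pure_tensor R M N x y) = \<beta> x y"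
    using tensor_universal[OF assms] by blast
  let ?P = "\<lambda>\<theta>. \<theta> \<in> carrier (hom_module R (tensor_module R M N) P) \<and>
    (\<forall>x\<in>carrier M. \<forall>y\<in>carrier N. \<theta> (pure_tensor R M N x y) = \<beta> x y)"
  have ex: "?P (restrict \<theta> (carrier (tensor_module R M N)))"
    using restrict_in_hom[OF module_tensor \<theta>(1)] \<theta>(2) pure_tensor_closed by simp
  have "\<eta> = \<eta>'" if \<eta>: "?P \<eta>" "?P \<eta>'" for \<eta> \<eta>'
  proof (rule hom_eqI)
    show "\<eta> \<in> carrier (hom_module R (tensor_module R M N) P)" "\<eta>' \<in> carrier (hom_module R (tensor_module R M N) P)"
      using \<eta> by auto
    fix t assume t: "t \<in> carrier (tensor_module R M N)"
    show "\<eta> t = \<eta>' t"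
      by (rule tensor_maps_eq[OF assms(1) hom_linear hom_linear _ t]) (use \<eta> in auto)
  qed
  with ex have "\<exists>!\<theta>. ?P \<theta>" by blast
  from theI'[OF this] show ?thesis unfolding tensor_lift_def .
qed

lemma linear_tensor_lift:
  "module R P \<Longrightarrow> bilinear_map R M N P \<beta> \<Longrightarrow> linear_map R (tensor_module R M N) P (tensor_lift R M N P \<beta>)"
  using tensor_lift hom_linear by blast

lemma tensor_lift_pure:
  "module R P \<Longrightarrow> bilinear_map R M N P \<beta> \<Longrightarrow> x \<in> carrier M \<Longrightarrow> y \<in> carrier N \<Longrightarrow>
    tensor_lift R M N P \<beta> (pure_tensor R M N x y) = \<beta> x y"
  using tensor_lift by blast

end

lemmas module_tensor = module_pair.module_tensor[OF module_pair.intro]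
lemmas pure_tensor_closed = module_pair.pure_tensor_closed[OF module_pair.intro]
lemmas linear_pure_right = module_pair.linear_pure_right[OF module_pair.intro]
lemmas linear_pure_left = module_pair.linear_pure_left[OF module_pair.intro]
lemmas pure_tensor_zero_left = module_pair.pure_tensor_zero_left[OF module_pair.intro]
lemmas pure_tensor_zero_right = module_pair.pure_tensor_zero_right[OF module_pair.intro]
lemmas tensor_induct = module_pair.tensor_induct[OF module_pair.intro]
lemmas tensor_maps_eq = module_pair.tensor_maps_eq[OF module_pair.intro]
lemmas tensor_universal = module_pair.tensor_universal[OF module_pair.intro]
lemmas linear_tensor_lift = module_pair.linear_tensor_lift[OF module_pair.intro]
lemmas tensor_lift_pure = module_pair.tensor_lift_pure[OF module_pair.intro]

lemma bilinear_tensor_map: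
  assumes "module R P" "module R Q" "linear_map R M P f" "linear_map R N Q g"
  shows "bilinear_map R M N (tensor_module R P Q) (\<lambda>x y. pure_tensor R P Q (f x) (g y))"
  using linear_map_compose[OF assms(4) linear_pure_right[OF assms(1,2)]]
    linear_map_compose[OF assms(3) linear_pure_left[OF assms(1,2)]]
    linear_map_closed[OF assms(3)] linear_map_closed[OF assms(4)]
  by (intro bilinear_mapI) blast+

lemma linear_tensor_map:
  assumes "module R M" "module R N" "module R P" "module R Q" "linear_map R M P f" "linear_map R N Q g"
  shows "linear_map R (tensor_module R M N) (tensor_module R P Q) (tensor_map R M N P Q f g)"
  unfolding tensor_map_def
  by (rule linear_tensor_lift[OF assms(1,2) module_tensor[OF assms(3,4)] bilinear_tensor_map[OF assms(3-6)]])

lemma tensor_map_pure: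
  assumes "module R M" "module R N" "module R P" "module R Q" "linear_map R M P f" "linear_map R N Q g"
    and "x \<in> carrier M" "y \<in> carrier N"
  shows "tensor_map R M N P Q f g (pure_tensor R M N x y) = pure_tensor R P Q (f x) (g y)"
  unfolding tensor_map_def
  by (rule tensor_lift_pure[OF assms(1,2) module_tensor[OF assms(3,4)] bilinear_tensor_map[OF assms(3-6)] assms(7,8)])

section \<open>Right exactness of the tensor product\<close>

lemma linear_map_id': "linear_map R M M id"
  by (rule linear_mapI) auto

abbreviation (input) tmap ::
    "('a, 'r) ring_scheme \<Rightarrow> ('a, 'm) module \<Rightarrow> ('a, 'n) module \<Rightarrow> ('a, 'c) module \<Rightarrow>
     ('m \<Rightarrow> 'n) \<Rightarrow> ('m \<times> 'c \<Rightarrow> 'a) set \<Rightarrow> ('n \<times> 'c \<Rightarrow> 'a) set" where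
  "tmap R M N C f \<equiv> tensor_map R M C N C f id"

lemma linear_tmap:
  assumes "module R M" "module R N" "module R C" "linear_map R M N f"
  shows "linear_map R (tensor_module R M C) (tensor_module R N C) (tmap R M N C f)"
  by (intro linear_tensor_map linear_map_id' assms)

lemma tmap_pure:
  assumes "module R M" "module R N" "module R C" "linear_map R M N f" "x \<in> carrier M" "c \<in> carrier C"
  shows "tmap R M N C f (pure_tensor R M C x c) = pure_tensor R N C (f x) c"
  using tensor_map_pure[OF assms(1,3,2,3,4) linear_map_id' assms(5,6)] by simp

lemma tmap_compose:
  assumes "module R M" "module R N" "module R P" "module R C" "linear_map R M N f" "linear_map R N P g"
    and "t \<in> carrier (tensor_module R M C)"
  shows "tmap R N P C g (tmap R M N C f t) = tmap R M P C (\<lambda>x. g (f x)) t"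
  by (rule tensor_maps_eq[OF assms(1,4) module_tensor[OF assms(3,4)]
        linear_map_compose[OF linear_tmap[OF assms(1,2,4,5)] linear_tmap[OF assms(2,3,4,6)]]
        linear_tmap[OF assms(1,3,4) linear_map_compose[OF assms(5,6)]] _ assms(7)])
    (simp add: tmap_pure assms linear_map_compose[OF assms(5,6)] linear_map_closed[OF assms(5)])

lemma tmap_surj:
  assumes "module R M" "module R N" "module R C" "linear_map R M N f" "f ` carrier M = carrier N"
  shows "tmap R M N C f ` carrier (tensor_module R M C) = carrier (tensor_module R N C)"
proof
  have lin: "linear_map R (tensor_module R M C) (tensor_module R N C) (tmap R M N C f)"
    by (rule linear_tmap[OF assms(1-4)])
  show "tmap R M N C f ` carrier (tensor_module R M C) \<subseteq> carrier (tensor_module R N C)"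
    using linear_map_closed[OF lin] by blast
  show "carrier (tensor_module R N C) \<subseteq> tmap R M N C f ` carrier (tensor_module R M C)"
  proof
    fix t assume t: "t \<in> carrier (tensor_module R N C)"
    show "t \<in> tmap R M N C f ` carrier (tensor_module R M C)"
    proof (rule tensor_induct[OF assms(2,3) submodule_image[OF _ _ lin] _ t])
      fix y c assume y: "y \<in> carrier N" and c: "c \<in> carrier C"
      then obtain x where "x \<in> carrier M" "y = f x" using assms(5) by blast
      then show "pure_tensor R N C y c \<in> tmap R M N C f ` carrier (tensor_module R M C)"
        using tmap_pure[OF assms(1-4) _ c, of x, symmetric] pure_tensor_closed[OF assms(1,3) _ c]
        by blast
    qed (rule module_tensor[OF assms(1,3)] module_tensor[OF assms(2,3)])+
  qed
qed

text \<open>Modulo the image of \<open>i \<otimes> C\<close>, the class of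
  \<open>x \<otimes> c\<close> depends only on \<open>q x\<close> and \<open>c\<close>. This gives a
  map \<open>\<theta>\<close> from \<open>N \<otimes> C\<close> to the cokernel \<open>?Q\<close>
  whose composite with \<open>q \<otimes> C\<close> is the projection; what
  \<open>q \<otimes> C\<close> kills is therefore zero in \<open>?Q\<close>.\<close>

lemma tensor_right_exact:
  assumes "module R L" "module R M" "module R N" "module R C" "linear_map R L M i" "linear_map R M N q"
    and "q ` carrier M = carrier N" "i ` carrier L = {x \<in> carrier M. q x = \<zero>\<^bsub>N\<^esub>}"
    and "t \<in> carrier (tensor_module R M C)" "tmap R M N C q t = \<zero>\<^bsub>tensor_module R N C\<^esub>"
  shows "t \<in> tmap R L M C i ` carrier (tensor_module R L C)"
proof -
  interpret M: module R M by fact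
  interpret C: module R C by fact
  let ?T = "tensor_module R M C"
  let ?U = "tmap R L M C i ` carrier (tensor_module R L C)"
  let ?Q = "quotient_module ?T ?U"
  have T: "module R ?T" by (rule module_tensor[OF assms(2,4)])
  have U: "submodule ?U R ?T"
    by (rule submodule_image[OF module_tensor[OF assms(1,4)] T linear_tmap[OF assms(1,2,4,5)]])
  have Q: "module R ?Q" by (rule module_quotient[OF T U])
  let ?p = "\<lambda>s. ?U +>\<^bsub>?T\<^esub> s"
  have p: "linear_map R ?T ?Q ?p" by (rule linear_map_coset[OF T U])
  have left: "linear_map R M ?Q (\<lambda>x. ?p (pure_tensor R M C x c))" if "c \<in> carrier C" for c
    by (rule linear_map_compose[OF linear_pure_left[OF assms(2,4) that] p])
  have right: "linear_map R C ?Q (\<lambda>c. ?p (pure_tensor R M C x c))" if "x \<in> carrier M" for x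
    by (rule linear_map_compose[OF linear_pure_right[OF assms(2,4) that] p])
  have "\<exists>g. linear_map R N ?Q g \<and> (\<forall>x\<in>carrier M. g (q x) = ?p (pure_tensor R M C x c))"
    if c: "c \<in> carrier C" for c
  proof -
    have zero: "?p (pure_tensor R M C x c) = \<zero>\<^bsub>?Q\<^esub>" if x: "x \<in> carrier M" "q x = \<zero>\<^bsub>N\<^esub>" for x
    proof -
      obtain l where l: "l \<in> carrier L" "x = i l" using assms(8) x by blast
      then have "pure_tensor R M C x c = tmap R L M C i (pure_tensor R L C l c)"
        using tmap_pure[OF assms(1,2,4,5) l(1) c] by simp
      then have "pure_tensor R M C x c \<in> ?U" using pure_tensor_closed[OF assms(1,4) l(1) c] by blast
      then show ?thesis
        using coset_eq_zero_iff[OF T U pure_tensor_closed[OF assms(2,4) x(1) c]] by simp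
    qed
    show ?thesis
      by (rule factor_through_surjection[OF assms(2,3) Q assms(6,7) left[OF c] zero]) blast+
  qed
  then obtain g where g: "\<And>c. c \<in> carrier C \<Longrightarrow> linear_map R N ?Q (g c)"
      "\<And>c x. c \<in> carrier C \<Longrightarrow> x \<in> carrier M \<Longrightarrow> g c (q x) = ?p (pure_tensor R M C x c)"
    by metis
  have bil: "bilinear_map R N C ?Q (\<lambda>y c. g c y)"
  proof (rule bilinear_mapI)
    fix y assume "y \<in> carrier N"
    then obtain x where x: "x \<in> carrier M" "y = q x" using assms(7) by blast
    \<comment> \<open>The maps \<open>g c\<close> were chosen separately for each \<open>c\<close>,
      but surjectivity of \<open>q\<close> forces their values on \<open>carrier N\<close>, which
      makes them linear in \<open>c\<close>.\<close>
    have "linear_map R C ?Q (\<lambda>c. g c y) = linear_map R C ?Q (\<lambda>c. ?p (pure_tensor R M C x c))"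
      by (rule linear_map_cong[OF assms(4)]) (simp add: g(2) x)
    then show "linear_map R C ?Q (\<lambda>c. g c y)" using right[OF x(1)] by simp
  qed (rule g(1))
  obtain \<theta> where \<theta>: "linear_map R (tensor_module R N C) ?Q \<theta>"
      "\<And>y c. y \<in> carrier N \<Longrightarrow> c \<in> carrier C \<Longrightarrow> \<theta> (pure_tensor R N C y c) = g c y"
    by (rule tensor_universal[OF assms(3,4) Q bil]) blast
  have "\<theta> (tmap R M N C q t) = ?p t"
    by (rule tensor_maps_eq[OF assms(2,4) Q linear_map_compose[OF linear_tmap[OF assms(2,3,4,6)] \<theta>(1)] p _ assms(9)])
      (simp add: tmap_pure assms \<theta>(2) g(2) linear_map_closed[OF assms(6)])
  moreover have "\<theta> (tmap R M N C q t) = \<zero>\<^bsub>?Q\<^esub>"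
    unfolding assms(10) by (rule linear_map_zero[OF module_tensor[OF assms(3,4)] Q \<theta>(1)])
  ultimately have "?p t = ?U" unfolding zero_quotient by (rule trans[OF sym])
  then show ?thesis using coset_eq_zero_iff[OF T U assms(9)] by blast
qed

section \<open>Maps out of faithful modules\<close>

text \<open>Existence of an associated prime of \<open>R t\<close>: among the nonzero multiples of
  \<open>t\<close> take \<open>k\<close> with maximal annihilator. The last clause says that this
  annihilator is prime.\<close>

lemma exists_torsion_free_multiple:
  assumes "noetherian_ring R" "module R T" "t \<in> carrier T" "t \<noteq> \<zero>\<^bsub>T\<^esub>"
  obtains k where "k \<in> carrier T" "k \<noteq> \<zero>\<^bsub>T\<^esub>" "\<exists>r\<in>carrier R. k = r \<odot>\<^bsub>T\<^esub> t"
    "\<And>a b. a \<in> carrier R \<Longrightarrow> b \<in> carrier R \<Longrightarrow> a \<odot>\<^bsub>T\<^esub> k \<noteq> \<zero>\<^bsub>T\<^esub> \<Longrightarrow> b \<odot>\<^bsub>T\<^esub> k \<noteq> \<zero>\<^bsub>T\<^esub> \<Longrightarrow>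
      a \<odot>\<^bsub>T\<^esub> (b \<odot>\<^bsub>T\<^esub> k) \<noteq> \<zero>\<^bsub>T\<^esub>"
proof -
  interpret T: module R T by fact
  interpret R: noetherian_ring R by fact
  define ann where "ann k = {a \<in> carrier R. a \<odot>\<^bsub>T\<^esub> k = \<zero>\<^bsub>T\<^esub>}" for k
  define K where "K = {k. (\<exists>r\<in>carrier R. k = r \<odot>\<^bsub>T\<^esub> t) \<and> k \<noteq> \<zero>\<^bsub>T\<^esub>}"
  have K_closed: "k \<in> carrier T" if "k \<in> K" for k using that assms(3) by (auto simp: K_def)
  have t: "t \<in> K" using assms(3,4) T.smult_one by (force simp: K_def)
  have ideal: "ideal (ann k) R" if "k \<in> K" for k
  proof (rule idealI[OF T.R.ring_axioms])
    show "subgroup (ann k) (add_monoid R)"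
      by (rule T.R.add.subgroupI)
        (use K_closed[OF that] in \<open>auto simp: ann_def T.smult_l_distr T.smult_l_minus simp flip: a_inv_def
          intro: exI[of _ "\<zero>\<^bsub>R\<^esub>"]\<close>)
  next
    fix a x assume a: "a \<in> ann k" and x: "x \<in> carrier R"
    then show "x \<otimes>\<^bsub>R\<^esub> a \<in> ann k" using K_closed[OF that] by (simp add: ann_def T.smult_assoc1)
    then show "a \<otimes>\<^bsub>R\<^esub> x \<in> ann k" using a x by (simp add: T.R.m_comm ann_def)
  qed
  \<comment> \<open>In a Noetherian ring a nonempty chain of ideals contains its union, so Zorn
    applies to the annihilators themselves.\<close>
  have "\<exists>I\<in>ann ` K. \<forall>J\<in>ann ` K. I \<subseteq> J \<longrightarrow> J = I"
  proof (rule subset_Zorn_nonempty)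
    fix \<C> assume C: "\<C> \<noteq> {}" "subset.chain (ann ` K) \<C>"
    then have "subset.chain {I. ideal I R} \<C>" using ideal by (auto simp: subset_chain_def)
    then show "\<Union> \<C> \<in> ann ` K"
      using R.ideal_chain_is_trivial[OF C(1)] C(2) by (auto simp: subset_chain_def)
  qed (use t in blast)
  then obtain k where k: "k \<in> K" and max: "\<And>l. l \<in> K \<Longrightarrow> ann k \<subseteq> ann l \<Longrightarrow> ann l = ann k" by blast
  show ?thesis
  proof (rule that[of k])
    fix a b assume a: "a \<in> carrier R" "a \<odot>\<^bsub>T\<^esub> k \<noteq> \<zero>\<^bsub>T\<^esub>" and b: "b \<in> carrier R" "b \<odot>\<^bsub>T\<^esub> k \<noteq> \<zero>\<^bsub>T\<^esub>"
    obtain r where r: "r \<in> carrier R" "k = r \<odot>\<^bsub>T\<^esub> t" using k by (auto simp: K_def)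
    have bk: "b \<odot>\<^bsub>T\<^esub> k \<in> K"
      using b r assms(3) T.smult_assoc1[of b r t] unfolding K_def
      by (auto intro!: bexI[of _ "b \<otimes>\<^bsub>R\<^esub> r"])
    \<comment> \<open>Passing from \<open>k\<close> to \<open>b k\<close> can only enlarge the
      annihilator, and by maximality it does not. If \<open>a (b k)\<close> were zero,
      \<open>a k\<close> would be zero too.\<close>
    have "ann k \<subseteq> ann (b \<odot>\<^bsub>T\<^esub> k)"
    proof
      fix x assume x: "x \<in> ann k"
      then have "x \<in> carrier R" by (simp add: ann_def)
      then have "x \<odot>\<^bsub>T\<^esub> (b \<odot>\<^bsub>T\<^esub> k) = b \<odot>\<^bsub>T\<^esub> (x \<odot>\<^bsub>T\<^esub> k)"
        using b(1) K_closed[OF k] by (simp add: T.smult_assoc1[symmetric] T.R.m_comm[of x b])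
      then show "x \<in> ann (b \<odot>\<^bsub>T\<^esub> k)" using x b by (simp add: ann_def)
    qed
    then have "ann (b \<odot>\<^bsub>T\<^esub> k) = ann k" by (rule max[OF bk])
    then show "a \<odot>\<^bsub>T\<^esub> (b \<odot>\<^bsub>T\<^esub> k) \<noteq> \<zero>\<^bsub>T\<^esub>" using a by (auto simp: ann_def)
  qed (use k K_closed in \<open>auto simp: K_def\<close>)
qed

lemma span_empty:
  assumes "module R M"
  shows "module_span R M {} = {\<zero>\<^bsub>M\<^esub>}"
  using span_minimal[OF submodule_zero_set[OF assms], of "{}"] submodule_zero[OF submodule_span[OF assms, of "{}"]]
  by auto

lemma span_insert:
  assumes "module R M" "c \<in> carrier M" "S \<subseteq> carrier M" "v \<in> module_span R M (insert c S)"
  obtains u r where "u \<in> module_span R M S" "r \<in> carrier R" "v = u \<oplus>\<^bsub>M\<^esub> r \<odot>\<^bsub>M\<^esub> c"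
proof -
  interpret M: module R M by fact
  let ?U = "module_span R M S"
  have U: "submodule ?U R M" by (rule submodule_span[OF assms(1,3)])
  note Uc = submodule_subset[OF U, THEN subsetD]
  let ?V = "{u \<oplus>\<^bsub>M\<^esub> r \<odot>\<^bsub>M\<^esub> c | u r. u \<in> ?U \<and> r \<in> carrier R}"
  have in_V: "u \<oplus>\<^bsub>M\<^esub> r \<odot>\<^bsub>M\<^esub> c \<in> ?V" if "u \<in> ?U" "r \<in> carrier R" for u r using that by blast
  have U_V: "u \<in> ?V" if "u \<in> ?U" for u using in_V[OF that M.R.zero_closed] assms(2) Uc[OF that] by simp
  have "submodule ?V R M"
  proof (rule submodule_criterion[OF assms(1)])
    show "?V \<subseteq> carrier M" using assms(2) Uc by auto
    show "\<zero>\<^bsub>M\<^esub> \<in> ?V" using U_V submodule_zero[OF U] .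
  next
    fix x y assume "x \<in> ?V" "y \<in> ?V"
    then obtain u r w s where x: "x = u \<oplus>\<^bsub>M\<^esub> r \<odot>\<^bsub>M\<^esub> c" "u \<in> ?U" "r \<in> carrier R"
      and y: "y = w \<oplus>\<^bsub>M\<^esub> s \<odot>\<^bsub>M\<^esub> c" "w \<in> ?U" "s \<in> carrier R" by blast
    have "x \<oplus>\<^bsub>M\<^esub> y = (u \<oplus>\<^bsub>M\<^esub> w) \<oplus>\<^bsub>M\<^esub> (r \<oplus>\<^bsub>R\<^esub> s) \<odot>\<^bsub>M\<^esub> c"
      using x y assms(2) Uc by (simp add: M.smult_l_distr M.M.a_ac)
    then show "x \<oplus>\<^bsub>M\<^esub> y \<in> ?V" using in_V submodule_add[OF U x(2) y(2)] x(3) y(3) by auto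
  next
    fix a x assume a: "a \<in> carrier R" and "x \<in> ?V"
    then obtain u r where x: "x = u \<oplus>\<^bsub>M\<^esub> r \<odot>\<^bsub>M\<^esub> c" "u \<in> ?U" "r \<in> carrier R" by blast
    have "a \<odot>\<^bsub>M\<^esub> x = a \<odot>\<^bsub>M\<^esub> u \<oplus>\<^bsub>M\<^esub> (a \<otimes>\<^bsub>R\<^esub> r) \<odot>\<^bsub>M\<^esub> c"
      using x a assms(2) Uc by (simp add: M.smult_r_distr M.smult_assoc1)
    then show "a \<odot>\<^bsub>M\<^esub> x \<in> ?V" using in_V submodule_smult[OF U a x(2)] x(3) a by auto
  qed
  moreover have "insert c S \<subseteq> ?V"
    using U_V span_superset[of S R M] in_V[OF submodule_zero[OF U] M.R.one_closed] assms(2) by auto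
  ultimately show ?thesis using that span_minimal[of ?V R M "insert c S"] assms(4) by blast
qed

text \<open>Induction on the generators. If some \<open>s\<close> with \<open>s k \<noteq> 0\<close> multiplies the new generator \<open>c\<close> into the
  old span, both alternatives carry over along multiplication by \<open>s\<close>; otherwise \<open>u + r c \<mapsto> r k\<close> is well
  defined on the new span.\<close>

lemma annihilated_or_nonzero_map:
  fixes C :: "('a, 'c) module" and T :: "('a, 't) module"
  assumes "module R C" "module R T" "k \<in> carrier T" "k \<noteq> \<zero>\<^bsub>T\<^esub>"
    and dom: "\<And>a b. a \<in> carrier R \<Longrightarrow> b \<in> carrier R \<Longrightarrow> a \<odot>\<^bsub>T\<^esub> k \<noteq> \<zero>\<^bsub>T\<^esub> \<Longrightarrow> b \<odot>\<^bsub>T\<^esub> k \<noteq> \<zero>\<^bsub>T\<^esub> \<Longrightarrow>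
      a \<odot>\<^bsub>T\<^esub> (b \<odot>\<^bsub>T\<^esub> k) \<noteq> \<zero>\<^bsub>T\<^esub>"
    and "finite S" "S \<subseteq> carrier C"
  shows "(\<exists>s\<in>carrier R. s \<odot>\<^bsub>T\<^esub> k \<noteq> \<zero>\<^bsub>T\<^esub> \<and> (\<forall>u\<in>module_span R C S. s \<odot>\<^bsub>C\<^esub> u = \<zero>\<^bsub>C\<^esub>)) \<or>
    (\<exists>f. linear_map R (C\<lparr>carrier := module_span R C S\<rparr>) T f \<and>
      (\<forall>u\<in>module_span R C S. \<exists>r\<in>carrier R. f u = r \<odot>\<^bsub>T\<^esub> k) \<and>
      (\<exists>u\<in>module_span R C S. f u \<noteq> \<zero>\<^bsub>T\<^esub>))"
  using assms(6,7)
proof (induction S rule: finite_induct)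
  case empty
  interpret C: module R C by fact
  interpret T: module R T by fact
  \<comment> \<open>Without generators the span is zero and \<open>\<one>\<close> annihilates it,
    while \<open>\<one>\<close> does not kill \<open>k\<close>.\<close>
  show ?case using assms(3,4) by (intro disjI1 bexI[of _ "\<one>\<^bsub>R\<^esub>"]) (auto simp: span_empty[OF assms(1)])
next
  case (insert c S)
  interpret C: module R C by fact
  interpret T: module R T by fact
  let ?U = "module_span R C S" and ?V = "module_span R C (insert c S)"
  have c: "c \<in> carrier C" and S: "S \<subseteq> carrier C" using insert.prems by auto
  have U: "submodule ?U R C" by (rule submodule_span[OF assms(1) S])
  have V: "submodule ?V R C" by (rule submodule_span[OF assms(1) insert.prems])
  have UV: "?U \<subseteq> ?V" using span_superset[of "insert c S" R C] by (intro span_minimal[OF V]) auto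
  have cV: "c \<in> ?V" using span_superset[of "insert c S" R C] by auto
  note Uc = submodule_subset[OF U, THEN subsetD]
  note Vc = submodule_subset[OF V, THEN subsetD]
  show ?case
  proof (cases "\<exists>s\<in>carrier R. s \<odot>\<^bsub>T\<^esub> k \<noteq> \<zero>\<^bsub>T\<^esub> \<and> s \<odot>\<^bsub>C\<^esub> c \<in> ?U")
    case True
    then obtain s where s: "s \<in> carrier R" "s \<odot>\<^bsub>T\<^esub> k \<noteq> \<zero>\<^bsub>T\<^esub>" "s \<odot>\<^bsub>C\<^esub> c \<in> ?U" by blast
    have sV: "s \<odot>\<^bsub>C\<^esub> v \<in> ?U" if v: "v \<in> ?V" for v
    proof -
      obtain u r where u: "u \<in> ?U" "r \<in> carrier R" "v = u \<oplus>\<^bsub>C\<^esub> r \<odot>\<^bsub>C\<^esub> c"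
        by (rule span_insert[OF assms(1) c S v])
      then have "s \<odot>\<^bsub>C\<^esub> v = s \<odot>\<^bsub>C\<^esub> u \<oplus>\<^bsub>C\<^esub> r \<odot>\<^bsub>C\<^esub> (s \<odot>\<^bsub>C\<^esub> c)"
        using s c Uc by (simp add: C.smult_r_distr C.smult_assoc1[symmetric] C.R.m_comm)
      then show ?thesis
        using submodule_add[OF U submodule_smult[OF U s(1) u(1)] submodule_smult[OF U u(2) s(3)]] by simp
    qed
    from insert.IH[OF S] show ?thesis
    proof (elim disjE)
      assume "\<exists>s\<in>carrier R. s \<odot>\<^bsub>T\<^esub> k \<noteq> \<zero>\<^bsub>T\<^esub> \<and> (\<forall>u\<in>?U. s \<odot>\<^bsub>C\<^esub> u = \<zero>\<^bsub>C\<^esub>)"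
      then obtain q where q: "q \<in> carrier R" "q \<odot>\<^bsub>T\<^esub> k \<noteq> \<zero>\<^bsub>T\<^esub>" "\<And>u. u \<in> ?U \<Longrightarrow> q \<odot>\<^bsub>C\<^esub> u = \<zero>\<^bsub>C\<^esub>" by blast
      then have "(q \<otimes>\<^bsub>R\<^esub> s) \<odot>\<^bsub>T\<^esub> k \<noteq> \<zero>\<^bsub>T\<^esub>" using dom s assms(3) by (simp add: T.smult_assoc1)
      moreover have "\<forall>v\<in>?V. (q \<otimes>\<^bsub>R\<^esub> s) \<odot>\<^bsub>C\<^esub> v = \<zero>\<^bsub>C\<^esub>" using q s sV Vc by (simp add: C.smult_assoc1)
      ultimately show ?thesis using q s by blast
    next
      assume "\<exists>f. linear_map R (C\<lparr>carrier := ?U\<rparr>) T f \<and>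
        (\<forall>u\<in>?U. \<exists>r\<in>carrier R. f u = r \<odot>\<^bsub>T\<^esub> k) \<and> (\<exists>u\<in>?U. f u \<noteq> \<zero>\<^bsub>T\<^esub>)"
      then obtain f w where f: "linear_map R (C\<lparr>carrier := ?U\<rparr>) T f"
        "\<And>u. u \<in> ?U \<Longrightarrow> \<exists>r\<in>carrier R. f u = r \<odot>\<^bsub>T\<^esub> k" and w: "w \<in> ?U" "f w \<noteq> \<zero>\<^bsub>T\<^esub>" by blast
      note fadd = linear_map_add[OF f(1), simplified] and fsmult = linear_map_smult[OF f(1), simplified]
        and fcl = linear_map_closed[OF f(1), simplified]
      have "linear_map R (C\<lparr>carrier := ?V\<rparr>) T (\<lambda>v. f (s \<odot>\<^bsub>C\<^esub> v))"
      proof (rule linear_mapI)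
        fix r v assume "r \<in> carrier R" "v \<in> carrier (C\<lparr>carrier := ?V\<rparr>)"
        then have rv: "r \<in> carrier R" "v \<in> ?V" by auto
        then have "s \<odot>\<^bsub>C\<^esub> (r \<odot>\<^bsub>C\<^esub> v) = r \<odot>\<^bsub>C\<^esub> (s \<odot>\<^bsub>C\<^esub> v)"
          using s Vc by (simp add: C.smult_assoc1[symmetric] C.R.m_comm)
        then show "f (s \<odot>\<^bsub>C\<^esub> (r \<odot>\<^bsub>C\<lparr>carrier := ?V\<rparr>\<^esub> v)) = r \<odot>\<^bsub>T\<^esub> f (s \<odot>\<^bsub>C\<^esub> v)"
          using fsmult rv sV by simp
      qed (use sV fadd fcl s Vc in \<open>auto simp: C.smult_r_distr\<close>)
      moreover have "\<forall>v\<in>?V. \<exists>r\<in>carrier R. f (s \<odot>\<^bsub>C\<^esub> v) = r \<odot>\<^bsub>T\<^esub> k" using f(2) sV by blast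
      \<comment> \<open>The induction carries the clause that all values are multiples of
        \<open>k\<close> for this step: \<open>dom\<close> speaks of multiples of \<open>k\<close>
        only, and it keeps \<open>s \<odot> f w\<close> nonzero.\<close>
      moreover obtain r where r: "r \<in> carrier R" "f w = r \<odot>\<^bsub>T\<^esub> k" using f(2) w by blast
      then have "f (s \<odot>\<^bsub>C\<^esub> w) \<noteq> \<zero>\<^bsub>T\<^esub>" using dom[OF s(1) r(1)] s w fsmult by simp
      ultimately show ?thesis using w UV by blast
    qed
  next
    case False
    then have none: "s \<odot>\<^bsub>T\<^esub> k = \<zero>\<^bsub>T\<^esub>" if "s \<in> carrier R" "s \<odot>\<^bsub>C\<^esub> c \<in> ?U" for s using that by blast
    define g where "g v = (SOME x. \<exists>u\<in>?U. \<exists>r\<in>carrier R. v = u \<oplus>\<^bsub>C\<^esub> r \<odot>\<^bsub>C\<^esub> c \<and> x = r \<odot>\<^bsub>T\<^esub> k)" for v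
    have g: "g (u \<oplus>\<^bsub>C\<^esub> r \<odot>\<^bsub>C\<^esub> c) = r \<odot>\<^bsub>T\<^esub> k" if u: "u \<in> ?U" and r: "r \<in> carrier R" for u r
    proof -
      let ?v = "u \<oplus>\<^bsub>C\<^esub> r \<odot>\<^bsub>C\<^esub> c"
      have "\<exists>x. \<exists>u\<in>?U. \<exists>r\<in>carrier R. ?v = u \<oplus>\<^bsub>C\<^esub> r \<odot>\<^bsub>C\<^esub> c \<and> x = r \<odot>\<^bsub>T\<^esub> k" using u r by blast
      then have "\<exists>u\<in>?U. \<exists>r\<in>carrier R. ?v = u \<oplus>\<^bsub>C\<^esub> r \<odot>\<^bsub>C\<^esub> c \<and> g ?v = r \<odot>\<^bsub>T\<^esub> k"
        unfolding g_def by (rule someI_ex)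
      then obtain w s where w: "w \<in> ?U" and s: "s \<in> carrier R" and eq: "?v = w \<oplus>\<^bsub>C\<^esub> s \<odot>\<^bsub>C\<^esub> c" "g ?v = s \<odot>\<^bsub>T\<^esub> k"
        by blast
      \<comment> \<open>Two expressions of one element differ by a multiple of \<open>c\<close> that
        lies in the old span. In the present case the coefficient of such a multiple kills
        \<open>k\<close>.\<close>
      have "(s \<ominus>\<^bsub>R\<^esub> r) \<odot>\<^bsub>C\<^esub> c = s \<odot>\<^bsub>C\<^esub> c \<ominus>\<^bsub>C\<^esub> r \<odot>\<^bsub>C\<^esub> c"
        using r s c by (simp add: a_minus_def C.smult_l_distr C.smult_l_minus)
      also have "\<dots> = u \<ominus>\<^bsub>C\<^esub> w"
      proof -
        have "s \<odot>\<^bsub>C\<^esub> c = \<ominus>\<^bsub>C\<^esub> w \<oplus>\<^bsub>C\<^esub> (u \<oplus>\<^bsub>C\<^esub> r \<odot>\<^bsub>C\<^esub> c)"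
          using eq(1) Uc w u r s c by (simp add: C.M.r_neg1)
        then show ?thesis
          using Uc w u r s c by (simp add: a_minus_def C.M.a_ac C.M.r_neg)
      qed
      also have "\<dots> \<in> ?U" by (rule submodule_minus[OF U u w])
      finally have "(s \<ominus>\<^bsub>R\<^esub> r) \<odot>\<^bsub>T\<^esub> k = \<zero>\<^bsub>T\<^esub>" using none r s by simp
      then have "s \<odot>\<^bsub>T\<^esub> k \<ominus>\<^bsub>T\<^esub> r \<odot>\<^bsub>T\<^esub> k = \<zero>\<^bsub>T\<^esub>"
        using r s assms(3) by (simp add: a_minus_def T.smult_l_distr T.smult_l_minus)
      then show ?thesis using eq(2) r s assms(3) by (simp add: T.M.minus_eq_zero_iff)
    qed
    have gV: "\<exists>u\<in>?U. \<exists>r\<in>carrier R. v = u \<oplus>\<^bsub>C\<^esub> r \<odot>\<^bsub>C\<^esub> c \<and> g v = r \<odot>\<^bsub>T\<^esub> k" if "v \<in> ?V" for v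
      by (rule span_insert[OF assms(1) c S that]) (use g in blast)
    have "linear_map R (C\<lparr>carrier := ?V\<rparr>) T g"
    proof (rule linear_mapI)
      fix v assume "v \<in> carrier (C\<lparr>carrier := ?V\<rparr>)"
      then have "v \<in> ?V" by simp
      from gV[OF this] show "g v \<in> carrier T" using assms(3) by auto
    next
      fix v w assume "v \<in> carrier (C\<lparr>carrier := ?V\<rparr>)" "w \<in> carrier (C\<lparr>carrier := ?V\<rparr>)"
      then have vw: "v \<in> ?V" "w \<in> ?V" by simp_all
      obtain u r where v: "u \<in> ?U" "r \<in> carrier R" "v = u \<oplus>\<^bsub>C\<^esub> r \<odot>\<^bsub>C\<^esub> c" "g v = r \<odot>\<^bsub>T\<^esub> k"
        using gV[OF vw(1)] by blast
      obtain u' r' where w: "u' \<in> ?U" "r' \<in> carrier R" "w = u' \<oplus>\<^bsub>C\<^esub> r' \<odot>\<^bsub>C\<^esub> c" "g w = r' \<odot>\<^bsub>T\<^esub> k"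
        using gV[OF vw(2)] by blast
      have "v \<oplus>\<^bsub>C\<^esub> w = (u \<oplus>\<^bsub>C\<^esub> u') \<oplus>\<^bsub>C\<^esub> (r \<oplus>\<^bsub>R\<^esub> r') \<odot>\<^bsub>C\<^esub> c"
        using v w c Uc by (simp add: C.smult_l_distr C.M.a_ac)
      then have "g (v \<oplus>\<^bsub>C\<^esub> w) = (r \<oplus>\<^bsub>R\<^esub> r') \<odot>\<^bsub>T\<^esub> k"
        using g[OF submodule_add[OF U v(1) w(1)] C.R.a_closed[OF v(2) w(2)]] by simp
      then show "g (v \<oplus>\<^bsub>C\<lparr>carrier := ?V\<rparr>\<^esub> w) = g v \<oplus>\<^bsub>T\<^esub> g w"
        using v(2,4) w(2,4) assms(3) by (simp add: T.smult_l_distr)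
    next
      fix a v assume a: "a \<in> carrier R" and "v \<in> carrier (C\<lparr>carrier := ?V\<rparr>)"
      then have vV: "v \<in> ?V" by simp
      obtain u r where v: "u \<in> ?U" "r \<in> carrier R" "v = u \<oplus>\<^bsub>C\<^esub> r \<odot>\<^bsub>C\<^esub> c" "g v = r \<odot>\<^bsub>T\<^esub> k"
        using gV[OF vV] by blast
      have "a \<odot>\<^bsub>C\<^esub> v = a \<odot>\<^bsub>C\<^esub> u \<oplus>\<^bsub>C\<^esub> (a \<otimes>\<^bsub>R\<^esub> r) \<odot>\<^bsub>C\<^esub> c"
        using v a c Uc by (simp add: C.smult_r_distr C.smult_assoc1)
      then have "g (a \<odot>\<^bsub>C\<^esub> v) = (a \<otimes>\<^bsub>R\<^esub> r) \<odot>\<^bsub>T\<^esub> k"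
        using g[OF submodule_smult[OF U a v(1)] C.R.m_closed[OF a v(2)]] by simp
      then show "g (a \<odot>\<^bsub>C\<lparr>carrier := ?V\<rparr>\<^esub> v) = a \<odot>\<^bsub>T\<^esub> g v"
        using v(2,4) a assms(3) by (simp add: T.smult_assoc1)
    qed
    moreover have "\<forall>v\<in>?V. \<exists>r\<in>carrier R. g v = r \<odot>\<^bsub>T\<^esub> k" using gV by blast
    moreover have "g c \<noteq> \<zero>\<^bsub>T\<^esub>"
      using g[OF submodule_zero[OF U] C.R.one_closed] c assms(3,4) by simp
    ultimately show ?thesis using cV by blast
  qed
qed

text \<open>Faithfulness excludes the first alternative of
  \<open>annihilated_or_nonzero_map\<close>: an \<open>s\<close> that kills \<open>C\<close> is zero
  and would kill \<open>k\<close>. Keeping the values inside \<open>R t\<close> makes the map land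
  in any submodule that contains \<open>t\<close>, in the application the kernel of a map.\<close>

lemma exists_nonzero_map:
  fixes C :: "('a, 'c) module" and T :: "('a, 't) module"
  assumes "noetherian_ring R" "fg_module R C" "module R T"
    and faithful: "\<And>r. r \<in> carrier R \<Longrightarrow> (\<And>c. c \<in> carrier C \<Longrightarrow> r \<odot>\<^bsub>C\<^esub> c = \<zero>\<^bsub>C\<^esub>) \<Longrightarrow> r = \<zero>\<^bsub>R\<^esub>"
    and "t \<in> carrier T" "t \<noteq> \<zero>\<^bsub>T\<^esub>"
  obtains f where "linear_map R C T f" "\<And>c. c \<in> carrier C \<Longrightarrow> \<exists>r\<in>carrier R. f c = r \<odot>\<^bsub>T\<^esub> t"
    "\<exists>c\<in>carrier C. f c \<noteq> \<zero>\<^bsub>T\<^esub>"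
proof -
  interpret T: module R T by fact
  obtain S where C: "module R C" and S: "finite S" "S \<subseteq> carrier C" "module_span R C S = carrier C"
    using assms(2) unfolding fg_module_def by blast
  obtain k q where k: "k \<in> carrier T" "k \<noteq> \<zero>\<^bsub>T\<^esub>" and q: "q \<in> carrier R" "k = q \<odot>\<^bsub>T\<^esub> t"
    and dom: "\<And>a b. a \<in> carrier R \<Longrightarrow> b \<in> carrier R \<Longrightarrow> a \<odot>\<^bsub>T\<^esub> k \<noteq> \<zero>\<^bsub>T\<^esub> \<Longrightarrow> b \<odot>\<^bsub>T\<^esub> k \<noteq> \<zero>\<^bsub>T\<^esub> \<Longrightarrow>
      a \<odot>\<^bsub>T\<^esub> (b \<odot>\<^bsub>T\<^esub> k) \<noteq> \<zero>\<^bsub>T\<^esub>"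
    by (rule exists_torsion_free_multiple[OF assms(1,3,5,6)]) blast
  have "\<not> (\<exists>s\<in>carrier R. s \<odot>\<^bsub>T\<^esub> k \<noteq> \<zero>\<^bsub>T\<^esub> \<and> (\<forall>u\<in>carrier C. s \<odot>\<^bsub>C\<^esub> u = \<zero>\<^bsub>C\<^esub>))"
    using faithful k(1) T.smult_l_null by metis
  then obtain f where f: "linear_map R C T f" "\<forall>u\<in>carrier C. \<exists>r\<in>carrier R. f u = r \<odot>\<^bsub>T\<^esub> k"
      "\<exists>u\<in>carrier C. f u \<noteq> \<zero>\<^bsub>T\<^esub>"
    using annihilated_or_nonzero_map[OF C assms(3) k dom S(1,2)] unfolding S(3) by auto
  show ?thesis
  proof (rule that[OF f(1) _ f(3)])
    fix c assume "c \<in> carrier C"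
    then obtain r where "r \<in> carrier R" "f c = r \<odot>\<^bsub>T\<^esub> k" using f(2) by blast
    then show "\<exists>r\<in>carrier R. f c = r \<odot>\<^bsub>T\<^esub> t"
      using q assms(5) T.smult_assoc1 by (metis T.R.m_closed)
  qed
qed

section \<open>Finite presentation\<close>

lemma module_regular:
  assumes "cring R"
  shows "module R (regular_module R)"
proof -
  interpret R: cring R by fact
  show ?thesis
    unfolding regular_module_def
    by (rule moduleI; (rule abelian_groupI)?)
      (auto simp: R.a_ac R.l_distr R.r_distr R.m_ac assms intro: R.l_neg R.a_inv_closed bexI[of _ "\<ominus>\<^bsub>R\<^esub> x" for x])
qed

lemma submodule_regular_ideal:
  assumes "cring R" "submodule J R (regular_module R)"
  shows "ideal J R"
proof -
  interpret R: cring R by fact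
  show ?thesis
  proof (rule idealI[OF R.ring_axioms])
    show "subgroup J (add_monoid R)"
      using assms(2) unfolding submodule_def subgroup_def regular_module_def
      by (auto simp: m_inv_def)
    fix a x assume a: "a \<in> J" "x \<in> carrier R"
    then show "x \<otimes>\<^bsub>R\<^esub> a \<in> J" using submodule_smult[OF assms(2)] by (simp add: regular_module_def)
    then show "a \<otimes>\<^bsub>R\<^esub> x \<in> J"
      using a submodule_subset[OF assms(2)] by (auto simp: regular_module_def R.m_comm)
  qed
qed

text \<open>Elements of free modules are total functions with support in the basis, so enlarging the
  basis changes neither the elements nor the operations, and one can simply intersect.\<close>

lemma submodule_free_mono:
  assumes "cring R" "I \<subseteq> J" "submodule U R (free_module R J)"
  shows "submodule (U \<inter> carrier (free_module R I)) R (free_module R I)"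
proof -
  interpret F: module R "free_module R I" by (rule module_free) fact
  have *: "\<zero>\<^bsub>free_module R I\<^esub> = \<zero>\<^bsub>free_module R J\<^esub>" "v \<oplus>\<^bsub>free_module R I\<^esub> w = v \<oplus>\<^bsub>free_module R J\<^esub> w"
    "r \<odot>\<^bsub>free_module R I\<^esub> v = r \<odot>\<^bsub>free_module R J\<^esub> v" for v w r
    by (simp_all add: free_module_def)
  show ?thesis
    using submodule_zero[OF assms(3)] submodule_add[OF assms(3)] submodule_smult[OF assms(3)]
      F.M.zero_closed F.M.a_closed F.smult_closed
    by (intro submodule_criterion[OF F.module_axioms]) (auto simp: * simp del: free_zero)
qed

lemma linear_map_coordinate:
  "linear_map R (free_module R I) (regular_module R) (\<lambda>v. v i)"
  by (rule linear_mapI) (auto simp: carrier_free regular_module_def)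

lemma submodule_Int: "module R M \<Longrightarrow> submodule U R M \<Longrightarrow> submodule V R M \<Longrightarrow> submodule (U \<inter> V) R M"
  by (rule submodule_criterion)
    (auto simp: submodule_zero submodule_add submodule_smult dest: submodule_subset)

text \<open>Induction on the rank. The coordinates at \<open>s\<close> of elements of
  \<open>K\<close> form an ideal; finitely many \<open>Q\<close> in \<open>K\<close> realize its
  generators, and elements with coordinate zero at \<open>s\<close> are covered by the induction
  hypothesis. Generation is expressed by quantifying over all submodules \<open>U\<close> that
  contain \<open>P\<close>, the form in which the relations of \<open>C\<close> are later
  applied.\<close>

lemma submodule_free_fg:
  assumes "cring R" "noetherian_ring R" "finite S" "submodule K R (free_module R S)"
  shows "\<exists>P. finite P \<and> P \<subseteq> K \<and> (\<forall>U. submodule U R (free_module R S) \<longrightarrow> P \<subseteq> U \<longrightarrow> K \<subseteq> U)"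
  using assms(3,4)
proof (induction S arbitrary: K rule: finite_induct)
  case empty
  have "v = \<zero>\<^bsub>free_module R ({} :: 'c set)\<^esub>" if "v \<in> carrier (free_module R ({} :: 'c set))" for v
    using that by (auto simp: carrier_free)
  then have "K \<subseteq> {\<zero>\<^bsub>free_module R {}\<^esub>}" using submodule_subset[OF empty] by blast
  then show ?case using submodule_zero by (intro exI[of _ "{}"]) blast
next
  case (insert s S)
  interpret R: cring R by fact
  interpret N: noetherian_ring R by fact
  let ?F = "free_module R (insert s S)" and ?F' = "free_module R S"
  note K = \<open>submodule K R ?F\<close>
  have F: "module R ?F" and F': "module R ?F'" using assms(1) by (auto intro: module_free)
  interpret F: module R ?F by (rule F)
  note coord = linear_map_coordinate[of R "insert s S" s]
  have in_F': "v \<in> carrier ?F'" if "v \<in> carrier ?F" "v s = \<zero>\<^bsub>R\<^esub>" for v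
    using that by (auto simp: carrier_free)
  have ideal: "ideal ((\<lambda>v. v s) ` U) R" if "submodule U R ?F" for U
    by (rule submodule_regular_ideal[OF assms(1)
          submodule_image_submodule[OF F module_regular[OF assms(1)] coord that]])
  obtain A where A: "A \<subseteq> carrier R" "finite A" "(\<lambda>v. v s) ` K = Idl\<^bsub>R\<^esub> A"
    using N.finetely_gen[OF ideal[OF K]] by blast
  then have "A \<subseteq> (\<lambda>v. v s) ` K" using R.genideal_self by blast
  then obtain Q where Q: "Q \<subseteq> K" "finite Q" "A = (\<lambda>v. v s) ` Q"
    using A(2) by (meson finite_subset_image)
  obtain P where P: "finite P" "P \<subseteq> K \<inter> carrier ?F'"
      "\<And>U. submodule U R ?F' \<Longrightarrow> P \<subseteq> U \<Longrightarrow> K \<inter> carrier ?F' \<subseteq> U"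
    using insert.IH[OF submodule_free_mono[OF assms(1) subset_insertI K]] by blast
  show ?case
  proof (intro exI[of _ "P \<union> Q"] conjI allI impI)
    fix U assume U: "submodule U R ?F" "P \<union> Q \<subseteq> U"
    show "K \<subseteq> U"
    proof
      fix v assume v: "v \<in> K"
      \<comment> \<open>Taking coordinates of \<open>K \<inter> U\<close> instead of
        \<open>U\<close> yields a \<open>u\<close> in both. Then \<open>v - u\<close> stays in
        \<open>K\<close> and has coordinate zero at \<open>s\<close>, so the smaller rank
        applies.\<close>
      have KU: "submodule (K \<inter> U) R ?F" by (rule submodule_Int[OF F K U(1)])
      have "Idl\<^bsub>R\<^esub> A \<subseteq> (\<lambda>v. v s) ` (K \<inter> U)"
        using Q U(2) by (intro R.genideal_minimal[OF ideal[OF KU]]) blast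
      then have "v s \<in> (\<lambda>v. v s) ` (K \<inter> U)" using A(3) v by blast
      then obtain u where u: "u \<in> K" "u \<in> U" "u s = v s" by auto
      have uc: "u \<in> carrier ?F" and vc: "v \<in> carrier ?F" using u v submodule_subset[OF K] by auto
      have d: "v \<ominus>\<^bsub>?F\<^esub> u \<in> K" by (rule submodule_minus[OF K v u(1)])
      have "(v \<ominus>\<^bsub>?F\<^esub> u) s = v s \<ominus>\<^bsub>R\<^esub> u s"
        using linear_map_minus[OF F module_regular[OF assms(1)] coord vc uc]
        by (simp add: regular_module_def a_minus_def a_inv_def m_inv_def)
      then have "(v \<ominus>\<^bsub>?F\<^esub> u) s = \<zero>\<^bsub>R\<^esub>" using u(3) vc by (simp add: carrier_free R.minus_eq_zero_iff)
      then have "v \<ominus>\<^bsub>?F\<^esub> u \<in> K \<inter> carrier ?F'" using in_F' uc vc d by simp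
      moreover have "P \<subseteq> U \<inter> carrier ?F'" using P(2) U(2) by blast
      ultimately have "v \<ominus>\<^bsub>?F\<^esub> u \<in> U"
        using P(3)[OF submodule_free_mono[OF assms(1) subset_insertI U(1)]] by blast
      then have "(v \<ominus>\<^bsub>?F\<^esub> u) \<oplus>\<^bsub>?F\<^esub> u \<in> U" using submodule_add[OF U(1)] u(2) by blast
      moreover have "(v \<ominus>\<^bsub>?F\<^esub> u) \<oplus>\<^bsub>?F\<^esub> u = v"
        using uc vc unfolding a_minus_def by (simp add: F.M.a_assoc F.M.l_neg del: free_add)
      ultimately show "v \<in> U" by simp
    qed
  qed (use P Q in auto)
qed

section \<open>Tensors with a module given by generators and relations\<close>

lemma hom_free_eqI:
  assumes "cring R" "module R Y" "f \<in> carrier (hom_module R (free_module R I) Y)"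
    and "g \<in> carrier (hom_module R (free_module R I) Y)"
    and "\<And>i. i \<in> I \<Longrightarrow> f (free_gen R i) = g (free_gen R i)"
  shows "f = g"
  by (rule hom_eqI[OF assms(3,4)])
    (rule free_maps_eq[OF assms(1,2) hom_linear[OF assms(3)] hom_linear[OF assms(4)] assms(5)])

lemma finsum_delta:
  assumes "module R Y" "finite S" "s \<in> S" "x \<in> carrier Y"
  shows "(\<Oplus>\<^bsub>Y\<^esub>i\<in>S. if i = s then x else \<zero>\<^bsub>Y\<^esub>) = x"
proof -
  interpret Y: module R Y by fact
  show ?thesis
    using Y.M.finsum_singleton[OF assms(3,2), of "\<lambda>_. x"] assms(4) by (simp add: eq_commute[of s])
qed

text \<open>Two inductions: these sums form a submodule \<open>?U\<close>, so a pure tensor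
  \<open>y \<otimes> c\<close> suffices; for fixed \<open>y\<close> the \<open>c\<close> with
  \<open>y \<otimes> c\<close> in \<open>?U\<close> form a submodule, so \<open>c\<close> in
  \<open>S\<close> suffices.\<close>

lemma tensor_sum_form:
  assumes "module R Y" "module R C" "finite S" "S \<subseteq> carrier C" "module_span R C S = carrier C"
    and "t \<in> carrier (tensor_module R Y C)"
  shows "\<exists>y\<in>S \<rightarrow> carrier Y. t = (\<Oplus>\<^bsub>tensor_module R Y C\<^esub>s\<in>S. pure_tensor R Y C (y s) s)"
proof -
  let ?T = "tensor_module R Y C" and ?p = "pure_tensor R Y C"
  have T: "module R ?T" by (rule module_tensor[OF assms(1,2)])
  interpret Y: module R Y by fact
  interpret C: module R C by fact
  interpret T: module R ?T by (rule T)
  let ?U = "{t. \<exists>y\<in>S \<rightarrow> carrier Y. t = (\<Oplus>\<^bsub>?T\<^esub>s\<in>S. ?p (y s) s)}"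
  have Sc: "s \<in> carrier C" if "s \<in> S" for s using assms(4) that by blast
  have p: "?p y s \<in> carrier ?T" if "y \<in> carrier Y" "s \<in> S" for y s
    by (rule pure_tensor_closed[OF assms(1,2) that(1) Sc[OF that(2)]])
  note pl = linear_pure_left[OF assms(1,2) Sc]
  have U: "submodule ?U R ?T"
  proof (rule submodule_criterion[OF T])
    show "?U \<subseteq> carrier ?T" using p by (auto intro!: T.M.finsum_closed)
    have "(\<Oplus>\<^bsub>?T\<^esub>s\<in>S. ?p \<zero>\<^bsub>Y\<^esub> s) = (\<Oplus>\<^bsub>?T\<^esub>s\<in>S. \<zero>\<^bsub>?T\<^esub>)"
      by (rule T.M.finsum_cong') (auto simp: pure_tensor_zero_left[OF assms(1,2)] Sc)
    then show "\<zero>\<^bsub>?T\<^esub> \<in> ?U" by (auto intro!: bexI[of _ "\<lambda>_. \<zero>\<^bsub>Y\<^esub>"])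
  next
    fix t u assume "t \<in> ?U" "u \<in> ?U"
    then obtain y z where y: "y \<in> S \<rightarrow> carrier Y" "t = (\<Oplus>\<^bsub>?T\<^esub>s\<in>S. ?p (y s) s)"
      and z: "z \<in> S \<rightarrow> carrier Y" "u = (\<Oplus>\<^bsub>?T\<^esub>s\<in>S. ?p (z s) s)" by blast
    have "t \<oplus>\<^bsub>?T\<^esub> u = (\<Oplus>\<^bsub>?T\<^esub>s\<in>S. ?p (y s) s \<oplus>\<^bsub>?T\<^esub> ?p (z s) s)"
      unfolding y(2) z(2) using y(1) z(1) p by (intro T.M.finsum_addf[symmetric]) auto
    also have "\<dots> = (\<Oplus>\<^bsub>?T\<^esub>s\<in>S. ?p (y s \<oplus>\<^bsub>Y\<^esub> z s) s)"
      using y(1) z(1) p by (intro T.M.finsum_cong') (auto simp: linear_map_add[OF pl] Pi_iff)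
    finally show "t \<oplus>\<^bsub>?T\<^esub> u \<in> ?U" using y(1) z(1) by (auto intro!: bexI[of _ "\<lambda>s. y s \<oplus>\<^bsub>Y\<^esub> z s"])
  next
    fix r t assume r: "r \<in> carrier R" and "t \<in> ?U"
    then obtain y where y: "y \<in> S \<rightarrow> carrier Y" "t = (\<Oplus>\<^bsub>?T\<^esub>s\<in>S. ?p (y s) s)" by blast
    have "r \<odot>\<^bsub>?T\<^esub> t = (\<Oplus>\<^bsub>?T\<^esub>s\<in>S. r \<odot>\<^bsub>?T\<^esub> ?p (y s) s)"
      unfolding y(2) using y(1) p r assms(3) by (intro T.finsum_smult_ldistr) auto
    also have "\<dots> = (\<Oplus>\<^bsub>?T\<^esub>s\<in>S. ?p (r \<odot>\<^bsub>Y\<^esub> y s) s)"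
      using y(1) p r by (intro T.M.finsum_cong') (auto simp: linear_map_smult[OF pl] Pi_iff)
    finally show "r \<odot>\<^bsub>?T\<^esub> t \<in> ?U" using y(1) r by (auto intro!: bexI[of _ "\<lambda>s. r \<odot>\<^bsub>Y\<^esub> y s"])
  qed
  have "t \<in> ?U"
  proof (rule tensor_induct[OF assms(1,2) U _ assms(6)])
    fix y c assume y: "y \<in> carrier Y" and c: "c \<in> carrier C"
    have "S \<subseteq> {c \<in> carrier C. ?p y c \<in> ?U}"
    proof
      fix s assume s: "s \<in> S"
      have "(\<Oplus>\<^bsub>?T\<^esub>i\<in>S. ?p (if i = s then y else \<zero>\<^bsub>Y\<^esub>) i) = (\<Oplus>\<^bsub>?T\<^esub>i\<in>S. if i = s then ?p y s else \<zero>\<^bsub>?T\<^esub>)"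
        using y p by (intro T.M.finsum_cong') (auto simp: pure_tensor_zero_left[OF assms(1,2)] Sc)
      then have "(\<Oplus>\<^bsub>?T\<^esub>i\<in>S. ?p (if i = s then y else \<zero>\<^bsub>Y\<^esub>) i) = ?p y s"
        using finsum_delta[OF T assms(3) s p[OF y s]] by simp
      then show "s \<in> {c \<in> carrier C. ?p y c \<in> ?U}"
        using Sc[OF s] y by (auto intro!: bexI[of _ "\<lambda>i. if i = s then y else \<zero>\<^bsub>Y\<^esub>"])
    qed
    from span_minimal[OF submodule_vimage[OF assms(2) T linear_pure_right[OF assms(1,2) y] U] this]
    show "?p y c \<in> ?U" using c unfolding assms(5) by blast
  qed
  then show ?thesis by blast
qed

text \<open>Moving the scalars of one relation across the tensor sign turns its share into
  \<open>z \<rho> \<otimes> (\<Sum>s. \<rho> s \<odot> s)\<close>, and the second factor vanishes.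
  Together with \<open>tensor_zero_criterion\<close> this describes exactly which families
  \<open>y\<close> have vanishing sum of \<open>y s \<otimes> s\<close>.\<close>

lemma tensor_relation_zero:
  assumes "module R Y" "module R C" "finite S" "S \<subseteq> carrier C" "finite P" "P \<subseteq> carrier (free_module R S)"
    and "\<And>\<rho>. \<rho> \<in> P \<Longrightarrow> free_lift R C (\<lambda>s. s) \<rho> = \<zero>\<^bsub>C\<^esub>" "z \<in> P \<rightarrow> carrier Y"
  shows "(\<Oplus>\<^bsub>tensor_module R Y C\<^esub>s\<in>S. pure_tensor R Y C (\<Oplus>\<^bsub>Y\<^esub>\<rho>\<in>P. \<rho> s \<odot>\<^bsub>Y\<^esub> z \<rho>) s) = \<zero>\<^bsub>tensor_module R Y C\<^esub>"
  using assms(5-8)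
proof (induction P rule: finite_induct)
  let ?T = "tensor_module R Y C" and ?p = "pure_tensor R Y C"
  have T: "module R ?T" by (rule module_tensor[OF assms(1,2)])
  interpret Y: module R Y by fact
  interpret C: module R C by fact
  interpret T: module R ?T by (rule T)
  have Sc: "s \<in> carrier C" if "s \<in> S" for s using assms(4) that by blast
  {
    case empty
    have "(\<Oplus>\<^bsub>?T\<^esub>s\<in>S. ?p \<zero>\<^bsub>Y\<^esub> s) = (\<Oplus>\<^bsub>?T\<^esub>s\<in>S. \<zero>\<^bsub>?T\<^esub>)"
      by (rule T.M.finsum_cong') (auto simp: pure_tensor_zero_left[OF assms(1,2)] Sc)
    then show ?case by simp
  next
    case (insert \<rho> P)
    have p: "?p y s \<in> carrier ?T" if "y \<in> carrier Y" "s \<in> S" for y s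
      by (rule pure_tensor_closed[OF assms(1,2) that(1) Sc[OF that(2)]])
    have zP: "z \<in> P \<rightarrow> carrier Y" and z\<rho>: "z \<rho> \<in> carrier Y" and \<rho>: "\<rho> \<in> carrier (free_module R S)"
      using insert.prems by auto
    have coef: "\<sigma> s \<in> carrier R" if "\<sigma> \<in> insert \<rho> P" for \<sigma> s
      using that insert.prems(1) by (auto simp: carrier_free subset_iff)
    have rest: "(\<Oplus>\<^bsub>Y\<^esub>\<sigma>\<in>P. \<sigma> s \<odot>\<^bsub>Y\<^esub> z \<sigma>) \<in> carrier Y" for s
      using zP coef by (intro Y.M.finsum_closed) auto
    have "(\<Oplus>\<^bsub>?T\<^esub>s\<in>S. ?p (\<Oplus>\<^bsub>Y\<^esub>\<sigma>\<in>insert \<rho> P. \<sigma> s \<odot>\<^bsub>Y\<^esub> z \<sigma>) s) =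
        (\<Oplus>\<^bsub>?T\<^esub>s\<in>S. ?p (\<rho> s \<odot>\<^bsub>Y\<^esub> z \<rho>) s \<oplus>\<^bsub>?T\<^esub> ?p (\<Oplus>\<^bsub>Y\<^esub>\<sigma>\<in>P. \<sigma> s \<odot>\<^bsub>Y\<^esub> z \<sigma>) s)"
    proof (rule T.M.finsum_cong'[OF refl])
      fix s assume s: "s \<in> S"
      have "(\<Oplus>\<^bsub>Y\<^esub>\<sigma>\<in>insert \<rho> P. \<sigma> s \<odot>\<^bsub>Y\<^esub> z \<sigma>) = \<rho> s \<odot>\<^bsub>Y\<^esub> z \<rho> \<oplus>\<^bsub>Y\<^esub> (\<Oplus>\<^bsub>Y\<^esub>\<sigma>\<in>P. \<sigma> s \<odot>\<^bsub>Y\<^esub> z \<sigma>)"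
        using insert.hyps zP z\<rho> coef by (intro Y.M.finsum_insert) auto
      then show "?p (\<Oplus>\<^bsub>Y\<^esub>\<sigma>\<in>insert \<rho> P. \<sigma> s \<odot>\<^bsub>Y\<^esub> z \<sigma>) s =
          ?p (\<rho> s \<odot>\<^bsub>Y\<^esub> z \<rho>) s \<oplus>\<^bsub>?T\<^esub> ?p (\<Oplus>\<^bsub>Y\<^esub>\<sigma>\<in>P. \<sigma> s \<odot>\<^bsub>Y\<^esub> z \<sigma>) s"
        using linear_map_add[OF linear_pure_left[OF assms(1,2) Sc[OF s]]] rest z\<rho> coef by simp
    qed (use p rest z\<rho> coef in auto)
    also have "\<dots> = (\<Oplus>\<^bsub>?T\<^esub>s\<in>S. ?p (\<rho> s \<odot>\<^bsub>Y\<^esub> z \<rho>) s) \<oplus>\<^bsub>?T\<^esub> (\<Oplus>\<^bsub>?T\<^esub>s\<in>S. ?p (\<Oplus>\<^bsub>Y\<^esub>\<sigma>\<in>P. \<sigma> s \<odot>\<^bsub>Y\<^esub> z \<sigma>) s)"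
      using p rest z\<rho> coef by (intro T.M.finsum_addf) auto
    also have "(\<Oplus>\<^bsub>?T\<^esub>s\<in>S. ?p (\<Oplus>\<^bsub>Y\<^esub>\<sigma>\<in>P. \<sigma> s \<odot>\<^bsub>Y\<^esub> z \<sigma>) s) = \<zero>\<^bsub>?T\<^esub>"
      using insert.IH insert.prems by auto
    also have "(\<Oplus>\<^bsub>?T\<^esub>s\<in>S. ?p (\<rho> s \<odot>\<^bsub>Y\<^esub> z \<rho>) s) = (\<Oplus>\<^bsub>?T\<^esub>s\<in>S. ?p (z \<rho>) (\<rho> s \<odot>\<^bsub>C\<^esub> s))"
      using z\<rho> coef p Sc linear_map_smult[OF linear_pure_left[OF assms(1,2)]]
        linear_map_smult[OF linear_pure_right[OF assms(1,2)]]
      by (intro T.M.finsum_cong') auto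
    also have "\<dots> = ?p (z \<rho>) (\<Oplus>\<^bsub>C\<^esub>s\<in>S. \<rho> s \<odot>\<^bsub>C\<^esub> s)"
      using coef Sc
      by (intro linear_map_finsum[OF assms(2) T linear_pure_right[OF assms(1,2) z\<rho>] assms(3), symmetric]) auto
    also have "(\<Oplus>\<^bsub>C\<^esub>s\<in>S. \<rho> s \<odot>\<^bsub>C\<^esub> s) = \<zero>\<^bsub>C\<^esub>"
      using insert.prems(2)[of \<rho>] \<rho> Sc free_lift_superset[OF assms(2) \<rho> _ assms(3) _ subset_refl, of "\<lambda>s. s"]
      by (auto simp: carrier_free)
    also have "?p (z \<rho>) \<zero>\<^bsub>C\<^esub> = \<zero>\<^bsub>?T\<^esub>" by (rule pure_tensor_zero_right[OF assms(1,2) z\<rho>])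
    finally show ?case by simp
  }
qed

text \<open>\<open>Hom(F, Y)\<close> for \<open>F\<close> free on \<open>S\<close> serves as the power \<open>Y\<^sup>S\<close>. Modulo the submodule \<open>W\<close> of the
  combinations of the relations \<open>P\<close> it receives a map from \<open>Y \<otimes> C\<close> sending \<open>y \<otimes> s\<close> to the class of the
  family that is \<open>y\<close> at \<open>s\<close> and zero elsewhere.\<close>

lemma tensor_zero_criterion:
  assumes "module R Y" "module R C" "finite S" "S \<subseteq> carrier C" "module_span R C S = carrier C"
    and "finite P" "P \<subseteq> carrier (free_module R S)"
    and P_gen: "\<And>U. submodule U R (free_module R S) \<Longrightarrow> P \<subseteq> U \<Longrightarrow>
      {v \<in> carrier (free_module R S). free_lift R C (\<lambda>s. s) v = \<zero>\<^bsub>C\<^esub>} \<subseteq> U"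
    and "y \<in> S \<rightarrow> carrier Y"
    and zero: "(\<Oplus>\<^bsub>tensor_module R Y C\<^esub>s\<in>S. pure_tensor R Y C (y s) s) = \<zero>\<^bsub>tensor_module R Y C\<^esub>"
  shows "\<exists>z\<in>P \<rightarrow> carrier Y. \<forall>s\<in>S. y s = (\<Oplus>\<^bsub>Y\<^esub>\<rho>\<in>P. \<rho> s \<odot>\<^bsub>Y\<^esub> z \<rho>)"
proof -
  interpret Y: module R Y by fact
  interpret C: module R C by fact
  let ?F = "free_module R S"
  have R: "cring R" by (rule Y.R.cring_axioms)
  have F: "module R ?F" by (rule module_free[OF R])
  let ?H = "hom_module R ?F Y"
  have H: "module R ?H" by (rule module_hom[OF F assms(1)])
  interpret H: module R ?H by (rule H)
  have T: "module R (tensor_module R Y C)" by (rule module_tensor[OF assms(1,2)])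
  have Sc: "(\<lambda>s. s) \<in> S \<rightarrow> carrier C" using assms(4) by auto
  let ?\<pi> = "free_lift R C (\<lambda>s. s)"
  have \<pi>: "linear_map R ?F C ?\<pi>" by (rule linear_map_free_lift[OF assms(2) Sc])
  have \<pi>_gen: "?\<pi> (free_gen R s) = s" if "s \<in> S" for s using free_lift_gen[OF assms(2) Sc that] .
  have gen: "free_gen R s \<in> carrier ?F" if "s \<in> S" for s by (rule free_gen_closed[OF R that])
  have "S \<subseteq> ?\<pi> ` carrier ?F"
  proof
    fix s assume s: "s \<in> S"
    then show "s \<in> ?\<pi> ` carrier ?F" by (intro image_eqI[where f = ?\<pi> and x = "free_gen R s"]) (simp_all add: \<pi>_gen gen)
  qed
  then have "carrier C \<subseteq> ?\<pi> ` carrier ?F"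
    unfolding assms(5)[symmetric] by (intro span_minimal submodule_image[OF F assms(2) \<pi>])
  then have \<pi>_surj: "?\<pi> ` carrier ?F = carrier C" using linear_map_closed[OF \<pi>] by auto
  \<comment> \<open>In \<open>?H\<close>, read as \<open>Y^S\<close>, this is the family
    \<open>s \<mapsto> v s \<odot> x\<close>: the bilinear map behind
    \<open>Y \<otimes> R^S = Y^S\<close>. It descends along \<open>?\<pi>\<close> to a bilinear map
    on \<open>Y\<close> and \<open>C\<close> once the combinations of relations are divided
    out.\<close>
  define \<mu> where "\<mu> x v = restrict (free_lift R Y (\<lambda>s. v s \<odot>\<^bsub>Y\<^esub> x)) (carrier ?F)" for x v
  have vc: "v s \<in> carrier R" if "v \<in> carrier ?F" for v s using that by (simp add: carrier_free)
  have \<mu>_in: "\<mu> x v \<in> carrier ?H" if "x \<in> carrier Y" "v \<in> carrier ?F" for x v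
    unfolding \<mu>_def using that vc by (intro restrict_in_hom F linear_map_free_lift[OF assms(1)]) auto
  have \<mu>_gen: "\<mu> x v (free_gen R s) = v s \<odot>\<^bsub>Y\<^esub> x" if "x \<in> carrier Y" "v \<in> carrier ?F" "s \<in> S" for x v s
    unfolding \<mu>_def using that vc gen free_lift_gen[OF assms(1), of "\<lambda>s. v s \<odot>\<^bsub>Y\<^esub> x" S s] by auto
  have \<mu>_right: "linear_map R ?F ?H (\<mu> x)" if x: "x \<in> carrier Y" for x
  proof (rule linear_mapI)
    fix v w assume "v \<in> carrier ?F" "w \<in> carrier ?F"
    then show "\<mu> x (v \<oplus>\<^bsub>?F\<^esub> w) = \<mu> x v \<oplus>\<^bsub>?H\<^esub> \<mu> x w"
      using x module.axioms(2)[OF F, THEN abelian_group.axioms(1)] vc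
      by (intro hom_free_eqI[OF R assms(1)])
        (auto simp: \<mu>_in abelian_monoid.a_closed \<mu>_gen hom_add gen Y.smult_l_distr)
  next
    fix r v assume "r \<in> carrier R" "v \<in> carrier ?F"
    then show "\<mu> x (r \<odot>\<^bsub>?F\<^esub> v) = r \<odot>\<^bsub>?H\<^esub> \<mu> x v"
      using x module.smult_closed[OF F] vc
      by (intro hom_free_eqI[OF R assms(1)]) (auto simp: \<mu>_in \<mu>_gen hom_smult gen Y.smult_assoc1)
  qed (use \<mu>_in x in auto)
  have \<mu>_left: "linear_map R Y ?H (\<lambda>x. \<mu> x v)" if v: "v \<in> carrier ?F" for v
  proof (rule linear_mapI)
    fix x x' assume "x \<in> carrier Y" "x' \<in> carrier Y"
    then show "\<mu> (x \<oplus>\<^bsub>Y\<^esub> x') v = \<mu> x v \<oplus>\<^bsub>?H\<^esub> \<mu> x' v"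
      using v vc by (intro hom_free_eqI[OF R assms(1)]) (auto simp: \<mu>_in \<mu>_gen hom_add gen Y.smult_r_distr)
  next
    fix r x assume "r \<in> carrier R" "x \<in> carrier Y"
    then show "\<mu> (r \<odot>\<^bsub>Y\<^esub> x) v = r \<odot>\<^bsub>?H\<^esub> \<mu> x v"
      using v vc by (intro hom_free_eqI[OF R assms(1)])
        (auto simp: \<mu>_in \<mu>_gen hom_smult gen Y.smult_assoc1[symmetric] Y.R.m_comm)
  qed (use \<mu>_in v in auto)
  let ?c = "\<lambda>z s. \<Oplus>\<^bsub>Y\<^esub>\<rho>\<in>P. \<rho> s \<odot>\<^bsub>Y\<^esub> z \<rho>"
  define W where "W = {\<alpha> \<in> carrier ?H. \<exists>z\<in>P \<rightarrow> carrier Y. \<forall>s\<in>S. \<alpha> (free_gen R s) = ?c z s}"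
  have \<rho>c: "\<rho> s \<in> carrier R" if "\<rho> \<in> P" for \<rho> s using that assms(7) vc by blast
  let ?W0 = "{\<alpha> \<in> carrier ?H. \<exists>z\<in>P \<rightarrow> carrier Y. \<forall>s\<in>S. \<alpha> (free_gen R s) = ?c z s}"
  have W: "submodule W R ?H"
    unfolding W_def
  proof (rule submodule_criterion[OF H])
    have "?c (\<lambda>_. \<zero>\<^bsub>Y\<^esub>) s = (\<Oplus>\<^bsub>Y\<^esub>\<rho>\<in>P. \<zero>\<^bsub>Y\<^esub>)" for s
      using \<rho>c by (intro Y.M.finsum_cong') auto
    then show "\<zero>\<^bsub>?H\<^esub> \<in> ?W0" by (auto intro!: bexI[of _ "\<lambda>_. \<zero>\<^bsub>Y\<^esub>"] simp: hom_zero gen)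
  next
    fix \<alpha> \<beta> assume "\<alpha> \<in> ?W0" "\<beta> \<in> ?W0"
    then obtain z w where z: "\<alpha> \<in> carrier ?H" "z \<in> P \<rightarrow> carrier Y" "\<And>s. s \<in> S \<Longrightarrow> \<alpha> (free_gen R s) = ?c z s"
      and w: "\<beta> \<in> carrier ?H" "w \<in> P \<rightarrow> carrier Y" "\<And>s. s \<in> S \<Longrightarrow> \<beta> (free_gen R s) = ?c w s" by blast
    have "?c (\<lambda>\<rho>. z \<rho> \<oplus>\<^bsub>Y\<^esub> w \<rho>) s = ?c z s \<oplus>\<^bsub>Y\<^esub> ?c w s" for s
    proof -
      have "?c (\<lambda>\<rho>. z \<rho> \<oplus>\<^bsub>Y\<^esub> w \<rho>) s = (\<Oplus>\<^bsub>Y\<^esub>\<rho>\<in>P. \<rho> s \<odot>\<^bsub>Y\<^esub> z \<rho> \<oplus>\<^bsub>Y\<^esub> \<rho> s \<odot>\<^bsub>Y\<^esub> w \<rho>)"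
        using z(2) w(2) \<rho>c by (intro Y.M.finsum_cong') (auto simp: Y.smult_r_distr Pi_iff)
      then show ?thesis using z(2) w(2) \<rho>c by (simp add: Y.M.finsum_addf Pi_iff)
    qed
    then show "\<alpha> \<oplus>\<^bsub>?H\<^esub> \<beta> \<in> ?W0"
      using z w by (auto intro!: bexI[of _ "\<lambda>\<rho>. z \<rho> \<oplus>\<^bsub>Y\<^esub> w \<rho>"] simp: hom_add gen)
  next
    fix r \<alpha> assume r: "r \<in> carrier R" and "\<alpha> \<in> ?W0"
    then obtain z where z: "\<alpha> \<in> carrier ?H" "z \<in> P \<rightarrow> carrier Y" "\<And>s. s \<in> S \<Longrightarrow> \<alpha> (free_gen R s) = ?c z s" by blast
    have "?c (\<lambda>\<rho>. r \<odot>\<^bsub>Y\<^esub> z \<rho>) s = r \<odot>\<^bsub>Y\<^esub> ?c z s" for s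
    proof -
      have "?c (\<lambda>\<rho>. r \<odot>\<^bsub>Y\<^esub> z \<rho>) s = (\<Oplus>\<^bsub>Y\<^esub>\<rho>\<in>P. r \<odot>\<^bsub>Y\<^esub> (\<rho> s \<odot>\<^bsub>Y\<^esub> z \<rho>))"
        using z(2) \<rho>c r by (intro Y.M.finsum_cong') (auto simp: Y.smult_assoc1[symmetric] Y.R.m_comm Pi_iff)
      then show ?thesis using z(2) \<rho>c r assms(6) by (simp add: Y.finsum_smult_ldistr Pi_iff)
    qed
    then show "r \<odot>\<^bsub>?H\<^esub> \<alpha> \<in> ?W0"
      using z r by (auto intro!: bexI[of _ "\<lambda>\<rho>. r \<odot>\<^bsub>Y\<^esub> z \<rho>"] simp: hom_smult gen)
  qed auto
  let ?Q = "quotient_module ?H W"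
  have Q: "module R ?Q" by (rule module_quotient[OF H W])
  let ?q = "\<lambda>\<alpha>. W +>\<^bsub>?H\<^esub> \<alpha>"
  have q: "linear_map R ?H ?Q ?q" by (rule linear_map_coset[OF H W])
  \<comment> \<open>By \<open>P_gen\<close> it is enough to treat \<open>v\<close> in
    \<open>P\<close>. For \<open>\<rho>\<close> in \<open>P\<close> the family
    \<open>\<mu> x \<rho>\<close> is the combination with coefficient \<open>x\<close> at
    \<open>\<rho>\<close> and zero at the other relations.\<close>
  have kills: "\<mu> x v \<in> W" if x: "x \<in> carrier Y" and v: "v \<in> carrier ?F" "?\<pi> v = \<zero>\<^bsub>C\<^esub>" for x v
  proof -
    have "P \<subseteq> {v \<in> carrier ?F. \<mu> x v \<in> W}"
    proof
      fix \<rho> assume \<rho>: "\<rho> \<in> P"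
      have "\<mu> x \<rho> (free_gen R s) = ?c (\<lambda>\<sigma>. if \<sigma> = \<rho> then x else \<zero>\<^bsub>Y\<^esub>) s" if s: "s \<in> S" for s
      proof -
        have "?c (\<lambda>\<sigma>. if \<sigma> = \<rho> then x else \<zero>\<^bsub>Y\<^esub>) s = (\<Oplus>\<^bsub>Y\<^esub>\<sigma>\<in>P. if \<sigma> = \<rho> then \<rho> s \<odot>\<^bsub>Y\<^esub> x else \<zero>\<^bsub>Y\<^esub>)"
          using \<rho>c x by (intro Y.M.finsum_cong') auto
        then show ?thesis
          using finsum_delta[OF assms(1,6) \<rho>, of "\<rho> s \<odot>\<^bsub>Y\<^esub> x"] \<rho>c[OF \<rho>] x \<mu>_gen[OF x _ s, of \<rho>] assms(7) \<rho> by auto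
      qed
      then show "\<rho> \<in> {v \<in> carrier ?F. \<mu> x v \<in> W}"
        using \<rho> assms(7) \<mu>_in[OF x] x by (auto simp: W_def intro!: bexI[of _ "\<lambda>\<sigma>. if \<sigma> = \<rho> then x else \<zero>\<^bsub>Y\<^esub>"])
    qed
    from P_gen[OF submodule_vimage[OF F H \<mu>_right[OF x] W] this] v show ?thesis by blast
  qed
  have "\<exists>g. linear_map R C ?Q g \<and> (\<forall>v\<in>carrier ?F. g (?\<pi> v) = ?q (\<mu> x v))" if x: "x \<in> carrier Y" for x
  proof (rule factor_through_surjection[OF F assms(2) Q \<pi> \<pi>_surj linear_map_compose[OF \<mu>_right[OF x] q]])
    fix v assume v: "v \<in> carrier ?F" "?\<pi> v = \<zero>\<^bsub>C\<^esub>"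
    show "?q (\<mu> x v) = \<zero>\<^bsub>?Q\<^esub>"
      unfolding zero_quotient by (rule iffD2[OF coset_eq_zero_iff[OF H W \<mu>_in[OF x v(1)]] kills[OF x v]])
  qed blast
  then obtain g where g: "\<And>x. x \<in> carrier Y \<Longrightarrow> linear_map R C ?Q (g x)"
      "\<And>x v. x \<in> carrier Y \<Longrightarrow> v \<in> carrier ?F \<Longrightarrow> g x (?\<pi> v) = ?q (\<mu> x v)"
    by metis
  have bil: "bilinear_map R Y C ?Q g"
  proof (rule bilinear_mapI)
    fix c assume "c \<in> carrier C"
    then obtain v where v: "v \<in> carrier ?F" "c = ?\<pi> v" using \<pi>_surj by blast
    have "linear_map R Y ?Q (\<lambda>x. g x c) = linear_map R Y ?Q (\<lambda>x. ?q (\<mu> x v))"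
      by (rule linear_map_cong[OF assms(1)]) (use g(2) v in blast)
    then show "linear_map R Y ?Q (\<lambda>x. g x c)" using linear_map_compose[OF \<mu>_left[OF v(1)] q] by blast
  qed (rule g(1))
  obtain \<theta> where \<theta>: "linear_map R (tensor_module R Y C) ?Q \<theta>"
      "\<And>x c. x \<in> carrier Y \<Longrightarrow> c \<in> carrier C \<Longrightarrow> \<theta> (pure_tensor R Y C x c) = g x c"
    by (rule tensor_universal[OF assms(1,2) Q bil]) blast
  \<comment> \<open>The element of \<open>?H\<close> with value \<open>y s\<close> at the generator
    \<open>s\<close>. Its class in \<open>?Q\<close> is the image under \<open>\<theta>\<close> of
    the vanishing sum, so it lies in \<open>W\<close>, and the coefficients \<open>z\<close> can be
    read off.\<close>
  let ?A = "\<Oplus>\<^bsub>?H\<^esub>s\<in>S. \<mu> (y s) (free_gen R s)"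
  have ys: "y s \<in> carrier Y" if "s \<in> S" for s using assms(9) that by blast
  have terms: "(\<lambda>s. \<mu> (y s) (free_gen R s)) \<in> S \<rightarrow> carrier ?H" using \<mu>_in ys gen by blast
  have A: "?A \<in> carrier ?H" using terms by (rule H.M.finsum_closed)
  have "?q ?A = (\<Oplus>\<^bsub>?Q\<^esub>s\<in>S. ?q (\<mu> (y s) (free_gen R s)))"
    by (rule linear_map_finsum[OF H Q q assms(3) terms])
  also have "\<dots> = (\<Oplus>\<^bsub>?Q\<^esub>s\<in>S. \<theta> (pure_tensor R Y C (y s) s))"
  proof (rule abelian_monoid.finsum_cong'[OF _ refl])
    show "abelian_monoid ?Q" using Q by (simp add: module_def abelian_group_def)
    show "(\<lambda>s. \<theta> (pure_tensor R Y C (y s) s)) \<in> S \<rightarrow> carrier ?Q"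
      using linear_map_closed[OF \<theta>(1)] pure_tensor_closed[OF assms(1,2)] ys assms(4) by blast
    fix s assume s: "s \<in> S"
    have "s \<in> carrier C" using s assms(4) by blast
    from \<theta>(2)[OF ys[OF s] this] show "?q (\<mu> (y s) (free_gen R s)) = \<theta> (pure_tensor R Y C (y s) s)"
      using g(2)[OF ys[OF s] gen[OF s]] unfolding \<pi>_gen[OF s] by (simp only:)
  qed
  also have "\<dots> = \<theta> (\<Oplus>\<^bsub>tensor_module R Y C\<^esub>s\<in>S. pure_tensor R Y C (y s) s)"
    using pure_tensor_closed[OF assms(1,2)] ys assms(4)
    by (intro linear_map_finsum[OF T Q \<theta>(1) assms(3), symmetric]) blast
  also have "\<dots> = \<zero>\<^bsub>?Q\<^esub>" unfolding zero by (rule linear_map_zero[OF T Q \<theta>(1)])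
  finally have "?A \<in> W" unfolding zero_quotient by (rule iffD1[OF coset_eq_zero_iff[OF H W A]])
  then obtain z where z: "z \<in> P \<rightarrow> carrier Y" "\<And>s. s \<in> S \<Longrightarrow> ?A (free_gen R s) = ?c z s" unfolding W_def by blast
  have "?A (free_gen R s) = y s" if s: "s \<in> S" for s
  proof -
    have "?A (free_gen R s) = (\<Oplus>\<^bsub>Y\<^esub>i\<in>S. \<mu> (y i) (free_gen R i) (free_gen R s))"
      by (rule hom_finsum[OF F assms(1,3) terms gen[OF s]])
    also have "\<dots> = (\<Oplus>\<^bsub>Y\<^esub>i\<in>S. if i = s then y s else \<zero>\<^bsub>Y\<^esub>)"
      using ys gen s by (intro Y.M.finsum_cong') (auto simp: \<mu>_gen fun_cong[OF free_gen_def])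
    also have "\<dots> = y s" by (rule finsum_delta[OF assms(1,3) s ys[OF s]])
    finally show ?thesis .
  qed
  then show ?thesis using z by (intro bexI[of _ z]) auto
qed

section \<open>Existence of free resolutions\<close>

text \<open>The next basis of the resolution is a set of codes, in the same list type, of finitely supported
  functions on the previous one. This needs an encoding of lists of lists as lists: every letter is
  preceded by the mark \<open>u\<close>, every list is terminated by the mark \<open>v\<close>.\<close>

fun encode_lists :: "'x \<Rightarrow> 'x \<Rightarrow> 'x list list \<Rightarrow> 'x list" where
  "encode_lists u v [] = []"
| "encode_lists u v ([] # xss) = v # encode_lists u v xss"
| "encode_lists u v ((x # xs) # xss) = u # x # encode_lists u v (xs # xss)"

lemma encode_lists_inj:
  assumes "u \<noteq> v" "encode_lists u v xss = encode_lists u v yss"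
  shows "xss = yss"
  using assms
proof (induction u v xss arbitrary: yss rule: encode_lists.induct)
  case (1 u v)
  then show ?case by (cases "(u, v, yss)" rule: encode_lists.cases) auto
next
  case (2 u v xss)
  then show ?case by (cases "(u, v, yss)" rule: encode_lists.cases) auto
next
  case (3 u v x xs xss)
  then obtain y ys yss' where "yss = (y # ys) # yss'"
    by (cases "(u, v, yss)" rule: encode_lists.cases) auto
  with 3 show ?case by fastforce
qed

text \<open>The value \<open>v i\<close> becomes an additional first letter of the index
  \<open>i\<close>, so that the entries remain in the type of the indices; \<open>undefined\<close>
  fills the module component of that letter. The order of the entries is left to the
  \<open>SOME\<close>.\<close>

definition graph_list :: "('a, 'r) ring_scheme \<Rightarrow> (('a \<times> 'm) list \<Rightarrow> 'a) \<Rightarrow> ('a \<times> 'm) list list" where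
  "graph_list R v = (SOME xs. set xs = (\<lambda>i. (v i, undefined) # i) ` {i. v i \<noteq> \<zero>\<^bsub>R\<^esub>})"

lemma graph_list_inj:
  assumes "v \<in> carrier (free_module R I)" "w \<in> carrier (free_module R I)" "graph_list R v = graph_list R w"
  shows "v = w"
proof -
  have set: "set (graph_list R v) = (\<lambda>i. (v i, undefined) # i) ` {i. v i \<noteq> \<zero>\<^bsub>R\<^esub>}"
    if "v \<in> carrier (free_module R I)" for v
    unfolding graph_list_def using that
    by (intro someI_ex[of "\<lambda>xs. set xs = _"] finite_list) (auto simp: carrier_free)
  have eq: "(\<lambda>i. (v i, undefined) # i) ` {i. v i \<noteq> \<zero>\<^bsub>R\<^esub>} =
      (\<lambda>i. (w i, undefined) # i) ` {i. w i \<noteq> \<zero>\<^bsub>R\<^esub>}"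
    using set[OF assms(1)] set[OF assms(2)] assms(3) by simp
  show ?thesis
  proof
    fix i
    have "(v i, undefined) # i \<in> (\<lambda>i. (w i, undefined) # i) ` {i. w i \<noteq> \<zero>\<^bsub>R\<^esub>}" if "v i \<noteq> \<zero>\<^bsub>R\<^esub>"
      unfolding eq[symmetric] using that by blast
    moreover have "(w i, undefined) # i \<in> (\<lambda>i. (v i, undefined) # i) ` {i. v i \<noteq> \<zero>\<^bsub>R\<^esub>}" if "w i \<noteq> \<zero>\<^bsub>R\<^esub>"
      unfolding eq using that by blast
    ultimately show "v i = w i" by (cases "v i = \<zero>\<^bsub>R\<^esub>"; cases "w i = \<zero>\<^bsub>R\<^esub>") auto
  qed
qed

text \<open>The basis consists of the codes of all elements of \<open>K\<close>. The code serves to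
  place this basis in a prescribed index type, and the generator at the code of \<open>x\<close> is
  sent to \<open>x\<close>.\<close>

lemma free_cover:
  assumes "module R P" "submodule K R P" "inj_on code K"
  shows "linear_map R (free_module R (code ` K)) P (free_lift R P (inv_into K code))"
    and "free_lift R P (inv_into K code) ` carrier (free_module R (code ` K)) = K"
proof -
  interpret P: module R P by fact
  let ?\<phi> = "inv_into K code"
  have R: "cring R" by (rule P.R.cring_axioms)
  note Kc = submodule_subset[OF assms(2)]
  have \<phi>: "?\<phi> \<in> code ` K \<rightarrow> carrier P"
    by (rule Pi_I) (rule subsetD[OF Kc inv_into_into])
  show lin: "linear_map R (free_module R (code ` K)) P (free_lift R P ?\<phi>)"
    by (rule linear_map_free_lift[OF assms(1) \<phi>])
  have gen: "free_lift R P ?\<phi> (free_gen R (code x)) = x" if "x \<in> K" for x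
    using free_lift_gen[OF assms(1) \<phi>, of "code x"] inv_into_f_f[OF assms(3) that] that by simp
  show "free_lift R P ?\<phi> ` carrier (free_module R (code ` K)) = K"
  proof
    show "K \<subseteq> free_lift R P ?\<phi> ` carrier (free_module R (code ` K))"
    proof
      fix x assume x: "x \<in> K"
      then have "free_gen R (code x) \<in> carrier (free_module R (code ` K))"
        by (intro free_gen_closed[OF R]) simp
      then show "x \<in> free_lift R P ?\<phi> ` carrier (free_module R (code ` K))"
        using gen[OF x] by (metis image_eqI)
    qed
    have "v \<in> {v \<in> carrier (free_module R (code ` K)). free_lift R P ?\<phi> v \<in> K}"
      if "v \<in> carrier (free_module R (code ` K))" for v
      by (rule free_induct[OF R submodule_vimage[OF module_free[OF R] assms(1) lin assms(2)] _ that])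
        (use gen in \<open>auto intro: free_gen_closed[OF R]\<close>)
    then show "free_lift R P ?\<phi> ` carrier (free_module R (code ` K)) \<subseteq> K" by blast
  qed
qed

lemma exists_free_resolution:
  fixes R :: "('a, 'r) ring_scheme" and M :: "('a, 'm) module"
  assumes "module R M" "\<one>\<^bsub>R\<^esub> \<noteq> \<zero>\<^bsub>R\<^esub>"
  shows "\<exists>(I :: nat \<Rightarrow> ('a \<times> 'm) list set) d e. free_resolution R M I d e"
proof -
  interpret M: module R M by fact
  have R: "cring R" by (rule M.R.cring_axioms)
  \<comment> \<open>The two marks of the encoding differ because
    \<open>\<one> \<noteq> \<zero>\<close>. The code is then injective on every free module with a
    basis of lists, so any kernel in it can index the next basis in the same type.\<close>
  define code :: "(('a \<times> 'm) list \<Rightarrow> 'a) \<Rightarrow> ('a \<times> 'm) list" where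
    "code v = encode_lists (\<one>\<^bsub>R\<^esub>, undefined) (\<zero>\<^bsub>R\<^esub>, undefined) (graph_list R v)" for v
  have code_inj: "inj_on code (carrier (free_module R I))" for I
  proof (rule inj_onI)
    fix v w assume vw: "v \<in> carrier (free_module R I)" "w \<in> carrier (free_module R I)" "code v = code w"
    have "graph_list R v = graph_list R w"
      by (rule encode_lists_inj[OF _ vw(3)[unfolded code_def]]) (use assms(2) in simp)
    then show "v = w" by (rule graph_list_inj[OF vw(1,2)])
  qed
  define code0 :: "'m \<Rightarrow> ('a \<times> 'm) list" where "code0 x = [(undefined, x)]" for x
  have code0_inj: "inj_on code0 (carrier M)" by (auto simp: inj_on_def code0_def)
  define e where "e = free_lift R M (inv_into (carrier M) code0)"
  \<comment> \<open>The recursion carries the current basis together with the kernel that the next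
    module has to cover. The differential can be recovered from this pair, so it is not carried
    along.\<close>
  define S where "S = rec_nat
    (code0 ` carrier M, {v \<in> carrier (free_module R (code0 ` carrier M)). e v = \<zero>\<^bsub>M\<^esub>})
    (\<lambda>_ (I, K). (code ` K, {v \<in> carrier (free_module R (code ` K)).
      free_lift R (free_module R I) (inv_into K code) v = \<zero>\<^bsub>free_module R I\<^esub>}))"
  define I where "I n = fst (S n)" for n
  define K where "K n = snd (S n)" for n
  define d where "d n = free_lift R (free_module R (I n)) (inv_into (K n) code)" for n
  have I0: "I 0 = code0 ` carrier M" and K0: "K 0 = {v \<in> carrier (free_module R (I 0)). e v = \<zero>\<^bsub>M\<^esub>}"
    by (simp_all add: I_def K_def S_def)
  have IS: "I (Suc n) = code ` K n"
    and KS: "K (Suc n) = {v \<in> carrier (free_module R (I (Suc n))). d n v = \<zero>\<^bsub>free_module R (I n)\<^esub>}" for n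
    by (simp_all add: I_def K_def S_def d_def split: prod.split)
  have F: "module R (free_module R J)" for J :: "('a \<times> 'm) list set" by (rule module_free[OF R])
  note e = free_cover[OF assms(1) submodule_carrier[OF assms(1)] code0_inj, folded I0 e_def]
  have K_sub: "submodule (K n) R (free_module R (I n))" for n
  proof (induction n)
    case 0
    show ?case unfolding K0 by (rule submodule_kernel[OF F assms(1) e(1)])
  next
    case (Suc n)
    have "inj_on code (K n)" using inj_on_subset[OF code_inj submodule_subset[OF Suc]] .
    from free_cover(1)[OF F Suc this, folded IS d_def]
    show ?case unfolding KS by (intro submodule_kernel[OF F F])
  qed
  have "inj_on code (K n)" for n using inj_on_subset[OF code_inj submodule_subset[OF K_sub]] .
  note d = free_cover[OF F K_sub this, folded IS d_def]
  have "free_resolution R M I d e"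
    unfolding free_resolution_def Let_def
    using e d by (auto simp: K0[symmetric] KS[symmetric])
  then show ?thesis by blast
qed

section \<open>The chosen resolutions and chain maps between them\<close>

definition res_cycles :: "('a, 'r) ring_scheme \<Rightarrow> ('a, 'm) module \<Rightarrow> nat \<Rightarrow> (('a \<times> 'm) list \<Rightarrow> 'a) set" where
  "res_cycles R M n = (case n of 0 \<Rightarrow> {x \<in> carrier (res_module R M 0). res_aug R M x = \<zero>\<^bsub>M\<^esub>}
     | Suc k \<Rightarrow> {x \<in> carrier (res_module R M (Suc k)). res_diff R M k x = \<zero>\<^bsub>res_module R M k\<^esub>})"

text \<open>Existence gives meaning to the \<open>SOME\<close> in \<open>chosen_resolution\<close>.
  With \<open>res_cycles\<close>, exactness at the augmentation and at the differentials becomes a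
  single equation in all degrees.\<close>

lemma chosen_resolution:
  fixes R :: "('a, 'r) ring_scheme" and M :: "('a, 'm) module"
  assumes "module R M" "\<one>\<^bsub>R\<^esub> \<noteq> \<zero>\<^bsub>R\<^esub>"
  shows linear_res_aug: "linear_map R (res_module R M 0) M (res_aug R M)"
    and res_aug_surj: "res_aug R M ` carrier (res_module R M 0) = carrier M"
    and linear_res_diff: "linear_map R (res_module R M (Suc n)) (res_module R M n) (res_diff R M n)"
    and res_diff_image: "res_diff R M n ` carrier (res_module R M (Suc n)) = res_cycles R M n"
proof -
  obtain I d e where "free_resolution R M (I :: nat \<Rightarrow> ('a \<times> 'm) list set) d e"
    using exists_free_resolution[OF assms] by blast
  then have "(\<lambda>(I, d, e). free_resolution R M I d e) (I, d, e)" by simp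
  from someI[of "\<lambda>(I, d, e). free_resolution R M I d e", OF this]
  have "case chosen_resolution R M of (I, d, e) \<Rightarrow> free_resolution R M I d e"
    unfolding chosen_resolution_def .
  then have *: "free_resolution R M (fst (chosen_resolution R M)) (res_diff R M) (res_aug R M)"
    unfolding res_diff_def res_aug_def by (simp add: case_prod_beta)
  show "linear_map R (res_module R M 0) M (res_aug R M)"
    "res_aug R M ` carrier (res_module R M 0) = carrier M"
    "linear_map R (res_module R M (Suc n)) (res_module R M n) (res_diff R M n)"
    "res_diff R M n ` carrier (res_module R M (Suc n)) = res_cycles R M n"
    using * unfolding free_resolution_def Let_def res_cycles_def res_module_def by (auto split: nat.split)
qed

lemma module_res: "module R M \<Longrightarrow> module R (res_module R M n)"
  unfolding res_module_def by (intro module_free) (auto simp: module_def)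

lemma submodule_res_cycles:
  assumes "module R M" "\<one>\<^bsub>R\<^esub> \<noteq> \<zero>\<^bsub>R\<^esub>"
  shows "submodule (res_cycles R M n) R (res_module R M n)"
  unfolding res_diff_image[OF assms, symmetric]
  by (rule submodule_image[OF module_res[OF assms(1)] module_res[OF assms(1)] linear_res_diff[OF assms]])

lemma res_diff_diff:
  assumes "module R M" "\<one>\<^bsub>R\<^esub> \<noteq> \<zero>\<^bsub>R\<^esub>" "x \<in> carrier (res_module R M (Suc (Suc n)))"
  shows "res_diff R M n (res_diff R M (Suc n) x) = \<zero>\<^bsub>res_module R M n\<^esub>"
  using res_diff_image[OF assms(1,2), of "Suc n"] assms(3) by (auto simp: res_cycles_def)

lemma res_aug_diff:
  assumes "module R M" "\<one>\<^bsub>R\<^esub> \<noteq> \<zero>\<^bsub>R\<^esub>" "x \<in> carrier (res_module R M (Suc 0))"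
  shows "res_aug R M (res_diff R M 0 x) = \<zero>\<^bsub>M\<^esub>"
  using res_diff_image[OF assms(1,2), of 0] assms(3) by (auto simp: res_cycles_def)

text \<open>As \<open>\<phi>\<close> preserves cycles, \<open>\<phi>\<close> after the differential
  lands in the cycles, which are the image of the next differential by exactness; freeness then
  lifts it. The new map preserves cycles again, so the step can be iterated.\<close>

lemma chain_lift_step:
  assumes "module R M'" "module R M" "\<one>\<^bsub>R\<^esub> \<noteq> \<zero>\<^bsub>R\<^esub>"
    and "linear_map R (res_module R M' n) (res_module R M n) \<phi>"
    and "\<phi> ` res_cycles R M' n \<subseteq> res_cycles R M n"
  shows "\<exists>\<psi>. linear_map R (res_module R M' (Suc n)) (res_module R M (Suc n)) \<psi> \<and>
    \<psi> ` res_cycles R M' (Suc n) \<subseteq> res_cycles R M (Suc n) \<and>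
    (\<forall>x\<in>carrier (res_module R M' (Suc n)). res_diff R M n (\<psi> x) = \<phi> (res_diff R M' n x))"
proof -
  let ?F = "res_module R M" and ?F' = "res_module R M'"
  have F: "module R (?F n)" "module R (?F' n)" for n using module_res assms by auto
  let ?Z = "?F n\<lparr>carrier := res_cycles R M n\<rparr>"
  have Z: "module R ?Z" by (rule submodule_module[OF F(1) submodule_res_cycles[OF assms(2,3)]])
  have im: "res_diff R M n ` carrier (?F (Suc n)) = res_cycles R M n"
    by (rule res_diff_image[OF assms(2,3)])
  have q: "linear_map R (?F (Suc n)) ?Z (res_diff R M n)" "res_diff R M n ` carrier (?F (Suc n)) = carrier ?Z"
    using im by (auto intro!: linear_map_into_submodule linear_res_diff[OF assms(2,3)])
  have f: "linear_map R (?F' (Suc n)) ?Z (\<lambda>x. \<phi> (res_diff R M' n x))"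
    using res_diff_image[OF assms(1,3), of n] assms(5)
    by (intro linear_map_into_submodule linear_map_compose[OF linear_res_diff[OF assms(1,3)] assms(4)]) blast
  obtain \<psi> where \<psi>: "linear_map R (?F' (Suc n)) (?F (Suc n)) \<psi>"
      "\<And>x. x \<in> carrier (?F' (Suc n)) \<Longrightarrow> res_diff R M n (\<psi> x) = \<phi> (res_diff R M' n x)"
    by (rule free_projective[OF F(1) Z q f[unfolded res_module_def[of R M' "Suc n"]]])
      (auto simp: res_module_def)
  have "\<psi> x \<in> res_cycles R M (Suc n)" if "x \<in> res_cycles R M' (Suc n)" for x
    using that \<psi>(2)[of x] linear_map_closed[OF \<psi>(1), of x] linear_map_zero[OF F(2,1) assms(4)]
    by (simp add: res_cycles_def)
  then show ?thesis using \<psi> by blast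
qed

lemma exists_chain_lift:
  assumes "module R M'" "module R M" "\<one>\<^bsub>R\<^esub> \<noteq> \<zero>\<^bsub>R\<^esub>" "linear_map R M' M f"
  shows "\<exists>\<phi>. chain_lift R M' M f \<phi>"
proof -
  let ?F = "res_module R M" and ?F' = "res_module R M'"
  have F: "module R (?F n)" "module R (?F' n)" for n using module_res assms by auto
  \<comment> \<open>Dependent choice does not let the first member be prescribed, so compatibility
    with the augmentations is made part of the invariant in degree zero.\<close>
  let ?P = "\<lambda>n \<phi>. linear_map R (?F' n) (?F n) \<phi> \<and> \<phi> ` res_cycles R M' n \<subseteq> res_cycles R M n \<and>
    (n = 0 \<longrightarrow> (\<forall>x\<in>carrier (?F' 0). res_aug R M (\<phi> x) = f (res_aug R M' x)))"
  let ?Q = "\<lambda>n \<phi> \<psi>. \<forall>x\<in>carrier (?F' (Suc n)). res_diff R M n (\<psi> x) = \<phi> (res_diff R M' n x)"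
  obtain \<phi>0 where \<phi>0: "linear_map R (?F' 0) (?F 0) \<phi>0"
      "\<And>x. x \<in> carrier (?F' 0) \<Longrightarrow> res_aug R M (\<phi>0 x) = f (res_aug R M' x)"
    by (rule free_projective[OF F(1) assms(2) linear_res_aug[OF assms(2,3)] res_aug_surj[OF assms(2,3)]
          linear_map_compose[OF linear_res_aug[OF assms(1,3)] assms(4), unfolded res_module_def[of R M' 0]]])
      (auto simp: res_module_def)
  have "\<phi>0 x \<in> res_cycles R M 0" if "x \<in> res_cycles R M' 0" for x
    using that \<phi>0(2)[of x] linear_map_closed[OF \<phi>0(1), of x] linear_map_zero[OF assms(1,2,4)]
    by (simp add: res_cycles_def)
  then have base: "\<exists>\<phi>. ?P 0 \<phi>" using \<phi>0 by (intro exI[of _ \<phi>0]) auto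
  have step: "\<exists>\<psi>. ?P (Suc n) \<psi> \<and> ?Q n \<phi> \<psi>" if "?P n \<phi>" for n \<phi>
    using chain_lift_step[OF assms(1,2,3), of n \<phi>] that by simp
  from dependent_nat_choice[of ?P ?Q, OF base step]
  obtain \<phi> where "\<forall>n. ?P n (\<phi> n) \<and> ?Q n (\<phi> n) (\<phi> (Suc n))" ..
  then have "chain_lift R M' M f \<phi>" unfolding chain_lift_def by simp
  then show ?thesis by blast
qed

section \<open>Cohomology\<close>

locale cochain_complex =
  fixes R :: "('a, 'r) ring_scheme" and A :: "nat \<Rightarrow> ('a, 'm) module" and \<delta> :: "nat \<Rightarrow> 'm \<Rightarrow> 'm"
  assumes module_cochains: "module R (A n)"
    and linear_diff: "linear_map R (A n) (A (Suc n)) (\<delta> n)"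
    and diff_diff: "x \<in> carrier (A n) \<Longrightarrow> \<delta> (Suc n) (\<delta> n x) = \<zero>\<^bsub>A (Suc (Suc n))\<^esub>"
begin

lemma submodule_cocycles: "submodule (cocycles A \<delta> n) R (A n)"
  unfolding cocycles_def by (rule submodule_kernel[OF module_cochains module_cochains linear_diff])

lemma submodule_coboundaries: "submodule (coboundaries A \<delta> n) R (A n)"
  unfolding coboundaries_def
  by (cases n) (auto intro: submodule_zero_set module_cochains submodule_image linear_diff)

lemma coboundaries_subset: "coboundaries A \<delta> n \<subseteq> cocycles A \<delta> n"
proof (cases n)
  case 0
  then show ?thesis using submodule_zero[OF submodule_cocycles, of 0] by (simp add: coboundaries_def)
next
  case (Suc k)
  then show ?thesis
    using diff_diff linear_map_closed[OF linear_diff] by (auto simp: coboundaries_def cocycles_def)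
qed

abbreviation "Z n \<equiv> (A n)\<lparr>carrier := cocycles A \<delta> n\<rparr>"
abbreviation "B n \<equiv> (A n)\<lparr>carrier := coboundaries A \<delta> n\<rparr>"
abbreviation "H n \<equiv> cohomology A \<delta> n"
abbreviation "cls n x \<equiv> coboundaries A \<delta> n +>\<^bsub>A n\<^esub> x"

lemma module_Z: "module R (Z n)"
  by (rule submodule_module[OF module_cochains submodule_cocycles])

lemma module_B: "module R (B n)"
  by (rule submodule_module[OF module_cochains submodule_coboundaries])

lemma submodule_coboundaries_Z: "submodule (coboundaries A \<delta> n) R (Z n)"
  by (rule submodule_criterion[OF module_Z])
    (use coboundaries_subset submodule_zero[OF submodule_coboundaries] submodule_add[OF submodule_coboundaries]
      submodule_smult[OF submodule_coboundaries] in auto)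

lemma coset_Z: "coboundaries A \<delta> n +>\<^bsub>Z n\<^esub> x = cls n x"
  by (simp add: a_r_coset_def r_coset_def)

lemma module_H: "module R (H n)"
  unfolding cohomology_def by (rule module_quotient[OF module_Z submodule_coboundaries_Z])

lemma linear_cls: "linear_map R (Z n) (H n) (\<lambda>x. cls n x)"
  using linear_map_coset[OF module_Z submodule_coboundaries_Z] unfolding cohomology_def coset_Z .

lemma cls_surj: "(\<lambda>x. cls n x) ` carrier (Z n) = carrier (H n)"
  unfolding cohomology_def carrier_quotient coset_Z ..

lemma cls_eq_zero_iff: "x \<in> cocycles A \<delta> n \<Longrightarrow> cls n x = \<zero>\<^bsub>H n\<^esub> \<longleftrightarrow> x \<in> coboundaries A \<delta> n"
  using coset_eq_zero_iff[OF module_Z submodule_coboundaries_Z, of x n]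
  unfolding coset_Z by (simp add: cohomology_def)

lemma in_cls_iff:
  assumes "x \<in> cocycles A \<delta> n"
  shows "y \<in> cls n x \<longleftrightarrow> y \<in> cocycles A \<delta> n \<and> cls n y = cls n x"
  using in_coset_iff[OF module_Z submodule_coboundaries_Z, of x n y] assms unfolding coset_Z by simp

lemma diff_in_coboundaries: "x \<in> carrier (A n) \<Longrightarrow> \<delta> n x \<in> coboundaries A \<delta> (Suc n)"
  by (simp add: coboundaries_def)

end

text \<open>The map \<open>g\<close> that descends to cohomology shows that the class of
  \<open>\<phi> z\<close> is constant for \<open>z\<close> in a coset, so the union in
  \<open>cohomology_map\<close> collapses to one class; linearity is then that of
  \<open>g\<close>.\<close>

lemma cohomology_map:
  assumes "cochain_complex R A \<delta>" "cochain_complex R A' \<delta>'"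
    and "linear_map R (A n) (A' n) \<phi>"
    and "\<And>x. x \<in> cocycles A \<delta> n \<Longrightarrow> \<phi> x \<in> cocycles A' \<delta>' n"
    and "\<And>x. x \<in> coboundaries A \<delta> n \<Longrightarrow> \<phi> x \<in> coboundaries A' \<delta>' n"
  shows cohomology_map_cls: "\<And>x. x \<in> cocycles A \<delta> n \<Longrightarrow>
      cohomology_map A \<delta> A' \<delta>' n \<phi> (coboundaries A \<delta> n +>\<^bsub>A n\<^esub> x) = coboundaries A' \<delta>' n +>\<^bsub>A' n\<^esub> \<phi> x"
    and linear_cohomology_map: "linear_map R (cohomology A \<delta> n) (cohomology A' \<delta>' n) (cohomology_map A \<delta> A' \<delta>' n \<phi>)"
proof -
  interpret A: cochain_complex R A \<delta> by fact
  interpret A': cochain_complex R A' \<delta>' by fact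
  have lin: "linear_map R (A.Z n) (A'.Z n) \<phi>"
    by (rule linear_map_into_submodule[OF linear_map_on_submodule[OF assms(3)]])
      (use assms(4) submodule_subset[OF A.submodule_cocycles] in auto)
  obtain g where g: "linear_map R (A.H n) (A'.H n) g" "\<And>x. x \<in> carrier (A.Z n) \<Longrightarrow> g (A.cls n x) = A'.cls n (\<phi> x)"
  proof (rule factor_through_surjection[OF A.module_Z A.module_H A'.module_H A.linear_cls A.cls_surj
      linear_map_compose[OF lin A'.linear_cls]])
    fix x assume "x \<in> carrier (A.Z n)" "A.cls n x = \<zero>\<^bsub>A.H n\<^esub>"
    then have x: "x \<in> cocycles A \<delta> n" "x \<in> coboundaries A \<delta> n" using A.cls_eq_zero_iff by auto
    show "A'.cls n (\<phi> x) = \<zero>\<^bsub>A'.H n\<^esub>"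
      using A'.cls_eq_zero_iff[OF assms(4)[OF x(1)]] assms(5)[OF x(2)] by blast
  qed blast
  have val: "cohomology_map A \<delta> A' \<delta>' n \<phi> (A.cls n x) = A'.cls n (\<phi> x)" if x: "x \<in> cocycles A \<delta> n" for x
  proof -
    have const: "A'.cls n (\<phi> z) = A'.cls n (\<phi> x)" if "z \<in> A.cls n x" for z
    proof -
      have z: "z \<in> cocycles A \<delta> n" "A.cls n z = A.cls n x" using that A.in_cls_iff[OF x] by auto
      then show ?thesis using g(2)[of z] g(2)[of x] x by simp
    qed
    have x_in: "x \<in> A.cls n x" using A.in_cls_iff[OF x] x by blast
    then have "(\<Union>z\<in>A.cls n x. A'.cls n (\<phi> z)) = A'.cls n (\<phi> x)" using const by blast
    moreover have "A.cls n x \<in> carrier (A.H n)"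
      using linear_map_closed[OF A.linear_cls, of x n] x by simp
    ultimately show ?thesis unfolding cohomology_map_def by simp
  qed
  show "cohomology_map A \<delta> A' \<delta>' n \<phi> (A.cls n x) = A'.cls n (\<phi> x)" if x: "x \<in> cocycles A \<delta> n" for x
    by (rule val[OF x])
  have "linear_map R (A.H n) (A'.H n) (cohomology_map A \<delta> A' \<delta>' n \<phi>) = linear_map R (A.H n) (A'.H n) g"
  proof (rule linear_map_cong[OF A.module_H])
    fix X assume "X \<in> carrier (A.H n)"
    then obtain x where "x \<in> carrier (A.Z n)" "X = A.cls n x" unfolding A.cls_surj[symmetric] by blast
    then show "cohomology_map A \<delta> A' \<delta>' n \<phi> X = g X" using val g(2) by simp
  qed
  then show "linear_map R (A.H n) (A'.H n) (cohomology_map A \<delta> A' \<delta>' n \<phi>)" using g(1) by simp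
qed

section \<open>Ext as cohomology of the complex of homomorphisms\<close>

lemma ext_diff_apply:
  "x \<in> carrier (res_module R M (Suc n)) \<Longrightarrow> ext_diff R M n \<alpha> x = \<alpha> (res_diff R M n x)"
  by (simp add: ext_diff_def compose_def)

lemma ext_cochain_complex:
  assumes "module R M" "module R N" "\<one>\<^bsub>R\<^esub> \<noteq> \<zero>\<^bsub>R\<^esub>"
  shows "cochain_complex R (ext_complex R M N) (ext_diff R M)"
proof (rule cochain_complex.intro)
  show mod: "module R (ext_complex R M N n)" for n
    unfolding ext_complex_def by (rule module_hom[OF module_res[OF assms(1)] assms(2)])
  show lin: "linear_map R (ext_complex R M N n) (ext_complex R M N (Suc n)) (ext_diff R M n)" for n
    unfolding ext_complex_def ext_diff_def
    by (rule linear_map_precompose[OF module_res[OF assms(1)] linear_res_diff[OF assms(1,3)]])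
  fix \<alpha> n assume \<alpha>: "\<alpha> \<in> carrier (ext_complex R M N n)"
  show "ext_diff R M (Suc n) (ext_diff R M n \<alpha>) = \<zero>\<^bsub>ext_complex R M N (Suc (Suc n))\<^esub>"
  proof (rule hom_eqI[where R = R])
    show "ext_diff R M (Suc n) (ext_diff R M n \<alpha>) \<in> carrier (hom_module R (res_module R M (Suc (Suc n))) N)"
      using linear_map_closed[OF lin linear_map_closed[OF lin \<alpha>]] by (simp add: ext_complex_def)
    show "\<zero>\<^bsub>ext_complex R M N (Suc (Suc n))\<^esub> \<in> carrier (hom_module R (res_module R M (Suc (Suc n))) N)"
      using submodule_zero[OF submodule_carrier[OF mod]] unfolding ext_complex_def .
    fix x assume x: "x \<in> carrier (res_module R M (Suc (Suc n)))"
    then show "ext_diff R M (Suc n) (ext_diff R M n \<alpha>) x = \<zero>\<^bsub>ext_complex R M N (Suc (Suc n))\<^esub> x"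
      using res_diff_diff[OF assms(1,3) x] linear_map_closed[OF linear_res_diff[OF assms(1,3)] x]
        linear_map_zero[OF module_res[OF assms(1)] assms(2) hom_linear[OF \<alpha>[unfolded ext_complex_def]]]
      by (simp add: ext_diff_apply ext_complex_def hom_zero)
  qed
qed

lemma ext_cocycle_iff:
  assumes "module R M" "module R N" "\<one>\<^bsub>R\<^esub> \<noteq> \<zero>\<^bsub>R\<^esub>"
  shows "\<alpha> \<in> cocycles (ext_complex R M N) (ext_diff R M) n \<longleftrightarrow>
    \<alpha> \<in> carrier (hom_module R (res_module R M n) N) \<and>
    (\<forall>x\<in>carrier (res_module R M (Suc n)). \<alpha> (res_diff R M n x) = \<zero>\<^bsub>N\<^esub>)"
proof -
  interpret E: cochain_complex R "ext_complex R M N" "ext_diff R M" by (rule ext_cochain_complex[OF assms])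
  have "ext_diff R M n \<alpha> = \<zero>\<^bsub>ext_complex R M N (Suc n)\<^esub> \<longleftrightarrow>
      (\<forall>x\<in>carrier (res_module R M (Suc n)). \<alpha> (res_diff R M n x) = \<zero>\<^bsub>N\<^esub>)"
    if "\<alpha> \<in> carrier (hom_module R (res_module R M n) N)"
  proof
    assume eq: "ext_diff R M n \<alpha> = \<zero>\<^bsub>ext_complex R M N (Suc n)\<^esub>"
    show "\<forall>x\<in>carrier (res_module R M (Suc n)). \<alpha> (res_diff R M n x) = \<zero>\<^bsub>N\<^esub>"
    proof
      fix x assume x: "x \<in> carrier (res_module R M (Suc n))"
      from fun_cong[OF eq, of x] x show "\<alpha> (res_diff R M n x) = \<zero>\<^bsub>N\<^esub>"
        by (simp add: ext_diff_apply ext_complex_def hom_zero)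
    qed
  next
    assume zero: "\<forall>x\<in>carrier (res_module R M (Suc n)). \<alpha> (res_diff R M n x) = \<zero>\<^bsub>N\<^esub>"
    show "ext_diff R M n \<alpha> = \<zero>\<^bsub>ext_complex R M N (Suc n)\<^esub>"
    proof (rule hom_eqI[where R = R])
      show "ext_diff R M n \<alpha> \<in> carrier (hom_module R (res_module R M (Suc n)) N)"
        using linear_map_closed[OF E.linear_diff, of \<alpha> n] that by (simp add: ext_complex_def)
      show "\<zero>\<^bsub>ext_complex R M N (Suc n)\<^esub> \<in> carrier (hom_module R (res_module R M (Suc n)) N)"
        using submodule_zero[OF submodule_carrier[OF E.module_cochains]] unfolding ext_complex_def .
    qed (use zero in \<open>simp add: ext_diff_apply ext_complex_def hom_zero\<close>)
  qed
  then show ?thesis by (auto simp: cocycles_def ext_complex_def)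
qed

section \<open>Vanishing of Ext\<close>

text \<open>Vanishing of \<open>Ext\<close> in all degrees at least 1, whence the
  \<open>Suc j\<close>: each cocycle factors through the differential. It is phrased with plain
  linear maps, without cosets and extensionality, so that the parts of the long exact sequence can
  be chased on cochains.\<close>

definition ext_vanishing :: "('a, 'r) ring_scheme \<Rightarrow> ('a, 'c) module \<Rightarrow> ('a, 'm) module \<Rightarrow> bool" where
  "ext_vanishing R C A \<longleftrightarrow> (\<forall>j f. linear_map R (res_module R C (Suc j)) A f \<longrightarrow>
     (\<forall>x\<in>carrier (res_module R C (Suc (Suc j))). f (res_diff R C (Suc j) x) = \<zero>\<^bsub>A\<^esub>) \<longrightarrow>
     (\<exists>h. linear_map R (res_module R C j) A h \<and>
       (\<forall>x\<in>carrier (res_module R C (Suc j)). f x = h (res_diff R C j x))))"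

lemma ext_vanishingI:
  assumes "\<And>j f. linear_map R (res_module R C (Suc j)) A f \<Longrightarrow>
     (\<And>x. x \<in> carrier (res_module R C (Suc (Suc j))) \<Longrightarrow> f (res_diff R C (Suc j) x) = \<zero>\<^bsub>A\<^esub>) \<Longrightarrow>
     \<exists>h. linear_map R (res_module R C j) A h \<and>
       (\<forall>x\<in>carrier (res_module R C (Suc j)). f x = h (res_diff R C j x))"
  shows "ext_vanishing R C A"
  using assms unfolding ext_vanishing_def by simp

lemma ext_vanishingD:
  assumes "ext_vanishing R C A" "linear_map R (res_module R C (Suc j)) A f"
    and "\<And>x. x \<in> carrier (res_module R C (Suc (Suc j))) \<Longrightarrow> f (res_diff R C (Suc j) x) = \<zero>\<^bsub>A\<^esub>"
  obtains h where "linear_map R (res_module R C j) A h"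
    "\<And>x. x \<in> carrier (res_module R C (Suc j)) \<Longrightarrow> f x = h (res_diff R C j x)"
  using assms unfolding ext_vanishing_def by blast

lemma ext_vanishing_Ext:
  assumes "module R C" "module R A" "\<one>\<^bsub>R\<^esub> \<noteq> \<zero>\<^bsub>R\<^esub>" "\<forall>i\<ge>1. zero_module (Ext R i C A)"
  shows "ext_vanishing R C A"
proof (rule ext_vanishingI)
  fix j f assume f: "linear_map R (res_module R C (Suc j)) A f"
    and cocycle: "\<And>x. x \<in> carrier (res_module R C (Suc (Suc j))) \<Longrightarrow> f (res_diff R C (Suc j) x) = \<zero>\<^bsub>A\<^esub>"
  interpret E: cochain_complex R "ext_complex R C A" "ext_diff R C" by (rule ext_cochain_complex[OF assms(1-3)])
  let ?f = "restrict f (carrier (res_module R C (Suc j)))"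
  have Z: "?f \<in> cocycles (ext_complex R C A) (ext_diff R C) (Suc j)"
    unfolding ext_cocycle_iff[OF assms(1-3)]
    using restrict_in_hom[OF module_res[OF assms(1)] f] cocycle
      linear_map_closed[OF linear_res_diff[OF assms(1,3)]] by simp
  have "zero_module (E.H (Suc j))" using assms(4) unfolding Ext_def by simp
  moreover have "E.cls (Suc j) ?f \<in> carrier (E.H (Suc j))"
    using linear_map_closed[OF E.linear_cls, of ?f] Z by simp
  ultimately have "E.cls (Suc j) ?f = \<zero>\<^bsub>E.H (Suc j)\<^esub>" unfolding zero_module_def by blast
  then have "?f \<in> coboundaries (ext_complex R C A) (ext_diff R C) (Suc j)"
    using E.cls_eq_zero_iff[OF Z] by blast
  then obtain \<beta> where \<beta>: "\<beta> \<in> carrier (hom_module R (res_module R C j) A)" "?f = ext_diff R C j \<beta>"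
    by (auto simp: coboundaries_def ext_complex_def)
  have "f x = \<beta> (res_diff R C j x)" if "x \<in> carrier (res_module R C (Suc j))" for x
    using fun_cong[OF \<beta>(2), of x] that by (simp add: ext_diff_apply)
  then show "\<exists>h. linear_map R (res_module R C j) A h \<and>
      (\<forall>x\<in>carrier (res_module R C (Suc j)). f x = h (res_diff R C j x))"
    using hom_linear[OF \<beta>(1)] by blast
qed

text \<open>A cocycle is pushed to \<open>A'\<close> by \<open>\<sigma>\<close>, written as a
  coboundary there, and brought back by \<open>\<tau>\<close>. It is used to move the condition
  along isomorphisms.\<close>

lemma ext_vanishing_retract:
  assumes "module R A" "module R A'" "linear_map R A A' \<sigma>" "linear_map R A' A \<tau>"
    and "\<And>a. a \<in> carrier A \<Longrightarrow> \<tau> (\<sigma> a) = a" "ext_vanishing R C A'"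
  shows "ext_vanishing R C A"
proof (rule ext_vanishingI)
  fix j f assume f: "linear_map R (res_module R C (Suc j)) A f"
    and cocycle: "\<And>x. x \<in> carrier (res_module R C (Suc (Suc j))) \<Longrightarrow> f (res_diff R C (Suc j) x) = \<zero>\<^bsub>A\<^esub>"
  obtain h where h: "linear_map R (res_module R C j) A' h"
    "\<And>x. x \<in> carrier (res_module R C (Suc j)) \<Longrightarrow> \<sigma> (f x) = h (res_diff R C j x)"
    by (rule ext_vanishingD[OF assms(6) linear_map_compose[OF f assms(3)]])
      (auto simp: cocycle linear_map_zero[OF assms(1,2,3)])
  have "f x = \<tau> (h (res_diff R C j x))" if "x \<in> carrier (res_module R C (Suc j))" for x
    using h(2)[OF that, symmetric] assms(5)[OF linear_map_closed[OF f that]] by simp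
  then show "\<exists>h. linear_map R (res_module R C j) A h \<and>
      (\<forall>x\<in>carrier (res_module R C (Suc j)). f x = h (res_diff R C j x))"
    using linear_map_compose[OF h(1) assms(4)] by blast
qed

definition short_exact ::
    "('a, 'r) ring_scheme \<Rightarrow> ('a, 'm) module \<Rightarrow> ('a, 'n) module \<Rightarrow> ('a, 'p) module \<Rightarrow>
     ('m \<Rightarrow> 'n) \<Rightarrow> ('n \<Rightarrow> 'p) \<Rightarrow> bool" where
  "short_exact R A B D j q \<longleftrightarrow> module R A \<and> module R B \<and> module R D \<and>
     linear_map R A B j \<and> linear_map R B D q \<and>
     (\<forall>a\<in>carrier A. j a = \<zero>\<^bsub>B\<^esub> \<longrightarrow> a = \<zero>\<^bsub>A\<^esub>) \<and> q ` carrier B = carrier D \<and>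
     j ` carrier A = {b \<in> carrier B. q b = \<zero>\<^bsub>D\<^esub>}"

text \<open>Left exactness of \<open>Hom(P, _)\<close>: the inverse of \<open>j\<close> on its image
  is linear, and \<open>g\<close> lands in that image.\<close>

lemma short_exact_kernel:
  assumes "short_exact R A B D j q" "linear_map R P B g" "\<And>x. x \<in> carrier P \<Longrightarrow> q (g x) = \<zero>\<^bsub>D\<^esub>"
  obtains g' where "linear_map R P A g'" "\<And>x. x \<in> carrier P \<Longrightarrow> j (g' x) = g x"
proof -
  have A: "module R A" and B: "module R B" and j: "linear_map R A B j"
    and inj0: "\<And>a. a \<in> carrier A \<Longrightarrow> j a = \<zero>\<^bsub>B\<^esub> \<Longrightarrow> a = \<zero>\<^bsub>A\<^esub>"
    and im: "j ` carrier A = {b \<in> carrier B. q b = \<zero>\<^bsub>D\<^esub>}"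
    using assms(1) unfolding short_exact_def by auto
  have inj: "inj_on j (carrier A)" by (rule linear_map_inj_onI[OF A B j inj0])
  let ?K = "B\<lparr>carrier := j ` carrier A\<rparr>"
  have K: "module R ?K" by (rule submodule_module[OF B submodule_image[OF A B j]])
  have iso: "module_iso R A ?K j"
    unfolding module_iso_def using inj by (auto intro!: linear_map_into_submodule[OF j] simp: bij_betw_def)
  have gK: "linear_map R P ?K g"
    using assms(3) linear_map_closed[OF assms(2)] by (intro linear_map_into_submodule[OF assms(2)]) (simp add: im)
  show ?thesis
  proof (rule that[OF linear_map_compose[OF gK linear_map_inv_into[OF A K iso]]])
    fix x assume "x \<in> carrier P"
    then have "g x \<in> j ` carrier A" using linear_map_closed[OF gK] by simp
    then show "j (inv_into (carrier A) j (g x)) = g x" by (rule f_inv_into_f)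
  qed
qed

text \<open>Exactness of \<open>Ext(C, A) \<rightarrow> Ext(C, B) \<rightarrow> Ext(C, D)\<close> in
  the middle, on cochains. The image of \<open>f\<close> in \<open>D\<close> is the coboundary of
  \<open>h\<close>; subtracting the coboundary of a lift \<open>h'\<close> leaves a cocycle that
  comes from \<open>A\<close>, where it is the coboundary of some \<open>k\<close>.\<close>

lemma ext_vanishing_extension:
  assumes "short_exact R A B D j q" "module R C" "\<one>\<^bsub>R\<^esub> \<noteq> \<zero>\<^bsub>R\<^esub>"
    and "ext_vanishing R C A" "ext_vanishing R C D"
  shows "ext_vanishing R C B"
proof (rule ext_vanishingI)
  let ?G = "res_module R C" and ?d = "res_diff R C"
  fix n f assume f: "linear_map R (?G (Suc n)) B f"
    and cocycle: "\<And>x. x \<in> carrier (?G (Suc (Suc n))) \<Longrightarrow> f (?d (Suc n) x) = \<zero>\<^bsub>B\<^esub>"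
  have A: "module R A" and B: "module R B" and D: "module R D" and j: "linear_map R A B j" and q: "linear_map R B D q"
    and inj: "\<And>a. a \<in> carrier A \<Longrightarrow> j a = \<zero>\<^bsub>B\<^esub> \<Longrightarrow> a = \<zero>\<^bsub>A\<^esub>" and surj: "q ` carrier B = carrier D"
    using assms(1) unfolding short_exact_def by auto
  interpret B: module R B by (rule B)
  interpret D: module R D by (rule D)
  have G: "module R (?G n)" for n by (rule module_res[OF assms(2)])
  note d = linear_res_diff[OF assms(2,3)]
  note dc = linear_map_closed[OF d]
  obtain h where h: "linear_map R (?G n) D h" "\<And>x. x \<in> carrier (?G (Suc n)) \<Longrightarrow> q (f x) = h (?d n x)"
    by (rule ext_vanishingD[OF assms(5) linear_map_compose[OF f q]]) (auto simp: cocycle linear_map_zero[OF B D q])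
  obtain h' where h': "linear_map R (?G n) B h'" "\<And>x. x \<in> carrier (?G n) \<Longrightarrow> q (h' x) = h x"
    by (rule free_projective[OF B D q surj h(1)[unfolded res_module_def]]) (auto simp: res_module_def)
  let ?g = "\<lambda>x. f x \<ominus>\<^bsub>B\<^esub> h' (?d n x)"
  have h'd: "linear_map R (?G (Suc n)) B (\<lambda>x. h' (?d n x))" by (rule linear_map_compose[OF d h'(1)])
  note h'c = linear_map_closed[OF h'(1)] and fc = linear_map_closed[OF f]
  have g: "linear_map R (?G (Suc n)) B ?g" by (rule linear_map_diff[OF G B f h'd])
  have qg: "q (?g x) = \<zero>\<^bsub>D\<^esub>" if x: "x \<in> carrier (?G (Suc n))" for x
    using linear_map_minus[OF B D q fc[OF x] h'c[OF dc[OF x]]] h(2)[OF x] h'(2)[OF dc[OF x]]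
      linear_map_closed[OF h(1) dc[OF x]] by (simp add: D.M.minus_eq_zero_iff)
  obtain g' where g': "linear_map R (?G (Suc n)) A g'" "\<And>x. x \<in> carrier (?G (Suc n)) \<Longrightarrow> j (g' x) = ?g x"
    by (rule short_exact_kernel[OF assms(1) g qg]) blast+
  have g'0: "g' (?d (Suc n) x) = \<zero>\<^bsub>A\<^esub>" if x: "x \<in> carrier (?G (Suc (Suc n)))" for x
  proof (rule inj[OF linear_map_closed[OF g'(1) dc[OF x]]])
    show "j (g' (?d (Suc n) x)) = \<zero>\<^bsub>B\<^esub>"
      using g'(2)[OF dc[OF x]] cocycle[OF x] res_diff_diff[OF assms(2,3) x] linear_map_zero[OF G B h'(1)]
      by (simp add: B.M.minus_zero_right)
  qed
  obtain k where k: "linear_map R (?G n) A k" "\<And>x. x \<in> carrier (?G (Suc n)) \<Longrightarrow> g' x = k (?d n x)"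
    by (rule ext_vanishingD[OF assms(4) g'(1) g'0]) blast+
  have "f x = h' (?d n x) \<oplus>\<^bsub>B\<^esub> j (k (?d n x))" if x: "x \<in> carrier (?G (Suc n))" for x
    using g'(2)[OF x] k(2)[OF x] fc[OF x] h'c[OF dc[OF x]]
    by (simp add: a_minus_def B.M.a_lcomm[of "h' (?d n x)"] B.M.r_neg)
  then show "\<exists>h. linear_map R (?G n) B h \<and> (\<forall>x\<in>carrier (?G (Suc n)). f x = h (?d n x))"
    using linear_map_plus[OF G B h'(1) linear_map_compose[OF k(1) j]] by blast
qed

text \<open>Exactness of \<open>Ext^i(C, B) \<rightarrow> Ext^i(C, D) \<rightarrow> Ext^(i+1)(C,
  A)\<close> in the middle. Lifting \<open>f\<close> to \<open>B\<close> loses the cocycle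
  condition; vanishing in \<open>A\<close> one degree higher supplies the correction
  \<open>k\<close> that restores it.\<close>

lemma ext_vanishing_cokernel:
  assumes "short_exact R A B D j q" "module R C" "\<one>\<^bsub>R\<^esub> \<noteq> \<zero>\<^bsub>R\<^esub>"
    and "ext_vanishing R C A" "ext_vanishing R C B"
  shows "ext_vanishing R C D"
proof (rule ext_vanishingI)
  let ?G = "res_module R C" and ?d = "res_diff R C"
  fix n f assume f: "linear_map R (?G (Suc n)) D f"
    and cocycle: "\<And>x. x \<in> carrier (?G (Suc (Suc n))) \<Longrightarrow> f (?d (Suc n) x) = \<zero>\<^bsub>D\<^esub>"
  have A: "module R A" and B: "module R B" and D: "module R D" and j: "linear_map R A B j" and q: "linear_map R B D q"
    and inj: "\<And>a. a \<in> carrier A \<Longrightarrow> j a = \<zero>\<^bsub>B\<^esub> \<Longrightarrow> a = \<zero>\<^bsub>A\<^esub>" and surj: "q ` carrier B = carrier D"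
    and im: "j ` carrier A = {b \<in> carrier B. q b = \<zero>\<^bsub>D\<^esub>}"
    using assms(1) unfolding short_exact_def by auto
  interpret B: module R B by (rule B)
  interpret D: module R D by (rule D)
  have G: "module R (?G n)" for n by (rule module_res[OF assms(2)])
  note d = linear_res_diff[OF assms(2,3)]
  note dc = linear_map_closed[OF d]
  obtain f' where f': "linear_map R (?G (Suc n)) B f'" "\<And>x. x \<in> carrier (?G (Suc n)) \<Longrightarrow> q (f' x) = f x"
    by (rule free_projective[OF B D q surj f[unfolded res_module_def]]) (auto simp: res_module_def)
  \<comment> \<open>The connecting homomorphism: the coboundary of the lift \<open>f'\<close> dies
    in \<open>D\<close>, hence comes from \<open>A\<close>, and it is a cocycle there because
    \<open>j\<close> is injective.\<close>
  obtain g where g: "linear_map R (?G (Suc (Suc n))) A g"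
      "\<And>x. x \<in> carrier (?G (Suc (Suc n))) \<Longrightarrow> j (g x) = f' (?d (Suc n) x)"
    by (rule short_exact_kernel[OF assms(1) linear_map_compose[OF d f'(1)]]) (auto simp: f'(2) cocycle dc)
  have g0: "g (?d (Suc (Suc n)) x) = \<zero>\<^bsub>A\<^esub>" if x: "x \<in> carrier (?G (Suc (Suc (Suc n))))" for x
  proof (rule inj[OF linear_map_closed[OF g(1) dc[OF x]]])
    show "j (g (?d (Suc (Suc n)) x)) = \<zero>\<^bsub>B\<^esub>"
      using g(2)[OF dc[OF x]] res_diff_diff[OF assms(2,3) x] linear_map_zero[OF G B f'(1)] by simp
  qed
  obtain k where k: "linear_map R (?G (Suc n)) A k" "\<And>x. x \<in> carrier (?G (Suc (Suc n))) \<Longrightarrow> g x = k (?d (Suc n) x)"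
    by (rule ext_vanishingD[OF assms(4) g(1) g0]) blast+
  note jk = linear_map_compose[OF k(1) j]
  let ?u = "\<lambda>x. f' x \<ominus>\<^bsub>B\<^esub> j (k x)"
  have u: "linear_map R (?G (Suc n)) B ?u" by (rule linear_map_diff[OF G B f'(1) jk])
  have u0: "?u (?d (Suc n) x) = \<zero>\<^bsub>B\<^esub>" if x: "x \<in> carrier (?G (Suc (Suc n)))" for x
    using g(2)[OF x] k(2)[OF x] linear_map_closed[OF f'(1) dc[OF x]] by (simp add: B.M.minus_eq_zero_iff)
  obtain h where h: "linear_map R (?G n) B h" "\<And>x. x \<in> carrier (?G (Suc n)) \<Longrightarrow> ?u x = h (?d n x)"
    by (rule ext_vanishingD[OF assms(5) u u0]) blast+
  have "f x = q (h (?d n x))" if x: "x \<in> carrier (?G (Suc n))" for x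
  proof -
    have "q (j (k x)) = \<zero>\<^bsub>D\<^esub>" using im linear_map_closed[OF k(1) x] by blast
    then show ?thesis
      using h(2)[OF x, symmetric] f'(2)[OF x] linear_map_closed[OF f x]
        linear_map_minus[OF B D q linear_map_closed[OF f'(1) x] linear_map_closed[OF jk x]]
      by (simp add: D.M.minus_zero_right)
  qed
  then show "\<exists>h. linear_map R (?G n) D h \<and> (\<forall>x\<in>carrier (?G (Suc n)). f x = h (?d n x))"
    using linear_map_compose[OF h(1) q] by blast
qed

text \<open>Exactness of \<open>Hom(C, B) \<rightarrow> Hom(C, D) \<rightarrow> Ext^1(C, A)\<close>
  in the middle. A lift of \<open>f\<close> to the degree-zero module of the resolution is corrected
  by a map into \<open>A\<close> until it descends to \<open>C\<close>.\<close>

lemma ext_vanishing_lift: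
  assumes "short_exact R A B D j q" "module R C" "\<one>\<^bsub>R\<^esub> \<noteq> \<zero>\<^bsub>R\<^esub>" "ext_vanishing R C A"
    and "linear_map R C D f"
  obtains F where "linear_map R C B F" "\<And>c. c \<in> carrier C \<Longrightarrow> q (F c) = f c"
proof -
  let ?G = "res_module R C" and ?d = "res_diff R C" and ?e = "res_aug R C"
  have A: "module R A" and B: "module R B" and D: "module R D" and j: "linear_map R A B j" and q: "linear_map R B D q"
    and inj: "\<And>a. a \<in> carrier A \<Longrightarrow> j a = \<zero>\<^bsub>B\<^esub> \<Longrightarrow> a = \<zero>\<^bsub>A\<^esub>" and surj: "q ` carrier B = carrier D"
    and im: "j ` carrier A = {b \<in> carrier B. q b = \<zero>\<^bsub>D\<^esub>}"
    using assms(1) unfolding short_exact_def by auto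
  interpret B: module R B by (rule B)
  interpret D: module R D by (rule D)
  have G: "module R (?G n)" for n by (rule module_res[OF assms(2)])
  note d = linear_res_diff[OF assms(2,3)] and e = linear_res_aug[OF assms(2,3)]
  note dc = linear_map_closed[OF d]
  note fe = linear_map_compose[OF e assms(5)]
  obtain f' where f': "linear_map R (?G 0) B f'" "\<And>x. x \<in> carrier (?G 0) \<Longrightarrow> q (f' x) = f (?e x)"
    by (rule free_projective[OF B D q surj fe[unfolded res_module_def]]) (auto simp: res_module_def)
  have qf'd: "q (f' (?d 0 x)) = \<zero>\<^bsub>D\<^esub>" if x: "x \<in> carrier (?G (Suc 0))" for x
    using f'(2)[OF dc[OF x]] res_aug_diff[OF assms(2,3) x] linear_map_zero[OF assms(2) D assms(5)] by simp
  obtain g where g: "linear_map R (?G (Suc 0)) A g" "\<And>x. x \<in> carrier (?G (Suc 0)) \<Longrightarrow> j (g x) = f' (?d 0 x)"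
    by (rule short_exact_kernel[OF assms(1) linear_map_compose[OF d f'(1)] qf'd]) blast+
  have g0: "g (?d (Suc 0) x) = \<zero>\<^bsub>A\<^esub>" if x: "x \<in> carrier (?G (Suc (Suc 0)))" for x
  proof (rule inj[OF linear_map_closed[OF g(1) dc[OF x]]])
    show "j (g (?d (Suc 0) x)) = \<zero>\<^bsub>B\<^esub>"
      using g(2)[OF dc[OF x]] res_diff_diff[OF assms(2,3) x] linear_map_zero[OF G B f'(1)] by simp
  qed
  obtain k where k: "linear_map R (?G 0) A k" "\<And>x. x \<in> carrier (?G (Suc 0)) \<Longrightarrow> g x = k (?d 0 x)"
    by (rule ext_vanishingD[OF assms(4) g(1) g0]) blast+
  note jk = linear_map_compose[OF k(1) j]
  let ?u = "\<lambda>x. f' x \<ominus>\<^bsub>B\<^esub> j (k x)"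
  have u: "linear_map R (?G 0) B ?u" by (rule linear_map_diff[OF G B f'(1) jk])
  \<comment> \<open>The corrected lift vanishes on the image of the first differential, which is the
    kernel of the augmentation, so it factors through \<open>C\<close>.\<close>
  have u0: "?u x = \<zero>\<^bsub>B\<^esub>" if x: "x \<in> carrier (?G 0)" "?e x = \<zero>\<^bsub>C\<^esub>" for x
  proof -
    have "x \<in> ?d 0 ` carrier (?G (Suc 0))"
      using res_diff_image[OF assms(2,3), of 0] x by (simp add: res_cycles_def)
    then obtain w where w: "w \<in> carrier (?G (Suc 0))" "x = ?d 0 w" by blast
    then show ?thesis
      using g(2)[OF w(1)] k(2)[OF w(1)] linear_map_closed[OF f'(1) dc[OF w(1)]]
      by (simp add: B.M.minus_eq_zero_iff)
  qed
  obtain F where F: "linear_map R C B F" "\<And>x. x \<in> carrier (?G 0) \<Longrightarrow> F (?e x) = ?u x"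
    by (rule factor_through_surjection[OF G assms(2) B e res_aug_surj[OF assms(2,3)] u u0]) blast+
  show ?thesis
  proof (rule that[OF F(1)])
    fix c assume "c \<in> carrier C"
    then obtain x where x: "x \<in> carrier (?G 0)" "c = ?e x" using res_aug_surj[OF assms(2,3)] by blast
    have "q (j (k x)) = \<zero>\<^bsub>D\<^esub>" using im linear_map_closed[OF k(1) x(1)] by blast
    then show "q (F c) = f c"
      using F(2)[OF x(1)] f'(2)[OF x(1)] linear_map_closed[OF fe x(1)] x(2)
        linear_map_minus[OF B D q linear_map_closed[OF f'(1) x(1)] linear_map_closed[OF jk x(1)]]
      by (simp add: D.M.minus_zero_right)
  qed
qed

section \<open>The Auslander class\<close>

text \<open>The part of the Auslander class that the argument uses, with the factors of the tensor product
  in the order of the comparison map.\<close>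

definition auslander_core :: "('a, 'r) ring_scheme \<Rightarrow> ('a, 'c) module \<Rightarrow> ('a, 'x) module \<Rightarrow> bool" where
  "auslander_core R C X \<longleftrightarrow> module R X \<and>
     (\<forall>x\<in>carrier X. (\<forall>c\<in>carrier C. pure_tensor R X C x c = \<zero>\<^bsub>tensor_module R X C\<^esub>) \<longrightarrow> x = \<zero>\<^bsub>X\<^esub>) \<and>
     (\<forall>f. linear_map R C (tensor_module R X C) f \<longrightarrow>
       (\<exists>x\<in>carrier X. \<forall>c\<in>carrier C. f c = pure_tensor R X C x c)) \<and>
     ext_vanishing R C (tensor_module R X C)"

lemma auslander_coreI:
  assumes "module R X"
    and "\<And>x. x \<in> carrier X \<Longrightarrow> (\<And>c. c \<in> carrier C \<Longrightarrow> pure_tensor R X C x c = \<zero>\<^bsub>tensor_module R X C\<^esub>) \<Longrightarrow>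
      x = \<zero>\<^bsub>X\<^esub>"
    and "\<And>f. linear_map R C (tensor_module R X C) f \<Longrightarrow>
      \<exists>x\<in>carrier X. \<forall>c\<in>carrier C. f c = pure_tensor R X C x c"
    and "ext_vanishing R C (tensor_module R X C)"
  shows "auslander_core R C X"
  using assms unfolding auslander_core_def by blast

lemma auslander_coreD:
  assumes "auslander_core R C X"
  shows auslander_core_module: "module R X"
    and auslander_core_inj: "\<And>x. x \<in> carrier X \<Longrightarrow>
      (\<And>c. c \<in> carrier C \<Longrightarrow> pure_tensor R X C x c = \<zero>\<^bsub>tensor_module R X C\<^esub>) \<Longrightarrow> x = \<zero>\<^bsub>X\<^esub>"
    and auslander_core_surj: "\<And>f. linear_map R C (tensor_module R X C) f \<Longrightarrow>
      \<exists>x\<in>carrier X. \<forall>c\<in>carrier C. f c = pure_tensor R X C x c"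
    and auslander_core_ext: "ext_vanishing R C (tensor_module R X C)"
  using assms unfolding auslander_core_def by blast+

lemma tensor_swap:
  assumes "module R X" "module R C"
  obtains \<sigma> where "linear_map R (tensor_module R X C) (tensor_module R C X) \<sigma>"
    "\<And>x c. x \<in> carrier X \<Longrightarrow> c \<in> carrier C \<Longrightarrow> \<sigma> (pure_tensor R X C x c) = pure_tensor R C X c x"
proof -
  have "bilinear_map R X C (tensor_module R C X) (\<lambda>x c. pure_tensor R C X c x)"
    by (rule bilinear_mapI) (simp_all add: linear_pure_left[OF assms(2,1)] linear_pure_right[OF assms(2,1)])
  from tensor_universal[OF assms module_tensor[OF assms(2,1)] this] show ?thesis using that by blast
qed

text \<open>The Auslander class is written with \<open>C \<otimes> X\<close>, the core with
  \<open>X \<otimes> C\<close>. The swap \<open>\<sigma>\<close> carries the conditions over, and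
  its left inverse \<open>\<tau>\<close> brings maps and values back.\<close>

lemma auslander_core_of_class:
  assumes "module R C" "\<one>\<^bsub>R\<^esub> \<noteq> \<zero>\<^bsub>R\<^esub>" "auslander_class R C X"
  shows "auslander_core R C X"
proof -
  have X: "module R X" and ext: "\<forall>i\<ge>1. zero_module (Ext R i C (tensor_module R C X))"
    and iso: "module_iso R X (hom_module R C (tensor_module R C X)) (\<lambda>x. \<lambda>c\<in>carrier C. pure_tensor R C X c x)"
    using assms(3) unfolding auslander_class_def by auto
  let ?T = "tensor_module R X C" and ?T' = "tensor_module R C X"
  let ?\<eta> = "\<lambda>x. \<lambda>c\<in>carrier C. pure_tensor R C X c x"
  have T: "module R ?T" and T': "module R ?T'" using module_tensor assms(1) X by auto
  have H: "module R (hom_module R C ?T')" by (rule module_hom[OF assms(1) T'])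
  have \<eta>: "linear_map R X (hom_module R C ?T') ?\<eta>" "inj_on ?\<eta> (carrier X)"
      "?\<eta> ` carrier X = carrier (hom_module R C ?T')"
    using iso unfolding module_iso_def bij_betw_def by auto
  obtain \<sigma> where \<sigma>: "linear_map R ?T ?T' \<sigma>"
      "\<And>x c. x \<in> carrier X \<Longrightarrow> c \<in> carrier C \<Longrightarrow> \<sigma> (pure_tensor R X C x c) = pure_tensor R C X c x"
    by (rule tensor_swap[OF X assms(1)]) blast
  obtain \<tau> where \<tau>: "linear_map R ?T' ?T \<tau>"
      "\<And>x c. x \<in> carrier X \<Longrightarrow> c \<in> carrier C \<Longrightarrow> \<tau> (pure_tensor R C X c x) = pure_tensor R X C x c"
    by (rule tensor_swap[OF assms(1) X]) blast
  have \<tau>\<sigma>: "\<tau> (\<sigma> t) = t" if "t \<in> carrier ?T" for t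
    by (rule tensor_maps_eq[OF X assms(1) T linear_map_compose[OF \<sigma>(1) \<tau>(1)] linear_map_id _ that])
      (simp add: \<sigma>(2) \<tau>(2))
  show ?thesis
  proof (rule auslander_coreI[OF X])
    fix x assume x: "x \<in> carrier X" and zero: "\<And>c. c \<in> carrier C \<Longrightarrow> pure_tensor R X C x c = \<zero>\<^bsub>?T\<^esub>"
    have "?\<eta> x = \<zero>\<^bsub>hom_module R C ?T'\<^esub>"
    proof (rule hom_eqI[OF linear_map_closed[OF \<eta>(1) x] submodule_zero[OF submodule_carrier[OF H]]])
      fix c assume c: "c \<in> carrier C"
      then show "?\<eta> x c = \<zero>\<^bsub>hom_module R C ?T'\<^esub> c"
        using \<sigma>(2)[OF x c] zero[OF c] linear_map_zero[OF T T' \<sigma>(1)] by (simp add: hom_zero)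
    qed
    then show "x = \<zero>\<^bsub>X\<^esub>" by (rule inj_on_linear_map_zero[OF X H \<eta>(1,2) x])
  next
    fix f assume f: "linear_map R C ?T f"
    let ?f = "restrict (\<lambda>c. \<sigma> (f c)) (carrier C)"
    have "?f \<in> carrier (hom_module R C ?T')"
      by (rule restrict_in_hom[OF assms(1) linear_map_compose[OF f \<sigma>(1)]])
    then obtain x where x: "x \<in> carrier X" "?f = ?\<eta> x" using \<eta>(3) by blast
    have "f c = pure_tensor R X C x c" if c: "c \<in> carrier C" for c
    proof -
      have "\<sigma> (f c) = pure_tensor R C X c x" using fun_cong[OF x(2), of c] c by simp
      then have "\<tau> (\<sigma> (f c)) = pure_tensor R X C x c" using \<tau>(2)[OF x(1) c] by simp
      then show ?thesis using \<tau>\<sigma>[OF linear_map_closed[OF f c]] by simp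
    qed
    then show "\<exists>x\<in>carrier X. \<forall>c\<in>carrier C. f c = pure_tensor R X C x c" using x(1) by blast
  next
    show "ext_vanishing R C ?T"
      by (rule ext_vanishing_retract[OF T T' \<sigma>(1) \<tau>(1) \<tau>\<sigma> ext_vanishing_Ext[OF assms(1) T' assms(2) ext]])
  qed
qed

section \<open>The Auslander condition in short exact sequences\<close>

lemma short_exactD:
  assumes "short_exact R A B D j q"
  shows "module R A" "module R B" "module R D" "linear_map R A B j" "linear_map R B D q"
    "\<And>a. a \<in> carrier A \<Longrightarrow> j a = \<zero>\<^bsub>B\<^esub> \<Longrightarrow> a = \<zero>\<^bsub>A\<^esub>" "q ` carrier B = carrier D"
    "j ` carrier A = {b \<in> carrier B. q b = \<zero>\<^bsub>D\<^esub>}"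
  using assms unfolding short_exact_def by auto

text \<open>Right exactness gives everything but injectivity on the left. That is left as a
  hypothesis because its proof differs: from the criterion directly for cocycles in cochains, by a
  detour through the cochains for coboundaries in cocycles.\<close>

lemma short_exact_tensor:
  assumes "short_exact R A B D j q" "module R C"
    and "\<And>t. t \<in> carrier (tensor_module R A C) \<Longrightarrow> tmap R A B C j t = \<zero>\<^bsub>tensor_module R B C\<^esub> \<Longrightarrow>
      t = \<zero>\<^bsub>tensor_module R A C\<^esub>"
  shows "short_exact R (tensor_module R A C) (tensor_module R B C) (tensor_module R D C)
    (tmap R A B C j) (tmap R B D C q)"
proof -
  note E = short_exactD[OF assms(1)]
  note T = module_tensor[OF E(1) assms(2)] module_tensor[OF E(2) assms(2)] module_tensor[OF E(3) assms(2)]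
  note lj = linear_tmap[OF E(1,2) assms(2) E(4)] and lq = linear_tmap[OF E(2,3) assms(2) E(5)]
  have zero: "tmap R B D C q (tmap R A B C j t) = \<zero>\<^bsub>tensor_module R D C\<^esub>" if t: "t \<in> carrier (tensor_module R A C)" for t
  proof (rule tensor_maps_eq[OF E(1) assms(2) T(3) linear_map_compose[OF lj lq] linear_map_const_zero[OF T(3)] _ t])
    fix x c assume x: "x \<in> carrier A" and c: "c \<in> carrier C"
    have "q (j x) = \<zero>\<^bsub>D\<^esub>" using E(8) x by blast
    then show "tmap R B D C q (tmap R A B C j (pure_tensor R A C x c)) = \<zero>\<^bsub>tensor_module R D C\<^esub>"
      using tmap_pure[OF E(1,2) assms(2) E(4) x c]
        tmap_pure[OF E(2,3) assms(2) E(5) linear_map_closed[OF E(4) x] c]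
        pure_tensor_zero_left[OF E(3) assms(2) c] by simp
  qed
  have "tmap R A B C j ` carrier (tensor_module R A C) =
      {t \<in> carrier (tensor_module R B C). tmap R B D C q t = \<zero>\<^bsub>tensor_module R D C\<^esub>}"
    using zero linear_map_closed[OF lj] tensor_right_exact[OF E(1,2,3) assms(2) E(4,5,7,8)] by blast
  then show ?thesis
    unfolding short_exact_def using T lj lq assms(3) tmap_surj[OF E(2,3) assms(2) E(5,7)] by blast
qed

text \<open>\<open>faithful\<close> is the source of the nonzero maps out of \<open>C\<close>, and
  \<open>one_neq_zero\<close> the source of the chosen resolutions, through the marks of their
  encoding.\<close>

locale faithful_over_noetherian =
  fixes R :: "('a, 'r) ring_scheme" and C :: "('a, 'c) module"
  assumes noetherian: "noetherian_ring R" and fg: "fg_module R C" and one_neq_zero: "\<one>\<^bsub>R\<^esub> \<noteq> \<zero>\<^bsub>R\<^esub>"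
    and faithful: "\<And>r. r \<in> carrier R \<Longrightarrow> (\<And>c. c \<in> carrier C \<Longrightarrow> r \<odot>\<^bsub>C\<^esub> c = \<zero>\<^bsub>C\<^esub>) \<Longrightarrow> r = \<zero>\<^bsub>R\<^esub>"
begin

lemma module_C: "module R C"
  using fg by (simp add: fg_module_def)

lemma cring: "cring R"
  using module_C by (simp add: module_def)

text \<open>A nonzero \<open>t\<close> in the kernel would be hit by a nonzero map from \<open>C\<close> into the kernel. That map has the
  form \<open>c \<mapsto> y \<otimes> c\<close>, and \<open>\<iota> y \<otimes> c = 0\<close> for all \<open>c\<close> forces \<open>y = 0\<close>.\<close>

lemma tmap_injective:
  fixes Y :: "('a, 'y) module" and Y' :: "('a, 'z) module"
  assumes "auslander_core R C Y" "auslander_core R C Y'" "linear_map R Y Y' \<iota>"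
    and inj: "\<And>y. y \<in> carrier Y \<Longrightarrow> \<iota> y = \<zero>\<^bsub>Y'\<^esub> \<Longrightarrow> y = \<zero>\<^bsub>Y\<^esub>"
    and t: "t \<in> carrier (tensor_module R Y C)" "tmap R Y Y' C \<iota> t = \<zero>\<^bsub>tensor_module R Y' C\<^esub>"
  shows "t = \<zero>\<^bsub>tensor_module R Y C\<^esub>"
proof (rule ccontr)
  assume nz: "t \<noteq> \<zero>\<^bsub>tensor_module R Y C\<^esub>"
  note Y = auslander_core_module[OF assms(1)] and Y' = auslander_core_module[OF assms(2)]
  note T = module_tensor[OF Y module_C] and T' = module_tensor[OF Y' module_C]
  note lin = linear_tmap[OF Y Y' module_C assms(3)]
  obtain f where f: "linear_map R C (tensor_module R Y C) f"
      "\<And>c. c \<in> carrier C \<Longrightarrow> \<exists>r\<in>carrier R. f c = r \<odot>\<^bsub>tensor_module R Y C\<^esub> t"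
      "\<exists>c\<in>carrier C. f c \<noteq> \<zero>\<^bsub>tensor_module R Y C\<^esub>"
    by (rule exists_nonzero_map[OF noetherian fg T faithful t(1) nz]) blast+
  obtain y where y: "y \<in> carrier Y" "\<And>c. c \<in> carrier C \<Longrightarrow> f c = pure_tensor R Y C y c"
    using auslander_core_surj[OF assms(1) f(1)] by blast
  have "\<iota> y = \<zero>\<^bsub>Y'\<^esub>"
  proof (rule auslander_core_inj[OF assms(2) linear_map_closed[OF assms(3) y(1)]])
    fix c assume c: "c \<in> carrier C"
    obtain r where r: "r \<in> carrier R" "f c = r \<odot>\<^bsub>tensor_module R Y C\<^esub> t" using f(2)[OF c] by blast
    have "pure_tensor R Y' C (\<iota> y) c = tmap R Y Y' C \<iota> (f c)"
      using tmap_pure[OF Y Y' module_C assms(3) y(1) c] y(2)[OF c] by simp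
    also have "\<dots> = r \<odot>\<^bsub>tensor_module R Y' C\<^esub> \<zero>\<^bsub>tensor_module R Y' C\<^esub>"
      unfolding r(2) linear_map_smult[OF lin r(1) t(1)] t(2) ..
    also have "\<dots> = \<zero>\<^bsub>tensor_module R Y' C\<^esub>" by (rule module.smult_r_null[OF T' r(1)])
    finally show "pure_tensor R Y' C (\<iota> y) c = \<zero>\<^bsub>tensor_module R Y' C\<^esub>" .
  qed
  then have "y = \<zero>\<^bsub>Y\<^esub>" by (rule inj[OF y(1)])
  then show False using f(3) y(2) pure_tensor_zero_left[OF Y module_C] by auto
qed

text \<open>The five lemma for \<open>X \<rightarrow> Hom(C, X \<otimes> C)\<close>, chased by hand,
  together with the extension property of vanishing Ext. Injectivity on the left is a hypothesis
  since \<open>tmap_injective\<close> would presuppose the conclusion for \<open>Z\<close>.\<close>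

lemma auslander_core_extension:
  fixes B :: "('a, 'x) module" and Z :: "('a, 'y) module" and H :: "('a, 'z) module"
  assumes ses: "short_exact R B Z H i p" and "auslander_core R C B" "auslander_core R C H"
    and inj: "\<And>t. t \<in> carrier (tensor_module R B C) \<Longrightarrow> tmap R B Z C i t = \<zero>\<^bsub>tensor_module R Z C\<^esub> \<Longrightarrow>
      t = \<zero>\<^bsub>tensor_module R B C\<^esub>"
  shows "auslander_core R C Z"
proof -
  note E = short_exactD[OF ses]
  note ses' = short_exact_tensor[OF ses module_C inj]
  note T = module_tensor[OF E(1) module_C] module_tensor[OF E(2) module_C] module_tensor[OF E(3) module_C]
  note pi = tmap_pure[OF E(1,2) module_C E(4)] and pp = tmap_pure[OF E(2,3) module_C E(5)]
  note li = linear_tmap[OF E(1,2) module_C E(4)] and lp = linear_tmap[OF E(2,3) module_C E(5)]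
  interpret Z: module R Z by (rule E(2))
  interpret TZ: module R "tensor_module R Z C" by (rule T(2))
  interpret TH: module R "tensor_module R H C" by (rule T(3))
  show ?thesis
  proof (rule auslander_coreI[OF E(2)])
    fix z assume z: "z \<in> carrier Z" and zero: "\<And>c. c \<in> carrier C \<Longrightarrow> pure_tensor R Z C z c = \<zero>\<^bsub>tensor_module R Z C\<^esub>"
    have "p z = \<zero>\<^bsub>H\<^esub>"
      using pp[OF z] zero linear_map_zero[OF T(2,3) lp]
      by (intro auslander_core_inj[OF assms(3) linear_map_closed[OF E(5) z]]) simp
    then obtain b where b: "b \<in> carrier B" "z = i b" using E(8) z by blast
    have "b = \<zero>\<^bsub>B\<^esub>"
    proof (rule auslander_core_inj[OF assms(2) b(1)])
      fix c assume c: "c \<in> carrier C"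
      show "pure_tensor R B C b c = \<zero>\<^bsub>tensor_module R B C\<^esub>"
        using pi[OF b(1) c] zero[OF c] b(2) by (intro inj pure_tensor_closed[OF E(1) module_C b(1) c]) simp
    qed
    then show "z = \<zero>\<^bsub>Z\<^esub>" using b(2) linear_map_zero[OF E(1,2,4)] by simp
  next
    fix f assume f: "linear_map R C (tensor_module R Z C) f"
    obtain h where h: "h \<in> carrier H" "\<And>c. c \<in> carrier C \<Longrightarrow> tmap R Z H C p (f c) = pure_tensor R H C h c"
      using auslander_core_surj[OF assms(3) linear_map_compose[OF f lp]] by blast
    obtain z where z: "z \<in> carrier Z" "h = p z" using E(7) h(1) by blast
    note pz = linear_pure_right[OF E(2) module_C z(1)]
    \<comment> \<open>Subtracting \<open>z \<otimes> c\<close> kills the image in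
      \<open>H \<otimes> C\<close>. The rest comes from \<open>B \<otimes> C\<close> and is
      represented by some \<open>b\<close>, so \<open>z + i b\<close> represents
      \<open>f\<close>.\<close>
    let ?g = "\<lambda>c. f c \<ominus>\<^bsub>tensor_module R Z C\<^esub> pure_tensor R Z C z c"
    have g: "linear_map R C (tensor_module R Z C) ?g" by (rule linear_map_diff[OF module_C T(2) f pz])
    have g0: "tmap R Z H C p (?g c) = \<zero>\<^bsub>tensor_module R H C\<^esub>" if c: "c \<in> carrier C" for c
      using linear_map_minus[OF T(2,3) lp linear_map_closed[OF f c] linear_map_closed[OF pz c]]
        h(2)[OF c] pp[OF z(1) c] z(2) linear_map_closed[OF lp linear_map_closed[OF f c]]
      by (simp add: TH.M.minus_eq_zero_iff)
    obtain g' where g': "linear_map R C (tensor_module R B C) g'" "\<And>c. c \<in> carrier C \<Longrightarrow> tmap R B Z C i (g' c) = ?g c"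
      by (rule short_exact_kernel[OF ses' g g0]) blast+
    obtain b where b: "b \<in> carrier B" "\<And>c. c \<in> carrier C \<Longrightarrow> g' c = pure_tensor R B C b c"
      using auslander_core_surj[OF assms(2) g'(1)] by blast
    note ib = linear_map_closed[OF E(4) b(1)]
    have "f c = pure_tensor R Z C (z \<oplus>\<^bsub>Z\<^esub> i b) c" if c: "c \<in> carrier C" for c
    proof -
      have "?g c = pure_tensor R Z C (i b) c" using g'(2)[OF c] b(2)[OF c] pi[OF b(1) c] by simp
      then have "f c = pure_tensor R Z C z c \<oplus>\<^bsub>tensor_module R Z C\<^esub> pure_tensor R Z C (i b) c"
        using linear_map_closed[OF f c] linear_map_closed[OF pz c] pure_tensor_closed[OF E(2) module_C ib c]
        by (metis TZ.M.a_comm TZ.M.add.inv_solve_right' a_minus_def)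
      then show ?thesis using linear_map_add[OF linear_pure_left[OF E(2) module_C c] z(1) ib] by simp
    qed
    then show "\<exists>x\<in>carrier Z. \<forall>c\<in>carrier C. f c = pure_tensor R Z C x c"
      using Z.M.a_closed[OF z(1) ib] by blast
  next
    show "ext_vanishing R C (tensor_module R Z C)"
      by (rule ext_vanishing_extension[OF ses' module_C one_neq_zero auslander_core_ext[OF assms(2)]
            auslander_core_ext[OF assms(3)]])
  qed
qed

text \<open>Here both modules on the left satisfy the condition, so \<open>tmap_injective\<close>
  makes the tensored sequence exact. Surjectivity of the natural map for \<open>B\<close> uses
  \<open>Ext^1(C, Z \<otimes> C) = 0\<close>, and Ext vanishes for \<open>B \<otimes> C\<close> by
  the shift from \<open>D\<close> to \<open>A\<close> in the long exact sequence.\<close>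

lemma auslander_core_cokernel:
  fixes Z :: "('a, 'x) module" and X :: "('a, 'y) module" and B :: "('a, 'z) module"
  assumes ses: "short_exact R Z X B i p" and "auslander_core R C Z" "auslander_core R C X"
  shows "auslander_core R C B"
proof -
  note E = short_exactD[OF ses]
  note inj = tmap_injective[OF assms(2,3) E(4,6)]
  note ses' = short_exact_tensor[OF ses module_C inj]
  note T = module_tensor[OF E(1) module_C] module_tensor[OF E(2) module_C] module_tensor[OF E(3) module_C]
  note pi = tmap_pure[OF E(1,2) module_C E(4)] and pp = tmap_pure[OF E(2,3) module_C E(5)]
  note lp = linear_tmap[OF E(2,3) module_C E(5)]
  interpret X: module R X by (rule E(2))
  interpret TX: module R "tensor_module R X C" by (rule T(2))
  show ?thesis
  proof (rule auslander_coreI[OF E(3)])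
    fix b assume b: "b \<in> carrier B" and zero: "\<And>c. c \<in> carrier C \<Longrightarrow> pure_tensor R B C b c = \<zero>\<^bsub>tensor_module R B C\<^esub>"
    obtain x where x: "x \<in> carrier X" "b = p x" using b E(7) by blast
    note px = linear_pure_right[OF E(2) module_C x(1)]
    have px0: "tmap R X B C p (pure_tensor R X C x c) = \<zero>\<^bsub>tensor_module R B C\<^esub>" if c: "c \<in> carrier C" for c
      using pp[OF x(1) c] zero[OF c] x(2) by simp
    \<comment> \<open>If \<open>p x \<otimes> c\<close> vanishes for all \<open>c\<close>, then
      \<open>c \<mapsto> x \<otimes> c\<close> factors through \<open>Z \<otimes> C\<close> and is
      represented there by some \<open>z\<close>. By injectivity for \<open>X\<close>,
      \<open>x\<close> is the image of \<open>z\<close>, so \<open>p x\<close> is zero.\<close>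
    obtain g where g: "linear_map R C (tensor_module R Z C) g"
        "\<And>c. c \<in> carrier C \<Longrightarrow> tmap R Z X C i (g c) = pure_tensor R X C x c"
      by (rule short_exact_kernel[OF ses' px px0]) blast+
    obtain z where z: "z \<in> carrier Z" "\<And>c. c \<in> carrier C \<Longrightarrow> g c = pure_tensor R Z C z c"
      using auslander_core_surj[OF assms(2) g(1)] by blast
    note iz = linear_map_closed[OF E(4) z(1)]
    have "x \<ominus>\<^bsub>X\<^esub> i z = \<zero>\<^bsub>X\<^esub>"
    proof (rule auslander_core_inj[OF assms(3) X.M.minus_closed[OF x(1) iz]])
      fix c assume c: "c \<in> carrier C"
      have "pure_tensor R X C (i z) c = pure_tensor R X C x c" using g(2)[OF c] z(2)[OF c] pi[OF z(1) c] by simp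
      then show "pure_tensor R X C (x \<ominus>\<^bsub>X\<^esub> i z) c = \<zero>\<^bsub>tensor_module R X C\<^esub>"
        using linear_map_minus[OF E(2) T(2) linear_pure_left[OF E(2) module_C c] x(1) iz]
          pure_tensor_closed[OF E(2) module_C x(1) c]
        by (simp add: TX.M.minus_eq_zero_iff)
    qed
    then have "x \<in> i ` carrier Z" using X.M.minus_eq_zero_iff[OF x(1) iz] z(1) by blast
    then show "b = \<zero>\<^bsub>B\<^esub>" using E(8) x(2) by blast
  next
    fix f assume f: "linear_map R C (tensor_module R B C) f"
    \<comment> \<open>Only a map into \<open>X \<otimes> C\<close> is known to be represented by an
      element, so \<open>f\<close> is lifted first; the obstruction lies in
      \<open>Ext^1(C, Z \<otimes> C)\<close>.\<close>
    obtain F where F: "linear_map R C (tensor_module R X C) F" "\<And>c. c \<in> carrier C \<Longrightarrow> tmap R X B C p (F c) = f c"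
      by (rule ext_vanishing_lift[OF ses' module_C one_neq_zero auslander_core_ext[OF assms(2)] f]) blast+
    obtain x where x: "x \<in> carrier X" "\<And>c. c \<in> carrier C \<Longrightarrow> F c = pure_tensor R X C x c"
      using auslander_core_surj[OF assms(3) F(1)] by blast
    have "f c = pure_tensor R B C (p x) c" if c: "c \<in> carrier C" for c
      using F(2)[OF c] x(2)[OF c] pp[OF x(1) c] by simp
    then show "\<exists>b\<in>carrier B. \<forall>c\<in>carrier C. f c = pure_tensor R B C b c"
      using linear_map_closed[OF E(5) x(1)] by blast
  next
    show "ext_vanishing R C (tensor_module R B C)"
      by (rule ext_vanishing_cokernel[OF ses' module_C one_neq_zero auslander_core_ext[OF assms(2)]
            auslander_core_ext[OF assms(3)]])
  qed
qed

end

section \<open>Homomorphisms from free modules\<close>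

text \<open>Tensor evaluation on a single cochain module. \<open>Ext_tensor_map\<close> is what it
  induces on cohomology classes.\<close>

definition hom_tensor ::
    "('a, 'r) ring_scheme \<Rightarrow> ('a, 'm) module \<Rightarrow> ('a, 'n) module \<Rightarrow> ('a, 'c) module \<Rightarrow>
     (('m \<Rightarrow> 'n) \<times> 'c \<Rightarrow> 'a) set \<Rightarrow> 'm \<Rightarrow> ('n \<times> 'c \<Rightarrow> 'a) set" where
  "hom_tensor R F N C = tensor_lift R (hom_module R F N) C (hom_module R F (tensor_module R N C))
     (\<lambda>\<alpha> c. \<lambda>v\<in>carrier F. pure_tensor R N C (\<alpha> v) c)"

lemma bilinear_hom_tensor:
  assumes "module R F" "module R N" "module R C"
  shows "bilinear_map R (hom_module R F N) C (hom_module R F (tensor_module R N C))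
    (\<lambda>\<alpha> c. \<lambda>v\<in>carrier F. pure_tensor R N C (\<alpha> v) c)"
proof (rule bilinear_mapI)
  note left = linear_pure_left[OF assms(2,3)] and right = linear_pure_right[OF assms(2,3)]
  fix \<alpha> assume "\<alpha> \<in> carrier (hom_module R F N)"
  then have \<alpha>: "linear_map R F N \<alpha>" by (rule hom_linear)
  show "linear_map R C (hom_module R F (tensor_module R N C)) (\<lambda>c. \<lambda>v\<in>carrier F. pure_tensor R N C (\<alpha> v) c)"
    by (rule linear_map_into_homI[OF assms(1) linear_map_compose[OF \<alpha> left]])
      (simp_all add: linear_map_add[OF right] linear_map_smult[OF right] linear_map_closed[OF \<alpha>])
next
  note left = linear_pure_left[OF assms(2,3)]
  fix c assume c: "c \<in> carrier C"
  show "linear_map R (hom_module R F N) (hom_module R F (tensor_module R N C))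
      (\<lambda>\<alpha>. \<lambda>v\<in>carrier F. pure_tensor R N C (\<alpha> v) c)"
  proof (rule linear_map_into_homI[OF assms(1)])
    fix \<alpha> assume "\<alpha> \<in> carrier (hom_module R F N)"
    then show "linear_map R F (tensor_module R N C) (\<lambda>v. pure_tensor R N C (\<alpha> v) c)"
      by (intro linear_map_compose[OF hom_linear left[OF c]])
  next
    fix \<alpha> \<beta> v assume "\<alpha> \<in> carrier (hom_module R F N)" "\<beta> \<in> carrier (hom_module R F N)" "v \<in> carrier F"
    then show "pure_tensor R N C ((\<alpha> \<oplus>\<^bsub>hom_module R F N\<^esub> \<beta>) v) c =
        pure_tensor R N C (\<alpha> v) c \<oplus>\<^bsub>tensor_module R N C\<^esub> pure_tensor R N C (\<beta> v) c"
      by (simp add: hom_add linear_map_add[OF left[OF c]] linear_map_closed[OF hom_linear])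
  next
    fix r \<alpha> v assume "r \<in> carrier R" "\<alpha> \<in> carrier (hom_module R F N)" "v \<in> carrier F"
    then show "pure_tensor R N C ((r \<odot>\<^bsub>hom_module R F N\<^esub> \<alpha>) v) c =
        r \<odot>\<^bsub>tensor_module R N C\<^esub> pure_tensor R N C (\<alpha> v) c"
      by (simp add: hom_smult linear_map_smult[OF left[OF c]] linear_map_closed[OF hom_linear])
  qed
qed

lemma linear_hom_tensor:
  assumes "module R F" "module R N" "module R C"
  shows "linear_map R (tensor_module R (hom_module R F N) C) (hom_module R F (tensor_module R N C))
    (hom_tensor R F N C)"
  unfolding hom_tensor_def
  by (rule linear_tensor_lift[OF module_hom[OF assms(1,2)] assms(3) module_hom[OF assms(1) module_tensor[OF assms(2,3)]]
        bilinear_hom_tensor[OF assms]])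

lemma hom_tensor_pure:
  assumes "module R F" "module R N" "module R C" "\<alpha> \<in> carrier (hom_module R F N)" "c \<in> carrier C"
  shows "hom_tensor R F N C (pure_tensor R (hom_module R F N) C \<alpha> c) = (\<lambda>v\<in>carrier F. pure_tensor R N C (\<alpha> v) c)"
  unfolding hom_tensor_def
  by (rule tensor_lift_pure[OF module_hom[OF assms(1,2)] assms(3) module_hom[OF assms(1) module_tensor[OF assms(2,3)]]
        bilinear_hom_tensor[OF assms(1-3)] assms(4,5)])

context faithful_over_noetherian
begin

text \<open>With \<open>Hom(F, N) = N^I\<close> this says that tensoring with a finitely presented
  \<open>C\<close> commutes with arbitrary powers. Finitely many generators give surjectivity: the
  values at all basis elements are sums over the same \<open>S\<close>, so their coefficients
  assemble to one map for each \<open>s\<close>. Finitely many relations give injectivity by the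
  same device.\<close>

lemma hom_tensor_free_bij:
  fixes N :: "('a, 'n) module" and I :: "'i set"
  assumes N: "module R N"
  shows "bij_betw (hom_tensor R (free_module R I) N C)
    (carrier (tensor_module R (hom_module R (free_module R I) N) C))
    (carrier (hom_module R (free_module R I) (tensor_module R N C)))"
proof -
  let ?F = "free_module R I"
  let ?X = "hom_module R ?F N" and ?T = "tensor_module R N C"
  let ?TX = "tensor_module R ?X C" and ?Y = "hom_module R ?F ?T"
  let ?\<tau> = "hom_tensor R ?F N C"
  have F: "module R ?F" by (rule module_free[OF cring])
  have X: "module R ?X" by (rule module_hom[OF F N])
  have T: "module R ?T" by (rule module_tensor[OF N module_C])
  have TX: "module R ?TX" by (rule module_tensor[OF X module_C])
  have Y: "module R ?Y" by (rule module_hom[OF F T])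
  interpret N: module R N by (rule N)
  interpret X: module R ?X by (rule X)
  interpret T: module R ?T by (rule T)
  interpret TX: module R ?TX by (rule TX)
  have lin: "linear_map R ?TX ?Y ?\<tau>" by (rule linear_hom_tensor[OF F N module_C])
  have gen: "free_gen R i \<in> carrier ?F" if "i \<in> I" for i by (rule free_gen_closed[OF cring that])
  obtain S where S: "finite S" "S \<subseteq> carrier C" "module_span R C S = carrier C"
    using fg unfolding fg_module_def by blast
  have S_mem: "s \<in> carrier C" if "s \<in> S" for s using S(2) that by blast
  have id: "(\<lambda>s. s) \<in> S \<rightarrow> carrier C" using S(2) by auto
  let ?\<pi> = "free_lift R C (\<lambda>s. s)"
  let ?K = "{v \<in> carrier (free_module R S). ?\<pi> v = \<zero>\<^bsub>C\<^esub>}"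
  have K: "submodule ?K R (free_module R S)"
    by (rule submodule_kernel[OF module_free[OF cring] module_C linear_map_free_lift[OF module_C id]])
  obtain P where "finite P \<and> P \<subseteq> ?K \<and> (\<forall>U. submodule U R (free_module R S) \<longrightarrow> P \<subseteq> U \<longrightarrow> ?K \<subseteq> U)"
    using submodule_free_fg[OF cring noetherian S(1) K] ..
  then have P: "finite P" "P \<subseteq> ?K" "\<And>U. submodule U R (free_module R S) \<Longrightarrow> P \<subseteq> U \<Longrightarrow> ?K \<subseteq> U"
    by simp_all
  have \<rho>c: "\<rho> s \<in> carrier R" if "\<rho> \<in> P" for \<rho> s using P(2) that by (auto simp: carrier_free subset_iff)
  have \<tau>_sum: "?\<tau> (\<Oplus>\<^bsub>?TX\<^esub>s\<in>S. pure_tensor R ?X C (\<alpha> s) s) v = (\<Oplus>\<^bsub>?T\<^esub>s\<in>S. pure_tensor R N C (\<alpha> s v) s)"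
    if \<alpha>: "\<alpha> \<in> S \<rightarrow> carrier ?X" and v: "v \<in> carrier ?F" for \<alpha> v
  proof -
    have pc: "(\<lambda>s. pure_tensor R ?X C (\<alpha> s) s) \<in> S \<rightarrow> carrier ?TX"
      using \<alpha> S_mem pure_tensor_closed[OF X module_C] by auto
    have "?\<tau> (\<Oplus>\<^bsub>?TX\<^esub>s\<in>S. pure_tensor R ?X C (\<alpha> s) s) v = (\<Oplus>\<^bsub>?T\<^esub>s\<in>S. ?\<tau> (pure_tensor R ?X C (\<alpha> s) s) v)"
      by (rule linear_map_finsum[OF TX T linear_map_compose[OF lin linear_map_eval[OF v]] S(1) pc])
    also have "\<dots> = (\<Oplus>\<^bsub>?T\<^esub>s\<in>S. pure_tensor R N C (\<alpha> s v) s)"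
    proof (rule T.M.finsum_cong'[OF refl])
      show "(\<lambda>s. pure_tensor R N C (\<alpha> s v) s) \<in> S \<rightarrow> carrier ?T"
      proof (rule Pi_I)
        fix s assume s: "s \<in> S"
        then have "\<alpha> s \<in> carrier ?X" using \<alpha> by blast
        from pure_tensor_closed[OF N module_C linear_map_closed[OF hom_linear[OF this] v] S_mem[OF s]]
        show "pure_tensor R N C (\<alpha> s v) s \<in> carrier ?T" .
      qed
      fix s assume s: "s \<in> S"
      then have "\<alpha> s \<in> carrier ?X" using \<alpha> by blast
      from hom_tensor_pure[OF F N module_C this S_mem[OF s]] v
      show "?\<tau> (pure_tensor R ?X C (\<alpha> s) s) v = pure_tensor R N C (\<alpha> s v) s" by simp
    qed
    finally show ?thesis .
  qed
  have lift: "\<exists>\<alpha>\<in>carrier ?X. \<forall>i\<in>I. \<alpha> (free_gen R i) = n i" if n: "\<And>i. i \<in> I \<Longrightarrow> n i \<in> carrier N" for n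
  proof (rule bexI)
    have n': "n \<in> I \<rightarrow> carrier N" using n by blast
    show "restrict (free_lift R N n) (carrier ?F) \<in> carrier ?X"
      by (rule restrict_in_hom[OF F linear_map_free_lift[OF N n']])
    show "\<forall>i\<in>I. restrict (free_lift R N n) (carrier ?F) (free_gen R i) = n i"
      using free_lift_gen[OF N n'] gen by simp
  qed
  have "inj_on ?\<tau> (carrier ?TX)"
  proof (rule linear_map_inj_onI[OF TX Y lin])
    fix t assume t: "t \<in> carrier ?TX" "?\<tau> t = \<zero>\<^bsub>?Y\<^esub>"
    obtain \<alpha> where \<alpha>: "\<alpha> \<in> S \<rightarrow> carrier ?X" "t = (\<Oplus>\<^bsub>?TX\<^esub>s\<in>S. pure_tensor R ?X C (\<alpha> s) s)"
      using tensor_sum_form[OF X module_C S t(1)] by blast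
    have "\<exists>z\<in>P \<rightarrow> carrier N. \<forall>s\<in>S. \<alpha> s (free_gen R i) = (\<Oplus>\<^bsub>N\<^esub>\<rho>\<in>P. \<rho> s \<odot>\<^bsub>N\<^esub> z \<rho>)" if i: "i \<in> I" for i
    proof (rule tensor_zero_criterion[OF N module_C S P(1) _ P(3)])
      show "(\<lambda>s. \<alpha> s (free_gen R i)) \<in> S \<rightarrow> carrier N"
      proof (rule Pi_I)
        fix s assume "s \<in> S"
        then have "\<alpha> s \<in> carrier ?X" using \<alpha>(1) by blast
        from linear_map_closed[OF hom_linear[OF this] gen[OF i]] show "\<alpha> s (free_gen R i) \<in> carrier N" .
      qed
      show "(\<Oplus>\<^bsub>?T\<^esub>s\<in>S. pure_tensor R N C (\<alpha> s (free_gen R i)) s) = \<zero>\<^bsub>?T\<^esub>"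
        using \<tau>_sum[OF \<alpha>(1) gen[OF i]] t(2) hom_zero[OF gen[OF i], of R ?T] unfolding \<alpha>(2)[symmetric] by simp
    qed (use P(2) in auto)
    \<comment> \<open>For each basis element separately, the vanishing sum in
      \<open>N \<otimes> C\<close> is explained by coefficients of the relations
      \<open>P\<close>.\<close>
    then have "\<forall>i\<in>I. \<exists>z. z \<in> P \<rightarrow> carrier N \<and>
        (\<forall>s\<in>S. \<alpha> s (free_gen R i) = (\<Oplus>\<^bsub>N\<^esub>\<rho>\<in>P. \<rho> s \<odot>\<^bsub>N\<^esub> z \<rho>))" by blast
    from bchoice[OF this] obtain z where "\<forall>i\<in>I. z i \<in> P \<rightarrow> carrier N \<and>
        (\<forall>s\<in>S. \<alpha> s (free_gen R i) = (\<Oplus>\<^bsub>N\<^esub>\<rho>\<in>P. \<rho> s \<odot>\<^bsub>N\<^esub> z i \<rho>))" ..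
    then have z: "\<And>i. i \<in> I \<Longrightarrow> z i \<in> P \<rightarrow> carrier N"
        "\<And>i s. i \<in> I \<Longrightarrow> s \<in> S \<Longrightarrow> \<alpha> s (free_gen R i) = (\<Oplus>\<^bsub>N\<^esub>\<rho>\<in>P. \<rho> s \<odot>\<^bsub>N\<^esub> z i \<rho>)"
      by simp_all
    \<comment> \<open>The coefficients at a fixed relation, for all basis elements at once, define
      one map on the free module. Since \<open>P\<close> is finite, this expresses the
      \<open>\<alpha> s\<close> by relations inside \<open>?X\<close> itself, and
      \<open>tensor_relation_zero\<close> applies there.\<close>
    have "\<exists>\<beta>\<in>carrier ?X. \<forall>i\<in>I. \<beta> (free_gen R i) = z i \<rho>" if "\<rho> \<in> P" for \<rho>
      by (rule lift) (use z(1) that in blast)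
    then obtain \<zeta> where \<zeta>: "\<And>\<rho>. \<rho> \<in> P \<Longrightarrow> \<zeta> \<rho> \<in> carrier ?X"
        "\<And>\<rho> i. \<rho> \<in> P \<Longrightarrow> i \<in> I \<Longrightarrow> \<zeta> \<rho> (free_gen R i) = z i \<rho>"
      by metis
    have \<zeta>c: "(\<lambda>\<rho>. \<rho> s \<odot>\<^bsub>?X\<^esub> \<zeta> \<rho>) \<in> P \<rightarrow> carrier ?X" for s using \<zeta>(1) \<rho>c by auto
    have \<alpha>_eq: "\<alpha> s = (\<Oplus>\<^bsub>?X\<^esub>\<rho>\<in>P. \<rho> s \<odot>\<^bsub>?X\<^esub> \<zeta> \<rho>)" if s: "s \<in> S" for s
    proof (rule hom_free_eqI[OF cring N])
      show "\<alpha> s \<in> carrier ?X" using \<alpha>(1) s by blast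
      show "(\<Oplus>\<^bsub>?X\<^esub>\<rho>\<in>P. \<rho> s \<odot>\<^bsub>?X\<^esub> \<zeta> \<rho>) \<in> carrier ?X" by (rule X.M.finsum_closed[OF \<zeta>c])
      fix i assume i: "i \<in> I"
      have "(\<Oplus>\<^bsub>?X\<^esub>\<rho>\<in>P. \<rho> s \<odot>\<^bsub>?X\<^esub> \<zeta> \<rho>) (free_gen R i) = (\<Oplus>\<^bsub>N\<^esub>\<rho>\<in>P. (\<rho> s \<odot>\<^bsub>?X\<^esub> \<zeta> \<rho>) (free_gen R i))"
        by (rule hom_finsum[OF F N P(1) \<zeta>c gen[OF i]])
      also have "\<dots> = (\<Oplus>\<^bsub>N\<^esub>\<rho>\<in>P. \<rho> s \<odot>\<^bsub>N\<^esub> z i \<rho>)"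
        using z(1)[OF i] \<rho>c by (intro N.M.finsum_cong') (auto simp: hom_smult gen[OF i] \<zeta>(2) i)
      finally show "\<alpha> s (free_gen R i) = (\<Oplus>\<^bsub>?X\<^esub>\<rho>\<in>P. \<rho> s \<odot>\<^bsub>?X\<^esub> \<zeta> \<rho>) (free_gen R i)"
        using z(2)[OF i s] by simp
    qed
    have "t = (\<Oplus>\<^bsub>?TX\<^esub>s\<in>S. pure_tensor R ?X C (\<Oplus>\<^bsub>?X\<^esub>\<rho>\<in>P. \<rho> s \<odot>\<^bsub>?X\<^esub> \<zeta> \<rho>) s)"
      unfolding \<alpha>(2)
    proof (rule TX.M.finsum_cong'[OF refl])
      show "(\<lambda>s. pure_tensor R ?X C (\<Oplus>\<^bsub>?X\<^esub>\<rho>\<in>P. \<rho> s \<odot>\<^bsub>?X\<^esub> \<zeta> \<rho>) s) \<in> S \<rightarrow> carrier ?TX"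
        using S_mem X.M.finsum_closed[OF \<zeta>c] pure_tensor_closed[OF X module_C] by blast
    qed (simp add: \<alpha>_eq)
    also have "\<dots> = \<zero>\<^bsub>?TX\<^esub>"
    proof (rule tensor_relation_zero[OF X module_C S(1,2) P(1)])
      show "P \<subseteq> carrier (free_module R S)" using P(2) by blast
      show "?\<pi> \<rho> = \<zero>\<^bsub>C\<^esub>" if "\<rho> \<in> P" for \<rho> using P(2) that by blast
      show "\<zeta> \<in> P \<rightarrow> carrier ?X" using \<zeta>(1) by blast
    qed
    finally show "t = \<zero>\<^bsub>?TX\<^esub>" .
  qed
  moreover have "carrier ?Y \<subseteq> ?\<tau> ` carrier ?TX"
  proof
    fix \<alpha>' assume \<alpha>': "\<alpha>' \<in> carrier ?Y"
    have "\<exists>y\<in>S \<rightarrow> carrier N. \<alpha>' (free_gen R i) = (\<Oplus>\<^bsub>?T\<^esub>s\<in>S. pure_tensor R N C (y s) s)" if i: "i \<in> I" for i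
      by (rule tensor_sum_form[OF N module_C S linear_map_closed[OF hom_linear[OF \<alpha>'] gen[OF i]]])
    then have "\<forall>i\<in>I. \<exists>y. y \<in> S \<rightarrow> carrier N \<and>
        \<alpha>' (free_gen R i) = (\<Oplus>\<^bsub>?T\<^esub>s\<in>S. pure_tensor R N C (y s) s)" by blast
    from bchoice[OF this] obtain y where "\<forall>i\<in>I. y i \<in> S \<rightarrow> carrier N \<and>
        \<alpha>' (free_gen R i) = (\<Oplus>\<^bsub>?T\<^esub>s\<in>S. pure_tensor R N C (y i s) s)" ..
    then have y: "\<And>i. i \<in> I \<Longrightarrow> y i \<in> S \<rightarrow> carrier N"
        "\<And>i. i \<in> I \<Longrightarrow> \<alpha>' (free_gen R i) = (\<Oplus>\<^bsub>?T\<^esub>s\<in>S. pure_tensor R N C (y i s) s)"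
      by simp_all
    have "\<exists>\<beta>\<in>carrier ?X. \<forall>i\<in>I. \<beta> (free_gen R i) = y i s" if "s \<in> S" for s
      by (rule lift) (use y(1) that in blast)
    then obtain \<alpha> where \<alpha>: "\<And>s. s \<in> S \<Longrightarrow> \<alpha> s \<in> carrier ?X"
        "\<And>s i. s \<in> S \<Longrightarrow> i \<in> I \<Longrightarrow> \<alpha> s (free_gen R i) = y i s"
      by metis
    have \<alpha>S: "\<alpha> \<in> S \<rightarrow> carrier ?X" using \<alpha>(1) by blast
    let ?t = "\<Oplus>\<^bsub>?TX\<^esub>s\<in>S. pure_tensor R ?X C (\<alpha> s) s"
    have t: "?t \<in> carrier ?TX"
      using \<alpha>(1) S_mem by (intro TX.M.finsum_closed) (auto intro!: pure_tensor_closed[OF X module_C])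
    have "?\<tau> ?t = \<alpha>'"
    proof (rule hom_free_eqI[OF cring T linear_map_closed[OF lin t] \<alpha>'])
      fix i assume i: "i \<in> I"
      have "(\<Oplus>\<^bsub>?T\<^esub>s\<in>S. pure_tensor R N C (\<alpha> s (free_gen R i)) s) = (\<Oplus>\<^bsub>?T\<^esub>s\<in>S. pure_tensor R N C (y i s) s)"
        using y(1)[OF i] S_mem \<alpha>(2) i
        by (intro T.M.finsum_cong') (auto intro!: pure_tensor_closed[OF N module_C])
      then show "?\<tau> ?t (free_gen R i) = \<alpha>' (free_gen R i)"
        using \<tau>_sum[OF \<alpha>S gen[OF i]] y(2)[OF i] by simp
    qed
    then show "\<alpha>' \<in> ?\<tau> ` carrier ?TX" using t by blast
  qed
  ultimately show ?thesis using linear_map_closed[OF lin] unfolding bij_betw_def by blast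
qed

text \<open>After the isomorphism \<open>?\<tau>\<close>, an element of
  \<open>?X \<otimes> C\<close> is a map into \<open>N \<otimes> C\<close>, and the conditions for
  \<open>N\<close> can be applied to its values: at every vector for injectivity and surjectivity,
  at the basis elements for Ext.\<close>

lemma auslander_core_hom_free:
  fixes N :: "('a, 'n) module" and I :: "'i set"
  assumes "auslander_core R C N"
  shows "auslander_core R C (hom_module R (free_module R I) N)"
proof -
  let ?F = "free_module R I"
  let ?X = "hom_module R ?F N" and ?T = "tensor_module R N C"
  let ?TX = "tensor_module R ?X C" and ?Y = "hom_module R ?F ?T"
  let ?\<tau> = "hom_tensor R ?F N C"
  note N = auslander_core_module[OF assms]
  have F: "module R ?F" by (rule module_free[OF cring])
  have X: "module R ?X" by (rule module_hom[OF F N])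
  have T: "module R ?T" by (rule module_tensor[OF N module_C])
  have TX: "module R ?TX" by (rule module_tensor[OF X module_C])
  have Y: "module R ?Y" by (rule module_hom[OF F T])
  interpret N: module R N by (rule N)
  interpret T: module R ?T by (rule T)
  have lin: "linear_map R ?TX ?Y ?\<tau>" by (rule linear_hom_tensor[OF F N module_C])
  have bij: "bij_betw ?\<tau> (carrier ?TX) (carrier ?Y)" by (rule hom_tensor_free_bij[OF N])
  then have inj: "inj_on ?\<tau> (carrier ?TX)" and surj: "?\<tau> ` carrier ?TX = carrier ?Y" unfolding bij_betw_def by auto
  have iso: "module_iso R ?TX ?Y ?\<tau>" unfolding module_iso_def using lin bij by blast
  have gen: "free_gen R i \<in> carrier ?F" if "i \<in> I" for i by (rule free_gen_closed[OF cring that])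
  have \<tau>_pure: "?\<tau> (pure_tensor R ?X C \<alpha> c) v = pure_tensor R N C (\<alpha> v) c"
    if "\<alpha> \<in> carrier ?X" "c \<in> carrier C" "v \<in> carrier ?F" for \<alpha> c v
    using hom_tensor_pure[OF F N module_C that(1,2)] that(3) by simp
  show ?thesis
  proof (rule auslander_coreI[OF X])
    fix \<alpha> assume \<alpha>: "\<alpha> \<in> carrier ?X" and zero: "\<And>c. c \<in> carrier C \<Longrightarrow> pure_tensor R ?X C \<alpha> c = \<zero>\<^bsub>?TX\<^esub>"
    show "\<alpha> = \<zero>\<^bsub>?X\<^esub>"
    proof (rule hom_eqI[OF \<alpha> submodule_zero[OF submodule_carrier[OF X]]])
      fix v assume v: "v \<in> carrier ?F"
      have "\<alpha> v = \<zero>\<^bsub>N\<^esub>"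
      proof (rule auslander_core_inj[OF assms linear_map_closed[OF hom_linear[OF \<alpha>] v]])
        fix c assume c: "c \<in> carrier C"
        have "pure_tensor R N C (\<alpha> v) c = ?\<tau> \<zero>\<^bsub>?TX\<^esub> v" using \<tau>_pure[OF \<alpha> c v] zero[OF c] by simp
        also have "\<dots> = \<zero>\<^bsub>?T\<^esub>" using linear_map_zero[OF TX Y lin] hom_zero[OF v] by simp
        finally show "pure_tensor R N C (\<alpha> v) c = \<zero>\<^bsub>?T\<^esub>" .
      qed
      then show "\<alpha> v = \<zero>\<^bsub>?X\<^esub> v" using v by (simp add: hom_zero)
    qed
  next
    fix f assume f: "linear_map R C ?TX f"
    have "\<exists>n\<in>carrier N. \<forall>c\<in>carrier C. ?\<tau> (f c) v = pure_tensor R N C n c" if v: "v \<in> carrier ?F" for v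
      by (rule auslander_core_surj[OF assms linear_map_compose[OF linear_map_compose[OF f lin] linear_map_eval[OF v]]])
    then obtain n where n: "\<And>v. v \<in> carrier ?F \<Longrightarrow> n v \<in> carrier N"
        "\<And>v c. v \<in> carrier ?F \<Longrightarrow> c \<in> carrier C \<Longrightarrow> ?\<tau> (f c) v = pure_tensor R N C (n v) c"
      by metis
    \<comment> \<open>The representing elements \<open>n v\<close> are chosen for each
      \<open>v\<close> without coherence. They are unique by injectivity for \<open>N\<close>, and
      uniqueness forces \<open>n\<close> to be linear.\<close>
    have unique: "x = y" if "x \<in> carrier N" "y \<in> carrier N" "\<And>c. c \<in> carrier C \<Longrightarrow> pure_tensor R N C x c = pure_tensor R N C y c" for x y
    proof -
      have "x \<ominus>\<^bsub>N\<^esub> y = \<zero>\<^bsub>N\<^esub>"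
      proof (rule auslander_core_inj[OF assms])
        fix c assume c: "c \<in> carrier C"
        then show "pure_tensor R N C (x \<ominus>\<^bsub>N\<^esub> y) c = \<zero>\<^bsub>?T\<^esub>"
          using linear_map_minus[OF N T linear_pure_left[OF N module_C c] that(1,2)] that(3)[OF c]
            pure_tensor_closed[OF N module_C that(2) c] by (simp add: T.M.minus_eq_zero_iff)
      qed (use that in simp)
      then show ?thesis using N.M.minus_eq_zero_iff that by blast
    qed
    have \<tau>f: "linear_map R ?F ?T (?\<tau> (f c))" if "c \<in> carrier C" for c
      using hom_linear[OF linear_map_closed[OF lin linear_map_closed[OF f that]]] .
    have "linear_map R ?F N n"
    proof (rule linear_mapI)
      fix v w assume v: "v \<in> carrier ?F" and w: "w \<in> carrier ?F"
      have vw: "v \<oplus>\<^bsub>?F\<^esub> w \<in> carrier ?F" by (rule submodule_add[OF submodule_carrier[OF F] v w])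
      show "n (v \<oplus>\<^bsub>?F\<^esub> w) = n v \<oplus>\<^bsub>N\<^esub> n w"
      proof (rule unique)
        fix c assume c: "c \<in> carrier C"
        show "pure_tensor R N C (n (v \<oplus>\<^bsub>?F\<^esub> w)) c = pure_tensor R N C (n v \<oplus>\<^bsub>N\<^esub> n w) c"
          using linear_map_add[OF \<tau>f[OF c] v w] n(2)[OF vw c] n(2)[OF v c] n(2)[OF w c]
            linear_map_add[OF linear_pure_left[OF N module_C c] n(1)[OF v] n(1)[OF w]] by simp
      qed (use n(1) v w vw in auto)
    next
      fix r v assume r: "r \<in> carrier R" and v: "v \<in> carrier ?F"
      have rv: "r \<odot>\<^bsub>?F\<^esub> v \<in> carrier ?F" by (rule submodule_smult[OF submodule_carrier[OF F] r v])
      show "n (r \<odot>\<^bsub>?F\<^esub> v) = r \<odot>\<^bsub>N\<^esub> n v"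
      proof (rule unique)
        fix c assume c: "c \<in> carrier C"
        show "pure_tensor R N C (n (r \<odot>\<^bsub>?F\<^esub> v)) c = pure_tensor R N C (r \<odot>\<^bsub>N\<^esub> n v) c"
          using linear_map_smult[OF \<tau>f[OF c] r v] n(2)[OF rv c] n(2)[OF v c]
            linear_map_smult[OF linear_pure_left[OF N module_C c] r n(1)[OF v]] by simp
      qed (use n(1) v r rv in auto)
    qed (rule n(1))
    then have \<alpha>: "restrict n (carrier ?F) \<in> carrier ?X" by (rule restrict_in_hom[OF F])
    have "f c = pure_tensor R ?X C (restrict n (carrier ?F)) c" if c: "c \<in> carrier C" for c
    proof (rule inj_onD[OF inj])
      show "?\<tau> (f c) = ?\<tau> (pure_tensor R ?X C (restrict n (carrier ?F)) c)"
        using \<tau>_pure[OF \<alpha> c] n(2)[OF _ c]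
        by (intro hom_eqI[OF linear_map_closed[OF lin linear_map_closed[OF f c]]
              linear_map_closed[OF lin pure_tensor_closed[OF X module_C \<alpha> c]]]) simp
    qed (use linear_map_closed[OF f c] pure_tensor_closed[OF X module_C \<alpha> c] in auto)
    then show "\<exists>\<alpha>\<in>carrier ?X. \<forall>c\<in>carrier C. f c = pure_tensor R ?X C \<alpha> c" using \<alpha> by blast
  next
    have "ext_vanishing R C ?Y"
    proof (rule ext_vanishingI)
      let ?G = "res_module R C" and ?d = "res_diff R C"
      fix j f assume f: "linear_map R (?G (Suc j)) ?Y f"
        and cocycle: "\<And>x. x \<in> carrier (?G (Suc (Suc j))) \<Longrightarrow> f (?d (Suc j) x) = \<zero>\<^bsub>?Y\<^esub>"
      have "\<exists>h. linear_map R (?G j) ?T h \<and> (\<forall>x\<in>carrier (?G (Suc j)). f x (free_gen R i) = h (?d j x))"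
        if i: "i \<in> I" for i
        by (rule ext_vanishingD[OF auslander_core_ext[OF assms] linear_map_compose[OF f linear_map_eval[OF gen[OF i]]]])
          (auto simp: cocycle hom_zero gen[OF i])
      then obtain h where h: "\<And>i. i \<in> I \<Longrightarrow> linear_map R (?G j) ?T (h i)"
          "\<And>i x. i \<in> I \<Longrightarrow> x \<in> carrier (?G (Suc j)) \<Longrightarrow> f x (free_gen R i) = h i (?d j x)"
        by metis
      \<comment> \<open>The bounding maps \<open>h i\<close> of the single coordinates are chosen
        independently and put together into one map with values in \<open>?Y\<close>; freeness on
        \<open>I\<close> imposes no compatibility.\<close>
      define k where "k x = restrict (free_lift R ?T (\<lambda>i. h i x)) (carrier ?F)" for x
      have hx: "(\<lambda>i. h i x) \<in> I \<rightarrow> carrier ?T" if "x \<in> carrier (?G j)" for x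
        using linear_map_closed[OF h(1) that] by blast
      have k: "k x \<in> carrier ?Y" if "x \<in> carrier (?G j)" for x
        unfolding k_def by (rule restrict_in_hom[OF F linear_map_free_lift[OF T hx[OF that]]])
      have k_gen: "k x (free_gen R i) = h i x" if "x \<in> carrier (?G j)" "i \<in> I" for x i
        using free_lift_gen[OF T hx[OF that(1)] that(2)] gen[OF that(2)] by (simp add: k_def)
      note G = module_res[OF module_C, of j]
      interpret G: module R "?G j" by (rule G)
      interpret Y: module R ?Y by (rule Y)
      have "linear_map R (?G j) ?Y k"
      proof (rule linear_mapI[OF k])
        fix x y assume xy: "x \<in> carrier (?G j)" "y \<in> carrier (?G j)"
        show "k (x \<oplus>\<^bsub>?G j\<^esub> y) = k x \<oplus>\<^bsub>?Y\<^esub> k y"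
          by (rule hom_free_eqI[OF cring T k[OF G.M.a_closed[OF xy]] Y.M.a_closed[OF k[OF xy(1)] k[OF xy(2)]]])
            (simp add: k_gen xy hom_add gen linear_map_add[OF h(1)])
      next
        fix r x assume r: "r \<in> carrier R" and x: "x \<in> carrier (?G j)"
        show "k (r \<odot>\<^bsub>?G j\<^esub> x) = r \<odot>\<^bsub>?Y\<^esub> k x"
          by (rule hom_free_eqI[OF cring T k[OF G.smult_closed[OF r x]] Y.smult_closed[OF r k[OF x]]])
            (simp add: k_gen r x hom_smult gen linear_map_smult[OF h(1)])
      qed
      moreover have "f x = k (?d j x)" if x: "x \<in> carrier (?G (Suc j))" for x
      proof (rule hom_free_eqI[OF cring T linear_map_closed[OF f x]])
        have dx: "?d j x \<in> carrier (?G j)"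
          by (rule linear_map_closed[OF linear_res_diff[OF module_C one_neq_zero] x])
        then show "k (?d j x) \<in> carrier ?Y" by (rule k)
        show "f x (free_gen R i) = k (?d j x) (free_gen R i)" if "i \<in> I" for i
          using h(2)[OF that x] k_gen[OF dx that] by simp
      qed
      ultimately show "\<exists>h. linear_map R (?G j) ?Y h \<and> (\<forall>x\<in>carrier (?G (Suc j)). f x = h (?d j x))" by blast
    qed
    \<comment> \<open>The vanishing was obtained for \<open>?Y\<close>, where coordinates are
      available; it returns to the tensor product along the inverse of
      \<open>?\<tau>\<close>.\<close>
    then show "ext_vanishing R C ?TX"
      by (rule ext_vanishing_retract[OF TX Y lin linear_map_inv_into[OF TX Y iso], rotated]) (rule inv_into_f_f[OF inj])
  qed
qed

end

section \<open>Functoriality of Ext and the comparison map\<close>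

abbreviation ext_class ::
    "('a, 'r) ring_scheme \<Rightarrow> ('a, 'm) module \<Rightarrow> ('a, 'n) module \<Rightarrow> nat \<Rightarrow>
     ((('a \<times> 'm) list \<Rightarrow> 'a) \<Rightarrow> 'n) \<Rightarrow> ((('a \<times> 'm) list \<Rightarrow> 'a) \<Rightarrow> 'n) set" where
  "ext_class R M N i \<alpha> \<equiv> coboundaries (ext_complex R M N) (ext_diff R M) i +>\<^bsub>ext_complex R M N i\<^esub> \<alpha>"

abbreviation ext_cocycles ::
    "('a, 'r) ring_scheme \<Rightarrow> ('a, 'm) module \<Rightarrow> ('a, 'n) module \<Rightarrow> nat \<Rightarrow>
     ((('a \<times> 'm) list \<Rightarrow> 'a) \<Rightarrow> 'n) set" where
  "ext_cocycles R M N i \<equiv> cocycles (ext_complex R M N) (ext_diff R M) i"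

lemma module_Ext:
  assumes "module R M" "module R N" "\<one>\<^bsub>R\<^esub> \<noteq> \<zero>\<^bsub>R\<^esub>"
  shows "module R (Ext R i M N)"
  unfolding Ext_def by (rule cochain_complex.module_H[OF ext_cochain_complex[OF assms]])

lemma Ext_class_cases:
  assumes "module R M" "module R N" "\<one>\<^bsub>R\<^esub> \<noteq> \<zero>\<^bsub>R\<^esub>" "\<xi> \<in> carrier (Ext R i M N)"
  obtains \<alpha> where "\<alpha> \<in> ext_cocycles R M N i" "\<xi> = ext_class R M N i \<alpha>"
proof -
  interpret E: cochain_complex R "ext_complex R M N" "ext_diff R M" by (rule ext_cochain_complex[OF assms(1-3)])
  have "\<xi> \<in> (\<lambda>x. E.cls i x) ` carrier (E.Z i)" using assms(4) unfolding Ext_def E.cls_surj .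
  then show ?thesis using that by auto
qed

lemma compose_cocycle:
  assumes "module R M" "module R N" "module R N'" "\<one>\<^bsub>R\<^esub> \<noteq> \<zero>\<^bsub>R\<^esub>" "linear_map R N N' g"
    and "\<alpha> \<in> ext_cocycles R M N i"
  shows "compose (carrier (res_module R M i)) g \<alpha> \<in> ext_cocycles R M N' i"
  using assms(6) compose_in_hom[OF module_res[OF assms(1)] hom_linear assms(5), of \<alpha> i]
    linear_map_closed[OF linear_res_diff[OF assms(1,4)], of _ i] linear_map_zero[OF assms(2,3,5)]
  unfolding ext_cocycle_iff[OF assms(1,2,4)] ext_cocycle_iff[OF assms(1,3,4)]
  by (auto simp: compose_def)

lemma Ext_map_right:
  assumes "module R M" "module R N" "module R N'" "\<one>\<^bsub>R\<^esub> \<noteq> \<zero>\<^bsub>R\<^esub>" "linear_map R N N' g"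
  shows linear_Ext_map_right: "linear_map R (Ext R i M N) (Ext R i M N') (Ext_map_right R i M N N' g)"
    and Ext_map_right_class: "\<And>\<alpha>. \<alpha> \<in> ext_cocycles R M N i \<Longrightarrow>
      Ext_map_right R i M N N' g (ext_class R M N i \<alpha>) =
      ext_class R M N' i (compose (carrier (res_module R M i)) g \<alpha>)"
proof -
  let ?c = "\<lambda>i \<alpha>. compose (carrier (res_module R M i)) g \<alpha>"
  interpret E: cochain_complex R "ext_complex R M N" "ext_diff R M" by (rule ext_cochain_complex[OF assms(1,2,4)])
  interpret E': cochain_complex R "ext_complex R M N'" "ext_diff R M" by (rule ext_cochain_complex[OF assms(1,3,4)])
  have lin: "linear_map R (ext_complex R M N i) (ext_complex R M N' i) (?c i)" for i
    unfolding ext_complex_def by (rule linear_map_postcompose[OF module_res[OF assms(1)] assms(5)])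
  have bound: "?c i \<alpha> \<in> coboundaries (ext_complex R M N') (ext_diff R M) i"
    if \<alpha>: "\<alpha> \<in> coboundaries (ext_complex R M N) (ext_diff R M) i" for \<alpha> i
  proof (cases i)
    case 0
    then show ?thesis
      using \<alpha> linear_map_zero[OF E.module_cochains E'.module_cochains lin, of 0] by (simp add: coboundaries_def)
  next
    case (Suc k)
    then obtain \<beta> where \<beta>: "\<beta> \<in> carrier (ext_complex R M N k)" "\<alpha> = ext_diff R M k \<beta>"
      using \<alpha> by (auto simp: coboundaries_def)
    have "?c (Suc k) \<alpha> = ext_diff R M k (?c k \<beta>)"
      unfolding \<beta>(2) ext_diff_def compose_def
      using linear_map_closed[OF linear_res_diff[OF assms(1,4)], of _ k] by (auto simp: restrict_def fun_eq_iff)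
    then show ?thesis using E'.diff_in_coboundaries[OF linear_map_closed[OF lin \<beta>(1)]] Suc by simp
  qed
  note m = cohomology_map[OF ext_cochain_complex[OF assms(1,2,4)] ext_cochain_complex[OF assms(1,3,4)] lin
    compose_cocycle[OF assms] bound]
  show "linear_map R (Ext R i M N) (Ext R i M N') (Ext_map_right R i M N N' g)"
    unfolding Ext_def Ext_map_right_def by (rule m(2))
  show "Ext_map_right R i M N N' g (ext_class R M N i \<alpha>) = ext_class R M N' i (?c i \<alpha>)"
    if "\<alpha> \<in> ext_cocycles R M N i" for \<alpha>
    unfolding Ext_map_right_def by (rule m(1)) (assumption | rule that)+
qed

text \<open>Names the \<open>SOME\<close> inside \<open>Ext_map_left\<close>, so that statements can
  refer to this one chain map.\<close>

definition chosen_lift ::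
    "('a, 'r) ring_scheme \<Rightarrow> ('a, 'k) module \<Rightarrow> ('a, 'm) module \<Rightarrow> ('k \<Rightarrow> 'm) \<Rightarrow>
     nat \<Rightarrow> (('a \<times> 'k) list \<Rightarrow> 'a) \<Rightarrow> (('a \<times> 'm) list \<Rightarrow> 'a)" where
  "chosen_lift R M' M f = (SOME \<phi>. chain_lift R M' M f \<phi>)"

lemma chain_lift_chosen:
  assumes "module R M'" "module R M" "\<one>\<^bsub>R\<^esub> \<noteq> \<zero>\<^bsub>R\<^esub>" "linear_map R M' M f"
  shows "chain_lift R M' M f (chosen_lift R M' M f)"
  unfolding chosen_lift_def using exists_chain_lift[OF assms] by (rule someI_ex)

lemma precompose_cocycle:
  assumes "module R M'" "module R M" "module R N" "\<one>\<^bsub>R\<^esub> \<noteq> \<zero>\<^bsub>R\<^esub>" "linear_map R M' M f"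
    and "\<alpha> \<in> ext_cocycles R M N i"
  shows "compose (carrier (res_module R M' i)) \<alpha> (chosen_lift R M' M f i) \<in> ext_cocycles R M' N i"
proof -
  have \<phi>: "\<And>i. linear_map R (res_module R M' i) (res_module R M i) (chosen_lift R M' M f i)"
    and comm: "\<And>x i. x \<in> carrier (res_module R M' (Suc i)) \<Longrightarrow>
      res_diff R M i (chosen_lift R M' M f (Suc i) x) = chosen_lift R M' M f i (res_diff R M' i x)"
    using chain_lift_chosen[OF assms(1,2,4,5)] unfolding chain_lift_def by auto
  have \<alpha>: "\<alpha> \<in> carrier (hom_module R (res_module R M i) N)"
      "\<And>x. x \<in> carrier (res_module R M (Suc i)) \<Longrightarrow> \<alpha> (res_diff R M i x) = \<zero>\<^bsub>N\<^esub>"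
    using assms(6) unfolding ext_cocycle_iff[OF assms(2,3,4)] by auto
  show ?thesis
    unfolding ext_cocycle_iff[OF assms(1,3,4)]
    using compose_in_hom[OF module_res[OF assms(1)] \<phi> hom_linear[OF \<alpha>(1)]]
      linear_map_closed[OF linear_res_diff[OF assms(1,4)], of _ i] linear_map_closed[OF \<phi>]
    by (auto simp: compose_def comm[symmetric] \<alpha>(2))
qed

text \<open>Precomposition with a chain map commutes with the differentials, so it respects cocycles
  and coboundaries; degree zero is separate because its only coboundary is zero.\<close>

lemma Ext_map_left:
  assumes "module R M'" "module R M" "module R N" "\<one>\<^bsub>R\<^esub> \<noteq> \<zero>\<^bsub>R\<^esub>" "linear_map R M' M f"
  shows linear_Ext_map_left: "linear_map R (Ext R i M N) (Ext R i M' N) (Ext_map_left R i M' M N f)"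
    and Ext_map_left_class: "\<And>\<alpha>. \<alpha> \<in> ext_cocycles R M N i \<Longrightarrow>
      Ext_map_left R i M' M N f (ext_class R M N i \<alpha>) =
      ext_class R M' N i (compose (carrier (res_module R M' i)) \<alpha> (chosen_lift R M' M f i))"
proof -
  let ?\<phi> = "chosen_lift R M' M f"
  let ?c = "\<lambda>i \<alpha>. compose (carrier (res_module R M' i)) \<alpha> (?\<phi> i)"
  interpret E: cochain_complex R "ext_complex R M N" "ext_diff R M" by (rule ext_cochain_complex[OF assms(2,3,4)])
  interpret E': cochain_complex R "ext_complex R M' N" "ext_diff R M'" by (rule ext_cochain_complex[OF assms(1,3,4)])
  have \<phi>: "\<And>i. linear_map R (res_module R M' i) (res_module R M i) (?\<phi> i)"
    and comm: "\<And>x i. x \<in> carrier (res_module R M' (Suc i)) \<Longrightarrow>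
      res_diff R M i (?\<phi> (Suc i) x) = ?\<phi> i (res_diff R M' i x)"
    using chain_lift_chosen[OF assms(1,2,4,5)] unfolding chain_lift_def by auto
  have lin: "linear_map R (ext_complex R M N i) (ext_complex R M' N i) (?c i)" for i
    unfolding ext_complex_def by (rule linear_map_precompose[OF module_res[OF assms(1)] \<phi>])
  have bound: "?c i \<alpha> \<in> coboundaries (ext_complex R M' N) (ext_diff R M') i"
    if \<alpha>: "\<alpha> \<in> coboundaries (ext_complex R M N) (ext_diff R M) i" for \<alpha> i
  proof (cases i)
    case 0
    then show ?thesis
      using \<alpha> linear_map_zero[OF E.module_cochains E'.module_cochains lin, of 0] by (simp add: coboundaries_def)
  next
    case (Suc k)
    then obtain \<beta> where \<beta>: "\<beta> \<in> carrier (ext_complex R M N k)" "\<alpha> = ext_diff R M k \<beta>"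
      using \<alpha> by (auto simp: coboundaries_def)
    have "?c (Suc k) \<alpha> = ext_diff R M' k (?c k \<beta>)"
      unfolding \<beta>(2) ext_diff_def compose_def
      using linear_map_closed[OF linear_res_diff[OF assms(1,4)], of _ k] linear_map_closed[OF \<phi>]
      by (auto simp: restrict_def fun_eq_iff comm)
    then show ?thesis using E'.diff_in_coboundaries[OF linear_map_closed[OF lin \<beta>(1)]] Suc by simp
  qed
  note m = cohomology_map[OF ext_cochain_complex[OF assms(2,3,4)] ext_cochain_complex[OF assms(1,3,4)] lin
    precompose_cocycle[OF assms] bound]
  show "linear_map R (Ext R i M N) (Ext R i M' N) (Ext_map_left R i M' M N f)"
    unfolding Ext_def Ext_map_left_def chosen_lift_def[symmetric] by (rule m(2))
  show "Ext_map_left R i M' M N f (ext_class R M N i \<alpha>) = ext_class R M' N i (?c i \<alpha>)"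
    if "\<alpha> \<in> ext_cocycles R M N i" for \<alpha>
    unfolding Ext_map_left_def chosen_lift_def[symmetric] by (rule m(1)) (assumption | rule that)+
qed

section \<open>The comparison map on cocycles and its naturality\<close>

lemma tensor_cocycle:
  assumes "module R M" "module R N" "module R C" "\<one>\<^bsub>R\<^esub> \<noteq> \<zero>\<^bsub>R\<^esub>"
    and "\<alpha> \<in> ext_cocycles R M N i" "c \<in> carrier C"
  shows "(\<lambda>v\<in>carrier (res_module R M i). pure_tensor R N C (\<alpha> v) c) \<in> ext_cocycles R M (tensor_module R N C) i"
  using compose_cocycle[OF assms(1,2) module_tensor[OF assms(2,3)] assms(4) linear_pure_left[OF assms(2,3,6)] assms(5)]
  by (simp add: compose_def)

text \<open>Linearity in \<open>\<xi>\<close> is that of \<open>Ext_map_right\<close>. Linearity in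
  \<open>c\<close> is hidden there, since \<open>c\<close> enters through the coefficient map; it
  becomes visible after a cocycle \<open>\<alpha>\<close> for \<open>\<xi>\<close> is fixed.\<close>

lemma bilinear_Ext_tensor:
  assumes "module R M" "module R N" "module R C" "\<one>\<^bsub>R\<^esub> \<noteq> \<zero>\<^bsub>R\<^esub>"
  shows "bilinear_map R (Ext R i M N) C (Ext R i M (tensor_module R N C))
    (\<lambda>\<xi> c. Ext_map_right R i M N (tensor_module R N C) (\<lambda>y. pure_tensor R N C y c) \<xi>)"
proof (rule bilinear_mapI)
  let ?T = "tensor_module R N C" and ?F = "res_module R M i"
  note T = module_tensor[OF assms(2,3)]
  fix \<xi> assume "\<xi> \<in> carrier (Ext R i M N)"
  then obtain \<alpha> where \<alpha>: "\<alpha> \<in> ext_cocycles R M N i" "\<xi> = ext_class R M N i \<alpha>"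
    by (rule Ext_class_cases[OF assms(1,2,4)])
  interpret E': cochain_complex R "ext_complex R M ?T" "ext_diff R M" by (rule ext_cochain_complex[OF assms(1) T assms(4)])
  have "\<alpha> \<in> carrier (hom_module R ?F N)" using \<alpha>(1) unfolding ext_cocycle_iff[OF assms(1,2,4)] by blast
  then have "linear_map R C (hom_module R ?F ?T) (\<lambda>c. \<lambda>v\<in>carrier ?F. pure_tensor R N C (\<alpha> v) c)"
    using bilinear_hom_tensor[OF module_res[OF assms(1)] assms(2,3)] unfolding bilinear_map_def by blast
  then have "linear_map R C (E'.Z i) (\<lambda>c. \<lambda>v\<in>carrier ?F. pure_tensor R N C (\<alpha> v) c)"
    using tensor_cocycle[OF assms \<alpha>(1)]
    by (intro linear_map_into_submodule) (simp_all add: ext_complex_def)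
  from linear_map_compose[OF this E'.linear_cls]
  have lin: "linear_map R C (Ext R i M ?T) (\<lambda>c. ext_class R M ?T i (\<lambda>v\<in>carrier ?F. pure_tensor R N C (\<alpha> v) c))"
    unfolding Ext_def .
  have "linear_map R C (Ext R i M ?T) (\<lambda>c. Ext_map_right R i M N ?T (\<lambda>y. pure_tensor R N C y c) \<xi>) =
      linear_map R C (Ext R i M ?T) (\<lambda>c. ext_class R M ?T i (\<lambda>v\<in>carrier ?F. pure_tensor R N C (\<alpha> v) c))"
    by (rule linear_map_cong[OF assms(3)])
      (simp add: \<alpha>(2) Ext_map_right_class[OF assms(1,2) T assms(4) linear_pure_left[OF assms(2,3)] \<alpha>(1)] compose_def)
  then show "linear_map R C (Ext R i M ?T) (\<lambda>c. Ext_map_right R i M N ?T (\<lambda>y. pure_tensor R N C y c) \<xi>)"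
    using lin by simp
qed (rule linear_Ext_map_right[OF assms(1,2) module_tensor[OF assms(2,3)] assms(4) linear_pure_left[OF assms(2,3)]])

lemma linear_Ext_tensor_map:
  assumes "module R M" "module R N" "module R C" "\<one>\<^bsub>R\<^esub> \<noteq> \<zero>\<^bsub>R\<^esub>"
  shows "linear_map R (tensor_module R (Ext R i M N) C) (Ext R i M (tensor_module R N C)) (Ext_tensor_map R i M N C)"
  unfolding Ext_tensor_map_def
  by (rule linear_tensor_lift[OF module_Ext[OF assms(1,2,4)] assms(3)
        module_Ext[OF assms(1) module_tensor[OF assms(2,3)] assms(4)] bilinear_Ext_tensor[OF assms]])

lemma Ext_tensor_map_class:
  assumes "module R M" "module R N" "module R C" "\<one>\<^bsub>R\<^esub> \<noteq> \<zero>\<^bsub>R\<^esub>"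
    and "\<alpha> \<in> ext_cocycles R M N i" "c \<in> carrier C"
  shows "Ext_tensor_map R i M N C (pure_tensor R (Ext R i M N) C (ext_class R M N i \<alpha>) c) =
    ext_class R M (tensor_module R N C) i (\<lambda>v\<in>carrier (res_module R M i). pure_tensor R N C (\<alpha> v) c)"
proof -
  note T = module_tensor[OF assms(2,3)]
  interpret E: cochain_complex R "ext_complex R M N" "ext_diff R M" by (rule ext_cochain_complex[OF assms(1,2,4)])
  have "ext_class R M N i \<alpha> \<in> carrier (Ext R i M N)"
    using linear_map_closed[OF E.linear_cls, of \<alpha> i] assms(5) unfolding Ext_def by simp
  then have "Ext_tensor_map R i M N C (pure_tensor R (Ext R i M N) C (ext_class R M N i \<alpha>) c) =
      Ext_map_right R i M N (tensor_module R N C) (\<lambda>y. pure_tensor R N C y c) (ext_class R M N i \<alpha>)"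
    unfolding Ext_tensor_map_def
    by (rule tensor_lift_pure[OF module_Ext[OF assms(1,2,4)] assms(3)
          module_Ext[OF assms(1) T assms(4)] bilinear_Ext_tensor[OF assms(1-4)] _ assms(6)])
  then show ?thesis
    using Ext_map_right_class[OF assms(1,2) T assms(4) linear_pure_left[OF assms(2,3,6)] assms(5)]
    by (simp add: compose_def)
qed

text \<open>Both sides are linear, so pure tensors suffice. For \<open>\<xi>\<close> represented by
  \<open>\<alpha>\<close>, both routes give the class of
  \<open>v \<mapsto> g (\<alpha> v) \<otimes> c\<close>.\<close>

lemma Ext_tensor_map_natural_right:
  assumes "module R M" "module R N" "module R N'" "module R C" "\<one>\<^bsub>R\<^esub> \<noteq> \<zero>\<^bsub>R\<^esub>" "linear_map R N N' g"
    and "t \<in> carrier (tensor_module R (Ext R i M N) C)"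
  shows "Ext_map_right R i M (tensor_module R N C) (tensor_module R N' C) (tmap R N N' C g) (Ext_tensor_map R i M N C t) =
    Ext_tensor_map R i M N' C (tmap R (Ext R i M N) (Ext R i M N') C (Ext_map_right R i M N N' g) t)"
proof -
  let ?F = "carrier (res_module R M i)"
  note T = module_tensor[OF assms(2,4)] and T' = module_tensor[OF assms(3,4)]
  note E = module_Ext[OF assms(1,2,5)] and E' = module_Ext[OF assms(1,3,5)]
  note lg = linear_tmap[OF assms(2,3,4,6)]
  note le = linear_Ext_map_right[OF assms(1,2,3,5,6)]
  show ?thesis
  proof (rule tensor_maps_eq[OF E assms(4) module_Ext[OF assms(1) T' assms(5)]
        linear_map_compose[OF linear_Ext_tensor_map[OF assms(1,2,4,5)] linear_Ext_map_right[OF assms(1) T T' assms(5) lg]]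
        linear_map_compose[OF linear_tmap[OF E E' assms(4) le] linear_Ext_tensor_map[OF assms(1,3,4,5)]] _ assms(7)])
    fix \<xi> c assume \<xi>: "\<xi> \<in> carrier (Ext R i M N)" and c: "c \<in> carrier C"
    obtain \<alpha> where \<alpha>: "\<alpha> \<in> ext_cocycles R M N i" "\<xi> = ext_class R M N i \<alpha>"
      by (rule Ext_class_cases[OF assms(1,2,5) \<xi>])
    have \<alpha>N: "\<alpha> v \<in> carrier N" if "v \<in> ?F" for v
      using \<alpha>(1) linear_map_closed[OF hom_linear that] unfolding ext_cocycle_iff[OF assms(1,2,5)] by blast
    have "compose ?F (tmap R N N' C g) (\<lambda>v\<in>?F. pure_tensor R N C (\<alpha> v) c) = (\<lambda>v\<in>?F. pure_tensor R N' C (compose ?F g \<alpha> v) c)"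
      using tmap_pure[OF assms(2,3,4,6) \<alpha>N c] by (auto simp: compose_def restrict_def fun_eq_iff)
    then show "Ext_map_right R i M (tensor_module R N C) (tensor_module R N' C) (tmap R N N' C g)
          (Ext_tensor_map R i M N C (pure_tensor R (Ext R i M N) C \<xi> c)) =
        Ext_tensor_map R i M N' C
          (tmap R (Ext R i M N) (Ext R i M N') C (Ext_map_right R i M N N' g) (pure_tensor R (Ext R i M N) C \<xi> c))"
      using tmap_pure[OF E E' assms(4) le \<xi> c] Ext_tensor_map_class[OF assms(1,2,4,5) \<alpha>(1) c]
        Ext_map_right_class[OF assms(1) T T' assms(5) lg tensor_cocycle[OF assms(1,2,4,5) \<alpha>(1) c]]
        Ext_map_right_class[OF assms(1,2,3,5,6) \<alpha>(1)]
        Ext_tensor_map_class[OF assms(1,3,4,5) compose_cocycle[OF assms(1,2,3,5,6) \<alpha>(1)] c]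
      by (simp add: \<alpha>(2))
  qed
qed

text \<open>On pure tensors both routes give the class of
  \<open>v \<mapsto> \<alpha> (?\<phi> v) \<otimes> c\<close>. The same chosen chain map occurs for
  the coefficients \<open>N\<close> and \<open>N \<otimes> C\<close>, so the cocycles agree and no
  homotopy enters.\<close>

lemma Ext_tensor_map_natural_left:
  assumes "module R M'" "module R M" "module R N" "module R C" "\<one>\<^bsub>R\<^esub> \<noteq> \<zero>\<^bsub>R\<^esub>" "linear_map R M' M f"
    and "t \<in> carrier (tensor_module R (Ext R i M N) C)"
  shows "Ext_map_left R i M' M (tensor_module R N C) f (Ext_tensor_map R i M N C t) =
    Ext_tensor_map R i M' N C (tmap R (Ext R i M N) (Ext R i M' N) C (Ext_map_left R i M' M N f) t)"
proof -
  let ?F = "carrier (res_module R M i)" and ?F' = "carrier (res_module R M' i)" and ?\<phi> = "chosen_lift R M' M f i"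
  note T = module_tensor[OF assms(3,4)]
  note E = module_Ext[OF assms(2,3,5)] and E' = module_Ext[OF assms(1,3,5)]
  note le = linear_Ext_map_left[OF assms(1,2,3,5,6)]
  have \<phi>: "linear_map R (res_module R M' i) (res_module R M i) ?\<phi>"
    using chain_lift_chosen[OF assms(1,2,5,6)] unfolding chain_lift_def by blast
  show ?thesis
  proof (rule tensor_maps_eq[OF E assms(4) module_Ext[OF assms(1) T assms(5)]
        linear_map_compose[OF linear_Ext_tensor_map[OF assms(2,3,4,5)] linear_Ext_map_left[OF assms(1,2) T assms(5,6)]]
        linear_map_compose[OF linear_tmap[OF E E' assms(4) le] linear_Ext_tensor_map[OF assms(1,3,4,5)]] _ assms(7)])
    fix \<xi> c assume \<xi>: "\<xi> \<in> carrier (Ext R i M N)" and c: "c \<in> carrier C"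
    obtain \<alpha> where \<alpha>: "\<alpha> \<in> ext_cocycles R M N i" "\<xi> = ext_class R M N i \<alpha>"
      by (rule Ext_class_cases[OF assms(2,3,5) \<xi>])
    have "compose ?F' (\<lambda>v\<in>?F. pure_tensor R N C (\<alpha> v) c) ?\<phi> = (\<lambda>v\<in>?F'. pure_tensor R N C (compose ?F' \<alpha> ?\<phi> v) c)"
      using linear_map_closed[OF \<phi>] by (auto simp: compose_def restrict_def fun_eq_iff)
    then show "Ext_map_left R i M' M (tensor_module R N C) f
          (Ext_tensor_map R i M N C (pure_tensor R (Ext R i M N) C \<xi> c)) =
        Ext_tensor_map R i M' N C
          (tmap R (Ext R i M N) (Ext R i M' N) C (Ext_map_left R i M' M N f) (pure_tensor R (Ext R i M N) C \<xi> c))"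
      using tmap_pure[OF E E' assms(4) le \<xi> c] Ext_tensor_map_class[OF assms(2,3,4,5) \<alpha>(1) c]
        Ext_map_left_class[OF assms(1,2) T assms(5,6) tensor_cocycle[OF assms(2,3,4,5) \<alpha>(1) c]]
        Ext_map_left_class[OF assms(1,2,3,5,6) \<alpha>(1)]
        Ext_tensor_map_class[OF assms(1,3,4,5) precompose_cocycle[OF assms(1,2,3,5,6) \<alpha>(1)] c]
      by (simp add: \<alpha>(2))
  qed
qed

section \<open>Bijectivity of the comparison map\<close>

context cochain_complex
begin

lemma short_exact_cohomology: "short_exact R (B n) (Z n) (H n) (\<lambda>x. x) (\<lambda>x. cls n x)"
proof -
  have "linear_map R (B n) (Z n) (\<lambda>x. x)"
    by (rule linear_map_into_submodule[OF linear_map_inclusion[OF submodule_subset[OF submodule_coboundaries]]])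
      (use coboundaries_subset in auto)
  moreover have "(\<lambda>x. x) ` carrier (B n) = {x \<in> carrier (Z n). cls n x = \<zero>\<^bsub>H n\<^esub>}"
    using coboundaries_subset[of n] cls_eq_zero_iff[of _ n] by (auto simp del: zero_quotient)
  ultimately show ?thesis
    unfolding short_exact_def using module_B module_Z module_H linear_cls cls_surj by simp
qed

lemma short_exact_cocycles: "short_exact R (Z n) (A n) (B (Suc n)) (\<lambda>x. x) (\<delta> n)"
proof -
  have "linear_map R (A n) (B (Suc n)) (\<delta> n)"
    by (rule linear_map_into_submodule[OF linear_diff]) (rule diff_in_coboundaries)
  moreover have "linear_map R (Z n) (A n) (\<lambda>x. x)"
    by (rule linear_map_inclusion[OF submodule_subset[OF submodule_cocycles]])
  moreover have "\<delta> n ` carrier (A n) = carrier (B (Suc n))" by (simp add: coboundaries_def)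
  moreover have "(\<lambda>x. x) ` carrier (Z n) = {x \<in> carrier (A n). \<delta> n x = \<zero>\<^bsub>B (Suc n)\<^esub>}"
    by (simp add: cocycles_def)
  ultimately show ?thesis
    unfolding short_exact_def using module_B[of "Suc n"] module_Z[of n] module_cochains[of n]
    by (intro conjI) simp_all
qed

end

context faithful_over_noetherian
begin

text \<open>The start of the induction: in degree zero the coboundaries are zero.\<close>

lemma auslander_core_trivial:
  fixes X :: "('a, 'x) module"
  assumes "module R X" "carrier X = {\<zero>\<^bsub>X\<^esub>}"
  shows "auslander_core R C X"
proof -
  note T = module_tensor[OF assms(1) module_C]
  have zero: "t = \<zero>\<^bsub>tensor_module R X C\<^esub>" if "t \<in> carrier (tensor_module R X C)" for t
    by (rule tensor_maps_eq[OF assms(1) module_C T linear_map_id linear_map_const_zero[OF T] _ that])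
      (simp add: assms(2) pure_tensor_zero_left[OF assms(1) module_C])
  show ?thesis
  proof (rule auslander_coreI[OF assms(1)])
    fix f assume f: "linear_map R C (tensor_module R X C) f"
    show "\<exists>x\<in>carrier X. \<forall>c\<in>carrier C. f c = pure_tensor R X C x c"
      using zero[OF linear_map_closed[OF f]] by (simp add: assms(2) pure_tensor_zero_left[OF assms(1) module_C])
  next
    show "ext_vanishing R C (tensor_module R X C)"
    proof (rule ext_vanishingI)
      fix j f assume f: "linear_map R (res_module R C (Suc j)) (tensor_module R X C) f"
      show "\<exists>h. linear_map R (res_module R C j) (tensor_module R X C) h \<and>
          (\<forall>x\<in>carrier (res_module R C (Suc j)). f x = h (res_diff R C j x))"
        using linear_map_const_zero[OF T] zero[OF linear_map_closed[OF f]] by blast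
    qed
  qed (simp add: assms(2))
qed

text \<open>Cohomology enters only in the step from \<open>B i\<close> to \<open>Z i\<close>. The
  step from \<open>Z i\<close> to \<open>B (i + 1)\<close> uses just the cochains, whence the bound
  \<open>Suc n\<close> for coboundaries.\<close>

lemma auslander_core_boundaries:
  fixes A :: "nat \<Rightarrow> ('a, 'm) module"
  assumes "cochain_complex R A \<delta>" "\<And>i. auslander_core R C (A i)"
    and "\<And>i. i \<le> n \<Longrightarrow> auslander_core R C (cohomology A \<delta> i)"
  shows auslander_core_coboundaries: "i \<le> Suc n \<Longrightarrow> auslander_core R C ((A i)\<lparr>carrier := coboundaries A \<delta> i\<rparr>)"
    and auslander_core_cocycles: "i \<le> n \<Longrightarrow> auslander_core R C ((A i)\<lparr>carrier := cocycles A \<delta> i\<rparr>)"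
proof -
  interpret A: cochain_complex R A \<delta> by fact
  have Z: "auslander_core R C (A.Z i)" if i: "i \<le> n" and B: "auslander_core R C (A.B i)" for i
  proof (rule auslander_core_extension[OF A.short_exact_cohomology B assms(3)[OF i]])
    note incl = linear_map_inclusion[OF submodule_subset[OF A.submodule_coboundaries]]
      linear_map_inclusion[OF submodule_subset[OF A.submodule_cocycles]]
    note BZ = short_exactD(4)[OF A.short_exact_cohomology]
    fix t assume t: "t \<in> carrier (tensor_module R (A.B i) C)"
      and zero: "tmap R (A.B i) (A.Z i) C (\<lambda>x. x) t = \<zero>\<^bsub>tensor_module R (A.Z i) C\<^esub>"
    \<comment> \<open>\<open>Z i\<close> is not yet known to satisfy the condition. The composite
      into \<open>A i\<close> has both ends covered by \<open>tmap_injective\<close>, and its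
      injectivity yields that of the first factor.\<close>
    have "tmap R (A.B i) (A i) C (\<lambda>x. x) t = tmap R (A.Z i) (A i) C (\<lambda>x. x) (tmap R (A.B i) (A.Z i) C (\<lambda>x. x) t)"
      by (rule tmap_compose[OF A.module_B A.module_Z A.module_cochains module_C BZ incl(2) t, symmetric])
    also have "\<dots> = \<zero>\<^bsub>tensor_module R (A i) C\<^esub>"
      unfolding zero by (rule linear_map_zero[OF module_tensor[OF A.module_Z module_C]
            module_tensor[OF A.module_cochains module_C] linear_tmap[OF A.module_Z A.module_cochains module_C incl(2)]])
    finally show "t = \<zero>\<^bsub>tensor_module R (A.B i) C\<^esub>"
      by (intro tmap_injective[OF B assms(2) incl(1) _ t]) simp_all
  qed
  have B: "auslander_core R C (A.B i)" if "i \<le> Suc n" for i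
    using that
  proof (induction i)
    case 0
    show ?case by (rule auslander_core_trivial[OF A.module_B]) (simp add: coboundaries_def)
  next
    case (Suc i)
    then show ?case by (intro auslander_core_cokernel[OF A.short_exact_cocycles Z assms(2)]) simp_all
  qed
  show "i \<le> Suc n \<Longrightarrow> auslander_core R C (A.B i)" by (rule B)
  show "i \<le> n \<Longrightarrow> auslander_core R C (A.Z i)" by (intro Z B) simp_all
qed

text \<open>Tensor evaluation commutes with the differentials. With
  \<open>hom_tensor_free_bij\<close> it identifies the complexes \<open>X \<otimes> C\<close> and
  \<open>Hom(F, N \<otimes> C)\<close>.\<close>

lemma hom_tensor_diff:
  fixes M :: "('a, 'm) module" and N :: "('a, 'n) module"
  assumes "module R M" "module R N" "t \<in> carrier (tensor_module R (ext_complex R M N i) C)"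
  shows "hom_tensor R (res_module R M (Suc i)) N C (tmap R (ext_complex R M N i) (ext_complex R M N (Suc i)) C (ext_diff R M i) t) =
    ext_diff R M i (hom_tensor R (res_module R M i) N C t)"
proof -
  let ?T = "tensor_module R N C"
  note T = module_tensor[OF assms(2) module_C]
  interpret E: cochain_complex R "ext_complex R M N" "ext_diff R M"
    by (rule ext_cochain_complex[OF assms(1,2) one_neq_zero])
  interpret E': cochain_complex R "ext_complex R M ?T" "ext_diff R M"
    by (rule ext_cochain_complex[OF assms(1) T one_neq_zero])
  note F = module_res[OF assms(1)]
  have \<tau>: "linear_map R (tensor_module R (ext_complex R M N i) C) (ext_complex R M ?T i) (hom_tensor R (res_module R M i) N C)" for i
    unfolding ext_complex_def by (rule linear_hom_tensor[OF F assms(2) module_C])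
  show ?thesis
  proof (rule tensor_maps_eq[OF E.module_cochains module_C E'.module_cochains
        linear_map_compose[OF linear_tmap[OF E.module_cochains E.module_cochains module_C E.linear_diff] \<tau>]
        linear_map_compose[OF \<tau> E'.linear_diff] _ assms(3)])
    fix \<alpha> c assume \<alpha>: "\<alpha> \<in> carrier (ext_complex R M N i)" and c: "c \<in> carrier C"
    note d\<alpha> = linear_map_closed[OF E.linear_diff \<alpha>]
    have "hom_tensor R (res_module R M (Suc i)) N C (pure_tensor R (ext_complex R M N (Suc i)) C (ext_diff R M i \<alpha>) c) =
        (\<lambda>v\<in>carrier (res_module R M (Suc i)). pure_tensor R N C (ext_diff R M i \<alpha> v) c)"
      using hom_tensor_pure[OF F assms(2) module_C _ c] d\<alpha> unfolding ext_complex_def by blast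
    also have "\<dots> = ext_diff R M i (\<lambda>v\<in>carrier (res_module R M i). pure_tensor R N C (\<alpha> v) c)"
      unfolding ext_diff_def compose_def
      using linear_map_closed[OF linear_res_diff[OF assms(1) one_neq_zero], of _ i] by (auto simp: restrict_def fun_eq_iff)
    also have "(\<lambda>v\<in>carrier (res_module R M i). pure_tensor R N C (\<alpha> v) c) =
        hom_tensor R (res_module R M i) N C (pure_tensor R (ext_complex R M N i) C \<alpha> c)"
      using hom_tensor_pure[OF F assms(2) module_C _ c, symmetric] \<alpha> unfolding ext_complex_def by blast
    finally show "hom_tensor R (res_module R M (Suc i)) N C (tmap R (ext_complex R M N i) (ext_complex R M N (Suc i)) C
          (ext_diff R M i) (pure_tensor R (ext_complex R M N i) C \<alpha> c)) =
        ext_diff R M i (hom_tensor R (res_module R M i) N C (pure_tensor R (ext_complex R M N i) C \<alpha> c))"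
      unfolding tmap_pure[OF E.module_cochains E.module_cochains module_C E.linear_diff \<alpha> c] .
  qed
qed

text \<open>Under tensor evaluation, \<open>Z i \<otimes> C\<close> becomes the module of cocycles
  of \<open>Hom(F, N \<otimes> C)\<close>, and \<open>B i \<otimes> C\<close> that of the
  coboundaries. The comparison map is then the induced map of quotients. Both identifications rest
  on the exactness of the tensored sequences.\<close>

lemma Ext_tensor_map_bij:
  fixes M :: "('a, 'm) module" and N :: "('a, 'n) module"
  assumes M: "module R M" and core_N: "auslander_core R C N"
    and core_Ext: "\<And>i. i \<le> n \<Longrightarrow> auslander_core R C (Ext R i M N)" and i: "i \<le> n"
  shows "bij_betw (Ext_tensor_map R i M N C) (carrier (tensor_module R (Ext R i M N) C))
    (carrier (Ext R i M (tensor_module R N C)))"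
proof -
  note N = auslander_core_module[OF core_N]
  let ?T = "tensor_module R N C"
  note T = module_tensor[OF N module_C]
  let ?E = "ext_complex R M N" and ?d = "ext_diff R M" and ?E' = "ext_complex R M ?T"
  note cE = ext_cochain_complex[OF M N one_neq_zero]
  interpret E: cochain_complex R ?E ?d by (rule cE)
  interpret E': cochain_complex R ?E' ?d by (rule ext_cochain_complex[OF M T one_neq_zero])
  have core_E: "auslander_core R C (?E j)" for j
    unfolding ext_complex_def res_module_def by (rule auslander_core_hom_free[OF core_N])
  note core_B = auslander_core_coboundaries[OF cE core_E core_Ext[unfolded Ext_def], of n, simplified]
  note core_Z = auslander_core_cocycles[OF cE core_E core_Ext[unfolded Ext_def], of n, simplified]
  let ?tau = "\<lambda>j. hom_tensor R (res_module R M j) N C"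
  have tau: "linear_map R (tensor_module R (?E j) C) (?E' j) (?tau j)" for j
    unfolding ext_complex_def by (rule linear_hom_tensor[OF module_res[OF M] N module_C])
  have tau_bij: "bij_betw (?tau j) (carrier (tensor_module R (?E j) C)) (carrier (?E' j))" for j
    unfolding ext_complex_def res_module_def by (rule hom_tensor_free_bij[OF N])
  note TE = module_tensor[OF E.module_cochains module_C]
  have tau_zero: "t = \<zero>\<^bsub>tensor_module R (?E j) C\<^esub>"
    if "t \<in> carrier (tensor_module R (?E j) C)" "?tau j t = \<zero>\<^bsub>?E' j\<^esub>" for t j
    by (rule inj_on_linear_map_zero[OF TE E'.module_cochains tau bij_betw_imp_inj_on[OF tau_bij] that])
  have tau_surj: "\<exists>t\<in>carrier (tensor_module R (?E j) C). x = ?tau j t" if "x \<in> carrier (?E' j)" for x j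
    using that tau_bij[of j] unfolding bij_betw_def by blast
  let ?iZ = "tmap R (E.Z i) (?E i) C (\<lambda>x. x)"
  let ?iB = "\<lambda>j. tmap R (E.B j) (?E j) C (\<lambda>x. x)"
  let ?bZ = "tmap R (E.B i) (E.Z i) C (\<lambda>x. x)"
  let ?db = "\<lambda>j. tmap R (?E j) (E.B (Suc j)) C (?d j)"
  let ?cl = "tmap R (E.Z i) (E.H i) C (\<lambda>x. E.cls i x)"
  let ?theta = "Ext_tensor_map R i M N C"
  note inclZ = linear_map_inclusion[OF submodule_subset[OF E.submodule_cocycles]]
  note inclB = linear_map_inclusion[OF submodule_subset[OF E.submodule_coboundaries]]
  note BZ = short_exactD(4)[OF E.short_exact_cohomology]
  note EB = short_exactD(4,5)[OF E.short_exact_cocycles]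
  note TZ = module_tensor[OF E.module_Z module_C] and TB = module_tensor[OF E.module_B module_C]
    and TH = module_tensor[OF E.module_H module_C]
  note l_iZ = linear_tmap[OF E.module_Z E.module_cochains module_C inclZ]
  note l_bZ = linear_tmap[OF E.module_B E.module_Z module_C BZ]
  note l_db = linear_tmap[OF E.module_cochains E.module_B module_C EB(2)]
  note l_cl = linear_tmap[OF E.module_Z E.module_H module_C E.linear_cls]
  have iZ_zero: "t = \<zero>\<^bsub>tensor_module R (E.Z i) C\<^esub>"
    if "t \<in> carrier (tensor_module R (E.Z i) C)" "?iZ t = \<zero>\<^bsub>tensor_module R (?E i) C\<^esub>" for t
    by (rule tmap_injective[OF core_Z[OF i] core_E inclZ _ that]) simp
  have iB_zero: "t = \<zero>\<^bsub>tensor_module R (E.B j) C\<^esub>"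
    if "j \<le> Suc n" "t \<in> carrier (tensor_module R (E.B j) C)" "?iB j t = \<zero>\<^bsub>tensor_module R (?E j) C\<^esub>" for t j
    by (rule tmap_injective[OF core_B[OF that(1)] core_E inclB _ that(2,3)]) simp
  have bZ_zero: "t = \<zero>\<^bsub>tensor_module R (E.B i) C\<^esub>"
    if t: "t \<in> carrier (tensor_module R (E.B i) C)" "?bZ t = \<zero>\<^bsub>tensor_module R (E.Z i) C\<^esub>" for t
  proof (rule iB_zero[OF _ t(1)])
    show "?iB i t = \<zero>\<^bsub>tensor_module R (?E i) C\<^esub>"
      using tmap_compose[OF E.module_B E.module_Z E.module_cochains module_C BZ inclZ t(1)] t(2)
        linear_map_zero[OF TZ TE l_iZ] by simp
  qed (use i in simp)
  note exZ = short_exactD(8)[OF short_exact_tensor[OF E.short_exact_cocycles module_C iZ_zero]]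
  note exB = short_exactD(8)[OF short_exact_tensor[OF E.short_exact_cohomology module_C bZ_zero]]
  \<comment> \<open>The tensored differential is split into a map onto
    \<open>B (j + 1) \<otimes> C\<close> and the map induced by the inclusion. Injectivity of the
    latter allows vanishing to be tested in \<open>B (j + 1) \<otimes> C\<close>, where the exact
    sequence with \<open>Z j\<close> speaks.\<close>
  have tau_d: "?d j (?tau j t) = ?tau (Suc j) (?iB (Suc j) (?db j t))"
    if "t \<in> carrier (tensor_module R (?E j) C)" for t j
    unfolding tmap_compose[OF E.module_cochains E.module_B E.module_cochains module_C EB(2) inclB that]
    by (rule hom_tensor_diff[OF M N that, symmetric])
  \<comment> \<open>The identification of \<open>Z i \<otimes> C\<close> with cocycles;
    \<open>theta_cl\<close> says that it lies above the comparison map.\<close>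
  let ?sigma = "\<lambda>t. ?tau i (?iZ t)"
  have sigma_cocycle: "?sigma t \<in> cocycles ?E' ?d i" if t: "t \<in> carrier (tensor_module R (E.Z i) C)" for t
  proof -
    note it = linear_map_closed[OF l_iZ t]
    have "?db i (?iZ t) = \<zero>\<^bsub>tensor_module R (E.B (Suc i)) C\<^esub>" using exZ t by blast
    then have "?d i (?sigma t) = \<zero>\<^bsub>?E' (Suc i)\<^esub>"
      using tau_d[OF it] linear_map_zero[OF TB TE linear_tmap[OF E.module_B E.module_cochains module_C inclB]]
        linear_map_zero[OF TE E'.module_cochains tau] by simp
    then show ?thesis using linear_map_closed[OF tau it] by (simp add: cocycles_def)
  qed
  have sigma: "linear_map R (tensor_module R (E.Z i) C) (E'.Z i) ?sigma"
    by (rule linear_map_into_submodule[OF linear_map_compose[OF l_iZ tau] sigma_cocycle])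
  have theta: "linear_map R (tensor_module R (E.H i) C) (E'.H i) ?theta"
    using linear_Ext_tensor_map[OF M N module_C one_neq_zero, of i] unfolding Ext_def .
  have theta_cl: "?theta (?cl t) = E'.cls i (?sigma t)" if t: "t \<in> carrier (tensor_module R (E.Z i) C)" for t
  proof (rule tensor_maps_eq[OF E.module_Z module_C E'.module_H linear_map_compose[OF l_cl theta]
        linear_map_compose[OF sigma E'.linear_cls] _ t])
    fix \<alpha> c assume \<alpha>: "\<alpha> \<in> carrier (E.Z i)" and c: "c \<in> carrier C"
    from \<alpha> have \<alpha>Z: "\<alpha> \<in> cocycles ?E ?d i" by simp
    then have \<alpha>E: "\<alpha> \<in> carrier (hom_module R (res_module R M i) N)"
      unfolding ext_cocycle_iff[OF M N one_neq_zero] by blast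
    have "?theta (?cl (pure_tensor R (E.Z i) C \<alpha> c)) =
        E'.cls i (\<lambda>v\<in>carrier (res_module R M i). pure_tensor R N C (\<alpha> v) c)"
      using tmap_pure[OF E.module_Z E.module_H module_C E.linear_cls \<alpha> c]
        Ext_tensor_map_class[OF M N module_C one_neq_zero \<alpha>Z c] unfolding Ext_def by simp
    also have "(\<lambda>v\<in>carrier (res_module R M i). pure_tensor R N C (\<alpha> v) c) = ?sigma (pure_tensor R (E.Z i) C \<alpha> c)"
      unfolding tmap_pure[OF E.module_Z E.module_cochains module_C inclZ \<alpha> c]
      unfolding ext_complex_def by (rule hom_tensor_pure[OF module_res[OF M] N module_C \<alpha>E c, symmetric])
    finally show "?theta (?cl (pure_tensor R (E.Z i) C \<alpha> c)) = E'.cls i (?sigma (pure_tensor R (E.Z i) C \<alpha> c))" .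
  qed
  have cl_surj: "\<exists>t\<in>carrier (tensor_module R (E.Z i) C). h = ?cl t" if "h \<in> carrier (tensor_module R (E.H i) C)" for h
    using that tmap_surj[OF E.module_Z E.module_H module_C E.linear_cls E.cls_surj] by blast
  have coboundary: "\<exists>s\<in>carrier (tensor_module R (E.B i) C). x = ?sigma (?bZ s)" if x: "x \<in> coboundaries ?E' ?d i" for x
  proof (cases i)
    case 0
    \<comment> \<open>In degree zero the only coboundary is zero, which is hit by the zero tensor.
      In higher degree a preimage is made from a cochain bounded by \<open>x\<close>
      instead.\<close>
    have "x = ?sigma (?bZ \<zero>\<^bsub>tensor_module R (E.B i) C\<^esub>)"
      unfolding linear_map_zero[OF TB TZ l_bZ] linear_map_zero[OF TZ TE l_iZ]
        linear_map_zero[OF TE E'.module_cochains tau]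
      using x 0 by (simp add: coboundaries_def)
    then show ?thesis using submodule_zero[OF submodule_carrier[OF TB]] by blast
  next
    case (Suc k)
    then obtain y where y: "y \<in> carrier (?E' k)" "x = ?d k y" using x by (auto simp: coboundaries_def)
    obtain u where u: "u \<in> carrier (tensor_module R (?E k) C)" "y = ?tau k u" using tau_surj[OF y(1)] by blast
    have s: "?db k u \<in> carrier (tensor_module R (E.B i) C)" unfolding Suc by (rule linear_map_closed[OF l_db u(1)])
    have "x = ?sigma (?bZ (?db k u))"
      using tau_d[OF u(1)] y(2) u(2)
        tmap_compose[OF E.module_B E.module_Z E.module_cochains module_C BZ inclZ s]
      by (simp add: Suc)
    then show ?thesis using s by blast
  qed
  have "inj_on ?theta (carrier (tensor_module R (E.H i) C))"
  proof (rule linear_map_inj_onI[OF TH E'.module_H theta])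
    fix h assume h: "h \<in> carrier (tensor_module R (E.H i) C)" and zero: "?theta h = \<zero>\<^bsub>E'.H i\<^esub>"
    obtain t where t: "t \<in> carrier (tensor_module R (E.Z i) C)" "h = ?cl t" using cl_surj[OF h] by blast
    \<comment> \<open>Injectivity: \<open>?sigma t\<close> is a coboundary and so comes from
      \<open>B i \<otimes> C\<close>. Both \<open>?tau\<close> and \<open>?iZ\<close> are injective,
      so \<open>t\<close> itself comes from there, and its image in \<open>H i \<otimes> C\<close>
      vanishes.\<close>
    have "?sigma t \<in> coboundaries ?E' ?d i"
      using zero E'.cls_eq_zero_iff[OF sigma_cocycle[OF t(1)]] theta_cl[OF t(1)] t(2) by simp
    then obtain s where s: "s \<in> carrier (tensor_module R (E.B i) C)" "?sigma t = ?sigma (?bZ s)"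
      using coboundary by blast
    note bs = linear_map_closed[OF l_bZ s(1)]
    have "?iZ t = ?iZ (?bZ s)"
      using s(2) bij_betw_imp_inj_on[OF tau_bij[of i]] linear_map_closed[OF l_iZ t(1)] linear_map_closed[OF l_iZ bs]
      by (simp add: inj_on_def)
    then have "t = ?bZ s"
      using linear_map_inj_onI[OF TZ TE l_iZ iZ_zero] t(1) bs by (simp add: inj_on_def)
    then show "h = \<zero>\<^bsub>tensor_module R (E.H i) C\<^esub>" using exB s(1) t(2) by blast
  qed
  moreover have "carrier (E'.H i) \<subseteq> ?theta ` carrier (tensor_module R (E.H i) C)"
  proof
    fix \<xi> assume "\<xi> \<in> carrier (E'.H i)"
    then obtain x where x: "x \<in> cocycles ?E' ?d i" "\<xi> = E'.cls i x" unfolding E'.cls_surj[symmetric] by auto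
    then have xc: "x \<in> carrier (?E' i)" and dx: "?d i x = \<zero>\<^bsub>?E' (Suc i)\<^esub>" by (auto simp: cocycles_def)
    obtain t where t: "t \<in> carrier (tensor_module R (?E i) C)" "x = ?tau i t" using tau_surj[OF xc] by blast
    note dt = linear_map_closed[OF l_db t(1)]
    have "?tau (Suc i) (?iB (Suc i) (?db i t)) = \<zero>\<^bsub>?E' (Suc i)\<^esub>" using tau_d[OF t(1)] t(2) dx by simp
    then have "?iB (Suc i) (?db i t) = \<zero>\<^bsub>tensor_module R (?E (Suc i)) C\<^esub>"
      by (rule tau_zero[OF linear_map_closed[OF linear_tmap[OF E.module_B E.module_cochains module_C inclB] dt]])
    \<comment> \<open>Injectivity is used in degree \<open>Suc i\<close>, which may equal
      \<open>Suc n\<close>: the last degree in which the coboundaries are known to satisfy the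
      condition.\<close>
    then have "?db i t = \<zero>\<^bsub>tensor_module R (E.B (Suc i)) C\<^esub>" using i by (intro iB_zero[OF _ dt]) simp_all
    then obtain s where s: "s \<in> carrier (tensor_module R (E.Z i) C)" "t = ?iZ s" using exZ t(1) by blast
    have "\<xi> = ?theta (?cl s)" using theta_cl[OF s(1)] x(2) t(2) s(2) by simp
    then show "\<xi> \<in> ?theta ` carrier (tensor_module R (E.H i) C)" using linear_map_closed[OF l_cl s(1)] by blast
  qed
  ultimately show ?thesis
    using linear_map_closed[OF theta] unfolding bij_betw_def Ext_def by blast
qed

end

section \<open>Specialization to local rings and semidualizing modules\<close>

lemma (in maximalideal) one_neq_zero: "\<one>\<^bsub>R\<^esub> \<noteq> \<zero>\<^bsub>R\<^esub>"
proof
  assume eq: "\<one>\<^bsub>R\<^esub> = \<zero>\<^bsub>R\<^esub>"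
  have "carrier R \<subseteq> I"
  proof
    fix x assume x: "x \<in> carrier R"
    then have "x = \<zero>\<^bsub>R\<^esub>" using eq l_null[OF x] l_one[OF x] by simp
    then show "x \<in> I" by simp
  qed
  then show False using I_notcarr a_subset by blast
qed

text \<open>A scalar that kills \<open>C\<close> has the same homothety as \<open>\<zero>\<close>,
  and the homothety map is injective.\<close>

lemma semidualizing_faithful:
  assumes "cring R" "semidualizing R C" "r \<in> carrier R" "\<And>c. c \<in> carrier C \<Longrightarrow> r \<odot>\<^bsub>C\<^esub> c = \<zero>\<^bsub>C\<^esub>"
  shows "r = \<zero>\<^bsub>R\<^esub>"
proof -
  interpret R: cring R by fact
  interpret C: module R C using assms(2) by (simp add: semidualizing_def fg_module_def)
  let ?h = "\<lambda>r. \<lambda>c\<in>carrier C. r \<odot>\<^bsub>C\<^esub> c"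
  have "inj_on ?h (carrier R)"
    using assms(2) by (simp add: semidualizing_def module_iso_def bij_betw_def regular_module_def)
  moreover have "?h r = ?h \<zero>\<^bsub>R\<^esub>" using assms(4) by (auto simp: restrict_def fun_eq_iff)
  ultimately show ?thesis using assms(3) by (auto dest: inj_onD)
qed

text \<open>The isomorphism is the explicit \<open>Ext_tensor_map\<close>. Naturality is given by
  its commuting squares, covariant in \<open>N\<close> and contravariant in \<open>M\<close>;
  \<open>N'\<close> and \<open>M'\<close> range over modules in types of their own.\<close>

theorem theorem4p5:
  fixes R :: "('a, 'r) ring_scheme"
    and C :: "('a, 'c) module"
    and M :: "('a, 'm) module"
    and N :: "('a, 'n) module"
    and n :: nat
  assumes "noetherian_local_ring R"
    and "semidualizing R C"
    and "fg_module R M"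
    and "fg_module R N"
    and "auslander_class R C N"
    and "\<And>i. i \<le> n \<Longrightarrow> auslander_class R C (Ext R i M N)"
  shows "\<forall>i\<le>n.
    module_iso R (tensor_module R (Ext R i M N) C) (Ext R i M (tensor_module R N C))
      (Ext_tensor_map R i M N C) \<and>
    (\<forall>(N' :: ('a, 'p) module) g. fg_module R N' \<longrightarrow> linear_map R N N' g \<longrightarrow>
      (\<forall>t\<in>carrier (tensor_module R (Ext R i M N) C).
        Ext_map_right R i M (tensor_module R N C) (tensor_module R N' C)
          (tensor_map R N C N' C g id) (Ext_tensor_map R i M N C t) =
        Ext_tensor_map R i M N' C
          (tensor_map R (Ext R i M N) C (Ext R i M N') C (Ext_map_right R i M N N' g) id t))) \<and>
    (\<forall>(M' :: ('a, 'k) module) f. fg_module R M' \<longrightarrow> linear_map R M' M f \<longrightarrow>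
      (\<forall>t\<in>carrier (tensor_module R (Ext R i M N) C).
        Ext_map_left R i M' M (tensor_module R N C) f (Ext_tensor_map R i M N C t) =
        Ext_tensor_map R i M' N C
          (tensor_map R (Ext R i M N) C (Ext R i M' N) C (Ext_map_left R i M' M N f) id t)))"
proof (intro allI impI conjI ballI)
  have R: "cring R" "noetherian_ring R" and one: "\<one>\<^bsub>R\<^esub> \<noteq> \<zero>\<^bsub>R\<^esub>"
    using assms(1) maximalideal.one_neq_zero unfolding noetherian_local_ring_def by auto
  have C: "fg_module R C" "module R C" and M: "module R M" and N: "module R N"
    using assms(2-4) by (auto simp: semidualizing_def fg_module_def)
  interpret faithful_over_noetherian R C
    by (rule faithful_over_noetherian.intro[OF R(2) C(1) one semidualizing_faithful[OF R(1) assms(2)]])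
  note core = auslander_core_of_class[OF C(2) one]
  fix i assume i: "i \<le> n"
  show "module_iso R (tensor_module R (Ext R i M N) C) (Ext R i M (tensor_module R N C)) (Ext_tensor_map R i M N C)"
    unfolding module_iso_def
    using linear_Ext_tensor_map[OF M N C(2) one] Ext_tensor_map_bij[OF M core[OF assms(5)] core[OF assms(6)] i] by blast
  fix t assume t: "t \<in> carrier (tensor_module R (Ext R i M N) C)"
  show "Ext_map_right R i M (tensor_module R N C) (tensor_module R N' C)
      (tensor_map R N C N' C g id) (Ext_tensor_map R i M N C t) =
    Ext_tensor_map R i M N' C (tensor_map R (Ext R i M N) C (Ext R i M N') C (Ext_map_right R i M N N' g) id t)"
    if "fg_module R N'" "linear_map R N N' g" for N' :: "('a, 'p) module" and g
    using that by (intro Ext_tensor_map_natural_right[OF M N _ C(2) one _ t]) (auto simp: fg_module_def)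
  show "Ext_map_left R i M' M (tensor_module R N C) f (Ext_tensor_map R i M N C t) =
    Ext_tensor_map R i M' N C (tensor_map R (Ext R i M N) C (Ext R i M' N) C (Ext_map_left R i M' M N f) id t)"
    if "fg_module R M'" "linear_map R M' M f" for M' :: "('a, 'k) module" and f
    using that by (intro Ext_tensor_map_natural_left[OF _ M N C(2) one _ t]) (auto simp: fg_module_def)
qed

end
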